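(* Let $H$ be a non-bi-arc graph. Then for $\varepsilon=2^{1-c^*(H)}$, List $H$-Coloring parameterized by the size $k$ of a minimum vertex cover of the input graph admits a kernel with $\mathcal{O}(k^{d^*(H)+1-\varepsilon})$ vertices and edges.
   Context: Graphs may have loops; $N(v)$ is the neighborhood of $v$. Vertices $u,v$ are incomparable if neither $N(u)\subseteq N(v)$ nor $N(v)\subseteq N(u)$. List $H$-Coloring: given $G$ and lists $\mathcal{L}\colon V(G)\to 2^{V(H)}$, decide whether there is an edge-preserving map $\varphi\colon V(G)\to V(H)$ with $\varphi(v)\in\mathcal{L}(v)$ for all $v$. A kernel with $f(k)$ vertices and edges is a polynomial-time algorithm producing an equivalent instance of List $H$-Coloring of at most $f(k)$ vertices and edges. Bi-arc graph: fix a circle with two distinct points $p,q$; a bi-arc is a pair $(N,S)$ of arcs with $p\in N\not\ni q$, $q\in S\not\ni p$; $H$ is bi-arc if there are bi-arcs $(N_x,S_x)_{x\in V(H)}$ such that for all (not necessarily distinct) $x,y$: $xy\in E(H)$ implies $N_x\cap S_y=N_y\cap S_x=\emptyset$, and $xy\notin E(H)$ implies $N_x\cap S_y\ne\emptyset\ne N_y\cap S_x$. A set $S$ has a common neighbor in $L$ if some vertex of $L$ is adjacent to all of $S$. $c^*(H)$ is the maximum over $L\subseteq V(H)$ of the largest size of an inclusion-minimal $S\subseteq V(H)$ without a common neighbor in $L$. A lower bound structure of order $d$: a set $L\subseteq V(H)$, distinct $x_1,\dots,x_d$, not necessarily distinct $x_1',\dots,x_d'$ with $x_i,x_i'$ incomparable,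 $\bigcap_i N(x_i)\cap L=\emptyset$, and $\bigcap_i N(y_i)\cap L\ne\emptyset$ for every choice $y_i\in\{x_i,x_i'\}$ with at least one $y_i=x_i'$. $d^*(H)$ is the largest order of a lower bound structure in $H$. *)

theory Defs
  imports
    "HOL-Analysis.Analysis"
    "HOL-Library.Landau_Symbols"
    "HOL-Computational_Algebra.Polynomial"
begin

text \<open>A loop at \<open>v\<close> is the singleton edge \<open>{v} = {v, v}\<close>.\<close>

record 'a graph =
  verts :: "'a set"
  edges :: "'a set set"

definition graph :: "'a graph \<Rightarrow> bool" where
  "graph G \<longleftrightarrow> finite (verts G) \<and> (\<forall>e\<in>edges G. \<exists>u\<in>verts G. \<exists>v\<in>verts G. e = {u, v})"

definition nbh :: "'a graph \<Rightarrow> 'a \<Rightarrow> 'a set" where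
  "nbh G v = {u \<in> verts G. {u, v} \<in> edges G}"

definition incomparable :: "'a graph \<Rightarrow> 'a \<Rightarrow> 'a \<Rightarrow> bool" where
  "incomparable G u v \<longleftrightarrow> \<not> nbh G u \<subseteq> nbh G v \<and> \<not> nbh G v \<subseteq> nbh G u"

definition vertex_cover :: "'a graph \<Rightarrow> 'a set \<Rightarrow> bool" where
  "vertex_cover G C \<longleftrightarrow> C \<subseteq> verts G \<and> (\<forall>e\<in>edges G. e \<inter> C \<noteq> {})"

definition vc_number :: "'a graph \<Rightarrow> nat" where
  "vc_number G = (LEAST k. \<exists>C. vertex_cover G C \<and> card C = k)"

definition circle :: "complex set" where
  "circle = sphere 0 1"

text \<open>
  Arcs are closed and non-degenerate. For a finite graph, the existence of a bi-arc
  representation does not depend on whether arcs contain their endpoints, nor on the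
  choice of the two points \<open>p \<noteq> q\<close>.
\<close>

definition circle_arc :: "complex set \<Rightarrow> bool" where
  "circle_arc A \<longleftrightarrow> A \<subseteq> circle \<and> (\<exists>g. arc g \<and> path_image g = A)"

definition bi_arc :: "complex \<Rightarrow> complex \<Rightarrow> complex set \<Rightarrow> complex set \<Rightarrow> bool" where
  "bi_arc p q N S \<longleftrightarrow>
     circle_arc N \<and> circle_arc S \<and> p \<in> N \<and> q \<notin> N \<and> q \<in> S \<and> p \<notin> S"

definition bi_arc_graph :: "'a graph \<Rightarrow> bool" where
  "bi_arc_graph H \<longleftrightarrow>
     (\<exists>p\<in>circle. \<exists>q\<in>circle. p \<noteq> q \<and>
       (\<exists>N S. (\<forall>x\<in>verts H. bi_arc p q (N x) (S x)) \<and>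
         (\<forall>x\<in>verts H. \<forall>y\<in>verts H.
            ({x, y} \<in> edges H \<longrightarrow> N x \<inter> S y = {} \<and> N y \<inter> S x = {}) \<and>
            ({x, y} \<notin> edges H \<longrightarrow> N x \<inter> S y \<noteq> {} \<and> N y \<inter> S x \<noteq> {}))))"

definition has_common_nbr :: "'a graph \<Rightarrow> 'a set \<Rightarrow> 'a set \<Rightarrow> bool" where
  "has_common_nbr H L S \<longleftrightarrow> (\<exists>z\<in>L. \<forall>s\<in>S. z \<in> nbh H s)"

definition minimal_without_common_nbr :: "'a graph \<Rightarrow> 'a set \<Rightarrow> 'a set \<Rightarrow> bool" where
  "minimal_without_common_nbr H L S \<longleftrightarrow>
     S \<subseteq> verts H \<and> \<not> has_common_nbr H L S \<and> (\<forall>T. T \<subset> S \<longrightarrow> has_common_nbr H L T)"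

text \<open>The pair \<open>L = S = {}\<close> always qualifies, so the maximum is over a nonempty set.\<close>

definition c_star :: "'a graph \<Rightarrow> nat" where
  "c_star H = Max {card S |L S. L \<subseteq> verts H \<and> minimal_without_common_nbr H L S}"

definition lower_bound_structure ::
    "'a graph \<Rightarrow> nat \<Rightarrow> 'a set \<Rightarrow> (nat \<Rightarrow> 'a) \<Rightarrow> (nat \<Rightarrow> 'a) \<Rightarrow> bool" where
  "lower_bound_structure H d L x x' \<longleftrightarrow>
     L \<subseteq> verts H \<and>
     (\<forall>i<d. x i \<in> verts H \<and> x' i \<in> verts H \<and> incomparable H (x i) (x' i)) \<and>
     inj_on x {..<d} \<and>
     (\<Inter>i<d. nbh H (x i)) \<inter> L = {} \<and>
     (\<forall>y. (\<forall>i<d. y i = x i \<or> y i = x' i) \<and> (\<exists>i<d. y i = x' i) \<longrightarrow>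
        (\<Inter>i<d. nbh H (y i)) \<inter> L \<noteq> {})"

text \<open>
  Order \<open>0\<close> (with \<open>L = {}\<close>) only serves to give the value \<open>0\<close> to graphs that have
  no lower bound structure of positive order.
\<close>

definition d_star :: "'a graph \<Rightarrow> nat" where
  "d_star H = Max {d. \<exists>L x x'. lower_bound_structure H d L x x'}"

definition instance_of :: "'h graph \<Rightarrow> 'v graph \<Rightarrow> ('v \<Rightarrow> 'h set) \<Rightarrow> bool" where
  "instance_of H G L \<longleftrightarrow> graph G \<and> (\<forall>v\<in>verts G. L v \<subseteq> verts H)"

definition list_colorable :: "'h graph \<Rightarrow> 'v graph \<Rightarrow> ('v \<Rightarrow> 'h set) \<Rightarrow> bool" where
  "list_colorable H G L \<longleftrightarrow>
     (\<exists>\<phi>. (\<forall>v\<in>verts G. \<phi> v \<in> L v) \<and>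
          (\<forall>u v. {u, v} \<in> edges G \<longrightarrow> {\<phi> u, \<phi> v} \<in> edges H))"

text \<open>
  The machine model is the WHILE language on binary trees (N. D. Jones, Computability and
  Complexity from a Programming Perspective). Every operation is charged the full size of the
  trees it handles, so that running times are polynomially related to those of Turing machines,
  and a program cannot build trees larger than its running time.
\<close>

datatype data = Leaf | Node data data

datatype expr =
    Var nat
  | Nil_E
  | Cons_E expr expr
  | Hd_E expr
  | Tl_E expr
  | Eq_E expr expr

datatype com =
    Skip
  | Assign nat expr
  | Seq com com
  | If expr com com
  | While expr com

type_synonym store = "nat \<Rightarrow> data"

fun hd_data :: "data \<Rightarrow> data" where
  "hd_data Leaf = Leaf"
| "hd_data (Node a b) = a"

fun tl_data :: "data \<Rightarrow> data" where
  "tl_data Leaf = Leaf"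
| "tl_data (Node a b) = b"

text \<open>\<open>Leaf\<close> is false, every other tree is true.\<close>

fun val :: "expr \<Rightarrow> store \<Rightarrow> data" where
  "val (Var x) s = s x"
| "val Nil_E s = Leaf"
| "val (Cons_E a b) s = Node (val a s) (val b s)"
| "val (Hd_E a) s = hd_data (val a s)"
| "val (Tl_E a) s = tl_data (val a s)"
| "val (Eq_E a b) s = (if val a s = val b s then Node Leaf Leaf else Leaf)"

fun cost :: "expr \<Rightarrow> store \<Rightarrow> nat" where
  "cost (Var x) s = Suc (size (s x))"
| "cost Nil_E s = 1"
| "cost (Cons_E a b) s = cost a s + cost b s + Suc (size (val (Cons_E a b) s))"
| "cost (Hd_E a) s = cost a s + Suc (size (val a s))"
| "cost (Tl_E a) s = cost a s + Suc (size (val a s))"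
| "cost (Eq_E a b) s = cost a s + cost b s + Suc (size (val a s) + size (val b s))"

text \<open>\<open>exec c s t s'\<close>: started in \<open>s\<close>, the program \<open>c\<close> halts in \<open>s'\<close> after time \<open>t\<close>.\<close>

inductive exec :: "com \<Rightarrow> store \<Rightarrow> nat \<Rightarrow> store \<Rightarrow> bool" where
  Skip: "exec Skip s 1 s"
| Assign: "exec (Assign x e) s (Suc (cost e s)) (s(x := val e s))"
| Seq: "exec c1 s t1 s1 \<Longrightarrow> exec c2 s1 t2 s2 \<Longrightarrow> exec (Seq c1 c2) s (Suc (t1 + t2)) s2"
| IfTrue: "val e s \<noteq> Leaf \<Longrightarrow> exec c1 s t s' \<Longrightarrow> exec (If e c1 c2) s (Suc (cost e s + t)) s'"
| IfFalse: "val e s = Leaf \<Longrightarrow> exec c2 s t s' \<Longrightarrow> exec (If e c1 c2) s (Suc (cost e s + t)) s'"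
| WhileFalse: "val e s = Leaf \<Longrightarrow> exec (While e c) s (Suc (cost e s)) s"
| WhileTrue: "val e s \<noteq> Leaf \<Longrightarrow> exec c s t1 s1 \<Longrightarrow> exec (While e c) s1 t2 s2 \<Longrightarrow>
    exec (While e c) s (Suc (cost e s + t1 + t2)) s2"

text \<open>Input and output are passed in variable \<open>0\<close>; all other variables start as \<open>Leaf\<close>.\<close>

definition computes_within :: "com \<Rightarrow> data \<Rightarrow> nat \<Rightarrow> data \<Rightarrow> bool" where
  "computes_within c d T r \<longleftrightarrow>
     (\<exists>t s. exec c ((\<lambda>_. Leaf)(0 := d)) t s \<and> t \<le> T \<and> s 0 = r)"

text \<open>Binary, least significant bit first.\<close>

fun enc_nat :: "nat \<Rightarrow> data" where
  "enc_nat n = (if n = 0 then Leaf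
     else Node (if odd n then Node Leaf Leaf else Leaf) (enc_nat (n div 2)))"

declare enc_nat.simps [simp del]

fun enc_list :: "data list \<Rightarrow> data" where
  "enc_list [] = Leaf"
| "enc_list (a # as) = Node a (enc_list as)"

text \<open>
  An instance is written as its vertices, each with its list, followed by its edges, all in
  arbitrary order. Vertices of \<open>H\<close> are named by the numbering \<open>\<nu>\<close>.
\<close>

definition encodes ::
    "('h \<Rightarrow> nat) \<Rightarrow> nat graph \<Rightarrow> (nat \<Rightarrow> 'h set) \<Rightarrow> data \<Rightarrow> bool" where
  "encodes \<nu> G L d \<longleftrightarrow>
     (\<exists>vs ls es.
        distinct vs \<and> set vs = verts G \<and>
        (\<forall>v\<in>verts G. distinct (ls v) \<and> set (ls v) = L v) \<and>
        distinct (map (\<lambda>(u, v). {u, v}) es) \<and> (\<lambda>(u, v). {u, v}) ` set es = edges G \<and>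
        d = Node
          (enc_list (map (\<lambda>v. Node (enc_nat v) (enc_list (map (enc_nat \<circ> \<nu>) (ls v)))) vs))
          (enc_list (map (\<lambda>(u, v). Node (enc_nat u) (enc_nat v)) es)))"

text \<open>
  The parameter is the vertex cover number of the input graph itself; neither it nor a vertex
  cover is part of the input. The program may depend on the fixed graph \<open>H\<close> and on the
  numbering of its vertices.
\<close>

definition admits_vc_kernel :: "'h graph \<Rightarrow> (nat \<Rightarrow> real) \<Rightarrow> bool" where
  "admits_vc_kernel H f \<longleftrightarrow>
     (\<forall>\<nu>. inj_on \<nu> (verts H) \<longrightarrow>
       (\<exists>(c :: com) (p :: nat poly). \<forall>(G :: nat graph) L d.
          instance_of H G L \<and> encodes \<nu> G L d \<longrightarrow>
          (\<exists>(G' :: nat graph) L' d'.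
             computes_within c d (poly p (size d)) d' \<and>
             instance_of H G' L' \<and> encodes \<nu> G' L' d' \<and>
             (list_colorable H G' L' \<longleftrightarrow> list_colorable H G L) \<and>
             real (card (verts G') + card (edges G')) \<le> f (vc_number G))))"

end

theory Submission imports Defs
begin

text \<open>
  Let \<open>X\<close> be a vertex cover of at most twice the minimum size (endpoints of a maximal
  matching) and shrink every list to pairwise incomparable colors. A vertex outside \<open>X\<close> with
  list \<open>L\<close> can be colored iff the colors of its neighbors have a common neighbor in \<open>L\<close>, which
  has to be tested for sets of at most \<open>c_star H\<close> neighbors. So it may be replaced by one
  new vertex for every tuple of at most \<open>c_star H\<close> of its neighbors, shared by all vertices with
  the same list \<open>L\<close>, leaving \<open>O(k ^ c_star H)\<close> constraints.

  Always \<open>c_star H \<le> d_star H + 1\<close>. In case of equality, consider two tuples \<open>s\<close>, \<open>t\<close> of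
  length \<open>c_star H\<close> that differ in every coordinate, such that the entries of each coordinate have
  the same list. If all mixtures of \<open>s\<close> and \<open>t\<close> carry the same constraint, that of \<open>s\<close> follows
  from the others, since otherwise the colors of \<open>s\<close> and \<open>t\<close> would form a lower bound structure
  of order \<open>c_star H\<close>. Deleting such \<open>s\<close> greedily leaves a hypergraph without boxes, and Erdos'
  bound for these gains the \<open>\<epsilon>\<close> in the exponent. For \<open>c_star H = 2\<close> the edges inside \<open>X\<close>
  may be too many and are thinned out in the same way.

  If \<open>c_star H = 1\<close>, the neighborhoods in \<open>H\<close> form a chain and the instance can be solved, and
  \<open>c_star H = 0\<close> is impossible, as \<open>H\<close> would be a complete graph with loops, hence bi-arc.
\<close>

section \<open>Polynomial-time functions on binary trees\<close>

text \<open>Each clause in the deletion rule answers one clause of a lower bound structure. Colors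
  from the same reduced list are equal or incomparable, hence the condition on the lists of a
  coordinate. If \<open>s\<close> and \<open>t\<close> get the same color in some coordinate, the
  mixture that differs from \<open>s\<close> only there has the color set of \<open>s\<close> and
  settles it. If \<open>s\<close> repeats a color, fewer than \<open>c_star H\<close> colors are
  involved; these are tested by shorter tuples, which are never deleted and number only
  \<open>O(k ^ (c_star H - 1))\<close>. Erdos' exponent for tuples of length \<open>c\<close> is
  \<open>c - 2 powr (1 - c)\<close>, the claimed one if \<open>c = d_star H + 1\<close>. If
  \<open>c \<le> d_star H\<close>, all tuples fit, as \<epsilon> is at most 1. An edge inside the
  cover is a tuple of length 2, so it counts as short unless \<open>c = 2\<close>. For the running
  time, explicit programs are confined to a few closure rules.\<close>

definition pbounded :: "(nat \<Rightarrow> nat) \<Rightarrow> bool" where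
  "pbounded q \<longleftrightarrow> mono q \<and> (\<exists>p. \<forall>n. q n \<le> poly p n)"

lemma mono_poly_nat: "mono (poly (p :: nat poly))"
proof (induction p)
  case (pCons a p)
  then show ?case by (auto simp: mono_def intro!: add_mono mult_mono)
qed (simp add: mono_def)

lemma pboundedI: "mono q \<Longrightarrow> (\<And>n. q n \<le> poly p n) \<Longrightarrow> pbounded q"
  by (auto simp: pbounded_def)

lemma pbounded_const [intro!]: "pbounded (\<lambda>_. k)"
  by (rule pboundedI[of _ "[:k:]"]) (auto simp: mono_def)

lemma pbounded_id [intro!]: "pbounded (\<lambda>n. n)"
  by (rule pboundedI[of _ "[:0, 1:]"]) (auto simp: mono_def)

lemma pbounded_add [intro!]:
  assumes "pbounded q" "pbounded r" shows "pbounded (\<lambda>n. q n + r n)"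
proof -
  obtain p p' where "\<forall>n. q n \<le> poly p n" "\<forall>n. r n \<le> poly p' n"
    using assms by (auto simp: pbounded_def)
  then show ?thesis
    using assms by (intro pboundedI[of _ "p + p'"]) (auto simp: pbounded_def mono_def intro: add_mono)
qed

lemma pbounded_mult [intro!]:
  assumes "pbounded q" "pbounded r" shows "pbounded (\<lambda>n. q n * r n)"
proof -
  obtain p p' where "\<forall>n. q n \<le> poly p n" "\<forall>n. r n \<le> poly p' n"
    using assms by (auto simp: pbounded_def)
  then show ?thesis
    using assms by (intro pboundedI[of _ "p * p'"]) (auto simp: pbounded_def mono_def intro: mult_mono)
qed

lemma pbounded_comp:
  assumes "pbounded q" "pbounded r" shows "pbounded (\<lambda>n. q (r n))"
proof -
  obtain p p' where p: "\<And>n. q n \<le> poly p n" "\<And>n. r n \<le> poly p' n"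
    using assms by (auto simp: pbounded_def)
  have "q (r n) \<le> poly (pcompose p p') n" for n
    using p(1)[of "r n"] monoD[OF mono_poly_nat p(2), of p n] by (simp add: poly_pcompose)
  then show ?thesis
    using assms by (intro pboundedI[of _ "pcompose p p'"]) (auto simp: pbounded_def mono_def)
qed

lemma pbounded_Suc [intro!]: "pbounded q \<Longrightarrow> pbounded (\<lambda>n. Suc (q n))"
  using pbounded_add[of q "\<lambda>_. 1", OF _ pbounded_const] by simp

lemma pbounded_mono: "pbounded q \<Longrightarrow> m \<le> n \<Longrightarrow> q m \<le> q n"
  by (auto simp: pbounded_def mono_def)

text \<open>
  Variables from \<open>m\<close> on may hold anything and are left alone, and the scratch variables
  below \<open>m\<close> are clean before and after. This makes such programs composable.
\<close>

definition runs :: "com \<Rightarrow> nat \<Rightarrow> (data \<Rightarrow> data) \<Rightarrow> (nat \<Rightarrow> nat) \<Rightarrow> bool" where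
  "runs c m f q \<longleftrightarrow> pbounded q \<and>
     (\<forall>s. (\<forall>i. 0 < i \<and> i < m \<longrightarrow> s i = Leaf) \<longrightarrow>
        (\<exists>t. exec c s t (s(0 := f (s 0))) \<and> t + size (f (s 0)) \<le> q (size (s 0))))"

definition ptime :: "(data \<Rightarrow> data) \<Rightarrow> bool" where
  "ptime f \<longleftrightarrow> (\<exists>c m q. runs c m f q)"

text \<open>A larger scratch area only strengthens the assumption on the initial store. Hence two
  programs can share one bound \<open>m'\<close>, and variables from \<open>m'\<close> on are free
  for a surrounding program to keep values in.\<close>

lemma ptime_runs:
  assumes "ptime f" shows "\<exists>c m q. \<forall>m'\<ge>m. runs c m' f q"
proof -
  obtain c m q where "runs c m f q" using assms by (auto simp: ptime_def)
  then have "runs c m' f q" if "m \<le> m'" for m'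
    using that unfolding runs_def by (meson order_less_le_trans)
  then show ?thesis by blast
qed

lemma runsE:
  assumes "runs c m f q" "\<And>i. 0 < i \<Longrightarrow> i < m \<Longrightarrow> s i = Leaf"
  obtains t where "exec c s t (s(0 := f (s 0)))" "t + size (f (s 0)) \<le> q (size (s 0))"
  using assms unfolding runs_def by blast

lemma ptime_comp:
  assumes "ptime f" "ptime g" shows "ptime (\<lambda>d. f (g d))"
proof -
  obtain m c q where "\<forall>m'\<ge>m. runs c m' f q" using ptime_runs[OF assms(1)] by (elim exE) (rule that)
  then have f: "\<And>m'. m \<le> m' \<Longrightarrow> runs c m' f q" by simp
  obtain n c' r where "\<forall>m'\<ge>n. runs c' m' g r" using ptime_runs[OF assms(2)] by (elim exE) (rule that)
  then have g: "\<And>m'. n \<le> m' \<Longrightarrow> runs c' m' g r" by simp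
  let ?k = "max m n" and ?q = "\<lambda>d. Suc (r d + q (r d))"
  have q: "pbounded q" "pbounded r" using f[of m] g[of n] by (auto simp: runs_def)
  have "runs (Seq c' c) ?k (\<lambda>d. f (g d)) ?q"
    unfolding runs_def
  proof (intro conjI allI impI)
    show "pbounded ?q" by (intro pbounded_Suc pbounded_add pbounded_comp[OF q] q)
    fix s :: store assume s: "\<forall>i. 0 < i \<and> i < ?k \<longrightarrow> s i = Leaf"
    obtain t where t: "exec c' s t (s(0 := g (s 0)))" "t + size (g (s 0)) \<le> r (size (s 0))"
      by (rule runsE[OF g[of ?k], of s]) (use s in simp_all)
    obtain u where u: "exec c (s(0 := g (s 0))) u (s(0 := f (g (s 0))))"
        "u + size (f (g (s 0))) \<le> q (size (g (s 0)))"
      by (rule runsE[OF f[of ?k], of "s(0 := g (s 0))"]) (use s in simp_all)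
    \<comment> \<open>The bound in \<open>runs\<close> covers the output size besides the time, so
      \<open>r\<close> bounds the input of the second program; monotonicity of \<open>q\<close> does
      the rest.\<close>
    have "q (size (g (s 0))) \<le> q (r (size (s 0)))"
      using t(2) by (intro pbounded_mono[OF q(1)]) simp
    then have "Suc (t + u) + size (f (g (s 0))) \<le> ?q (size (s 0))"
      using t(2) u(2) by linarith
    then show "\<exists>t. exec (Seq c' c) s t (s(0 := f (g (s 0)))) \<and> t + size (f (g (s 0))) \<le> ?q (size (s 0))"
      using exec.Seq[OF t(1) u(1)] by blast
  qed
  then show ?thesis by (auto simp: ptime_def)
qed

lemma ptime_expr:
  assumes "\<And>s. val e s = f (s 0)" "\<And>s. Suc (cost e s + size (f (s 0))) \<le> K * size (s 0) + K"
  shows "ptime f"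
proof -
  have "exec (Assign 0 e) s (Suc (cost e s)) (s(0 := f (s 0)))" for s
    using exec.Assign[of 0 e s] by (simp only: assms(1))
  moreover have "Suc (cost e s) + size (f (s 0)) \<le> K * size (s 0) + K" for s
    using assms(2)[of s] by simp
  moreover have "pbounded (\<lambda>n. K * n + K)" by (intro pbounded_add pbounded_mult pbounded_const pbounded_id)
  ultimately have "runs (Assign 0 e) 0 f (\<lambda>n. K * n + K)"
    unfolding runs_def by blast
  then show ?thesis by (auto simp: ptime_def)
qed

lemma size_hd_tl_data: "size (hd_data d) \<le> size d" "size (tl_data d) \<le> size d"
  by (cases d; simp)+

lemma ptime_id: "ptime (\<lambda>d. d)"
  by (rule ptime_expr[of "Var 0" _ 2]) auto

lemma ptime_hd_tl_id: "ptime hd_data" "ptime tl_data"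
proof -
  have "Suc (cost (Hd_E (Var 0)) s + size (hd_data (s 0))) \<le> 4 * size (s 0) + 4"
    "Suc (cost (Tl_E (Var 0)) s + size (tl_data (s 0))) \<le> 4 * size (s 0) + 4" for s
    using size_hd_tl_data[of "s 0"] by simp_all
  then show "ptime hd_data" "ptime tl_data"
    using ptime_expr[of "Hd_E (Var 0)" hd_data 4] ptime_expr[of "Tl_E (Var 0)" tl_data 4] by simp_all
qed

fun const_expr :: "data \<Rightarrow> expr" where
  "const_expr Leaf = Nil_E"
| "const_expr (Node a b) = Cons_E (const_expr a) (const_expr b)"

lemma val_const_expr [simp]: "val (const_expr k) s = k"
  by (induction k) auto

lemma cost_const_expr: "cost (const_expr k) s = cost (const_expr k) s'"
  by (induction k) auto

lemma ptime_const: "ptime (\<lambda>_. k)"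
proof (rule ptime_expr)
  fix s
  show "Suc (cost (const_expr k) s + size k) \<le> Suc (cost (const_expr k) (\<lambda>_. Leaf) + size k) * size (s 0) +
      Suc (cost (const_expr k) (\<lambda>_. Leaf) + size k)"
    using cost_const_expr[of k s "\<lambda>_. Leaf"] by simp
qed auto

lemmas ptime_hd [intro!] = ptime_comp[OF ptime_hd_tl_id(1)]
lemmas ptime_tl [intro!] = ptime_comp[OF ptime_hd_tl_id(2)]
declare ptime_id [intro!] ptime_const [intro!]

text \<open>The first program overwrites the input in variable \<open>0\<close>. Variables
  \<open>k\<close> and \<open>Suc k\<close>, above both scratch areas, keep the input and the first
  result, and are reset to \<open>Leaf\<close> at the end so that the compound program is clean
  again.\<close>

lemma ptime_Node [intro!]:
  assumes "ptime f" "ptime g" shows "ptime (\<lambda>d. Node (f d) (g d))"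
proof -
  obtain m c q where "\<forall>m'\<ge>m. runs c m' f q" using ptime_runs[OF assms(1)] by (elim exE) (rule that)
  then have f: "\<And>m'. m \<le> m' \<Longrightarrow> runs c m' f q" by simp
  obtain n c' r where "\<forall>m'\<ge>n. runs c' m' g r" using ptime_runs[OF assms(2)] by (elim exE) (rule that)
  then have g: "\<And>m'. n \<le> m' \<Longrightarrow> runs c' m' g r" by simp
  have q: "pbounded q" "pbounded r" using f[of m] g[of n] by (auto simp: runs_def)
  define k where "k = Suc (max m n)"
  have k: "m \<le> k" "n \<le> k" "0 < k" by (auto simp: k_def)
  let ?q = "\<lambda>d. 40 + (d + d + d) + (q d + q d + q d + q d) + (r d + r d + r d + r d)"
  let ?c = "Seq (Assign k (Var 0)) (Seq c (Seq (Assign (Suc k) (Var 0)) (Seq (Assign 0 (Var k))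
    (Seq c' (Seq (Assign 0 (Cons_E (Var (Suc k)) (Var 0)))
      (Seq (Assign k Nil_E) (Assign (Suc k) Nil_E)))))))"
  have "runs ?c (Suc (Suc k)) (\<lambda>d. Node (f d) (g d)) ?q"
    unfolding runs_def
  proof (intro conjI allI impI)
    show "pbounded ?q" using q by (intro pbounded_add pbounded_id pbounded_const)
    fix s :: store assume s: "\<forall>i. 0 < i \<and> i < Suc (Suc k) \<longrightarrow> s i = Leaf"
    define d where "d = s 0"
    define s1 where "s1 = s(k := d)"
    obtain t where t: "exec c s1 t (s1(0 := f d))" "t + size (f d) \<le> q (size d)"
      by (rule runsE[OF f[OF k(1)], of s1]) (use s k in \<open>auto simp: s1_def d_def\<close>)
    define s2 where "s2 = s1(0 := d, Suc k := f d)"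
    obtain u where u: "exec c' s2 u (s2(0 := g d))" "u + size (g d) \<le> r (size d)"
      by (rule runsE[OF g[OF k(2)], of s2]) (use s k in \<open>auto simp: s1_def s2_def d_def\<close>)
    have 1: "exec (Assign k (Var 0)) s (Suc (Suc (size d))) s1"
      using exec.Assign[of k "Var 0" s] by (simp add: s1_def d_def)
    have 2: "exec (Assign (Suc k) (Var 0)) (s1(0 := f d)) (Suc (Suc (size (f d)))) (s1(0 := f d, Suc k := f d))"
      using exec.Assign[of "Suc k" "Var 0" "s1(0 := f d)"] by simp
    have 3: "exec (Assign 0 (Var k)) (s1(0 := f d, Suc k := f d)) (Suc (Suc (size d))) s2"
    proof -
      have "(s1(0 := f d, Suc k := f d))(0 := d) = s2" by (auto simp: s2_def)
      then show ?thesis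
        using exec.Assign[of 0 "Var k" "s1(0 := f d, Suc k := f d)"] k by (simp add: s1_def)
    qed
    have 4: "exec (Assign 0 (Cons_E (Var (Suc k)) (Var 0))) (s2(0 := g d))
        (Suc (Suc (size (f d)) + Suc (size (g d)) + Suc (Suc (size (f d) + size (g d)))))
        (s2(0 := Node (f d) (g d)))"
      using exec.Assign[of 0 "Cons_E (Var (Suc k)) (Var 0)" "s2(0 := g d)"] by (simp add: s2_def)
    have 5: "exec (Assign k Nil_E) (s2(0 := Node (f d) (g d))) 2 (s2(0 := Node (f d) (g d), k := Leaf))"
      using exec.Assign[of k Nil_E "s2(0 := Node (f d) (g d))"] by (simp add: numeral_2_eq_2)
    have 6: "exec (Assign (Suc k) Nil_E) (s2(0 := Node (f d) (g d), k := Leaf)) 2 (s(0 := Node (f d) (g d)))"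
    proof -
      have "(s2(0 := Node (f d) (g d), k := Leaf))(Suc k := Leaf) = s(0 := Node (f d) (g d))"
        using s k by (auto simp: s2_def s1_def fun_eq_iff)
      then show ?thesis
        using exec.Assign[of "Suc k" Nil_E "s2(0 := Node (f d) (g d), k := Leaf)"] by (simp add: numeral_2_eq_2)
    qed
    show "\<exists>t. exec ?c s t (s(0 := Node (f (s 0)) (g (s 0)))) \<and>
        t + size (Node (f (s 0)) (g (s 0))) \<le> ?q (size (s 0))"
      unfolding d_def[symmetric]
      by (rule exI, rule conjI, rule exec.Seq[OF 1 exec.Seq[OF t(1) exec.Seq[OF 2 exec.Seq[OF 3
        exec.Seq[OF u(1) exec.Seq[OF 4 exec.Seq[OF 5 6]]]]]]]) (use t(2) u(2) in simp)
  qed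
  then show ?thesis by (auto simp: ptime_def)
qed

text \<open>Functions of several arguments are presented as functions of one tree that has the
  arguments in its head and tail. The same convention, element in the head and environment in the
  tail, is used for the bodies of list operations below.\<close>

lemma ptime_binary:
  assumes "ptime (\<lambda>z. F (hd_data z) (tl_data z))" "ptime f" "ptime g"
  shows "ptime (\<lambda>e. F (f e) (g e))"
  using ptime_comp[OF assms(1) ptime_Node[OF assms(2,3)]] by simp

definition truth :: "bool \<Rightarrow> data" where
  "truth b = (if b then Node Leaf Leaf else Leaf)"

definition ptimeB :: "(data \<Rightarrow> bool) \<Rightarrow> bool" where
  "ptimeB P \<longleftrightarrow> ptime (\<lambda>e. truth (P e))"

lemma ptimeB_eq [intro!]:
  assumes "ptime f" "ptime g" shows "ptimeB (\<lambda>e. f e = g e)"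
proof -
  have "ptime (\<lambda>z. truth (hd_data z = tl_data z))"
  proof (rule ptime_expr)
    show "Suc (cost (Eq_E (Hd_E (Var 0)) (Tl_E (Var 0))) s + size (truth (hd_data (s 0) = tl_data (s 0))))
        \<le> 20 * size (s 0) + 20" for s
      using size_hd_tl_data[of "s 0"] by (simp add: truth_def)
  qed (auto simp: truth_def)
  from ptime_binary[where F = "\<lambda>a b. truth (a = b)", OF this assms] show ?thesis
    by (simp add: ptimeB_def)
qed

text \<open>The truth value travels in the head of the input, next to the actual argument, so
  branching needs no extra variable.\<close>

lemma ptime_cond:
  assumes "ptime f" "ptime g" shows "ptime (\<lambda>z. if hd_data z \<noteq> Leaf then f (tl_data z) else g (tl_data z))"
proof -
  have *: "ptime (\<lambda>z. f (tl_data z))" "ptime (\<lambda>z. g (tl_data z))"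
    using assms[THEN ptime_comp, OF ptime_hd_tl_id(2)] .
  obtain m c q where "\<forall>m'\<ge>m. runs c m' (\<lambda>z. f (tl_data z)) q" using ptime_runs[OF *(1)] by (elim exE) (rule that)
  then have f: "\<And>m'. m \<le> m' \<Longrightarrow> runs c m' (\<lambda>z. f (tl_data z)) q" by simp
  obtain n c' r where "\<forall>m'\<ge>n. runs c' m' (\<lambda>z. g (tl_data z)) r" using ptime_runs[OF *(2)] by (elim exE) (rule that)
  then have g: "\<And>m'. n \<le> m' \<Longrightarrow> runs c' m' (\<lambda>z. g (tl_data z)) r" by simp
  have q: "pbounded q" "pbounded r" using f[of m] g[of n] by (auto simp: runs_def)
  let ?k = "max m n" and ?q = "\<lambda>n. n + n + 3 + q n + r n"
  have "runs (If (Hd_E (Var 0)) c c') ?k (\<lambda>z. if hd_data z \<noteq> Leaf then f (tl_data z) else g (tl_data z)) ?q"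
    unfolding runs_def
  proof (intro conjI allI impI)
    show "pbounded ?q" using q by (intro pbounded_add pbounded_id pbounded_const)
    fix s :: store assume s: "\<forall>i. 0 < i \<and> i < ?k \<longrightarrow> s i = Leaf"
    obtain t where t: "exec c s t (s(0 := f (tl_data (s 0))))" "t + size (f (tl_data (s 0))) \<le> q (size (s 0))"
      by (rule runsE[OF f[of ?k], of s]) (use s in simp_all)
    obtain u where u: "exec c' s u (s(0 := g (tl_data (s 0))))" "u + size (g (tl_data (s 0))) \<le> r (size (s 0))"
      by (rule runsE[OF g[of ?k], of s]) (use s in simp_all)
    show "\<exists>t. exec (If (Hd_E (Var 0)) c c') s t
        (s(0 := if hd_data (s 0) \<noteq> Leaf then f (tl_data (s 0)) else g (tl_data (s 0)))) \<and>
        t + size (if hd_data (s 0) \<noteq> Leaf then f (tl_data (s 0)) else g (tl_data (s 0))) \<le> ?q (size (s 0))"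
    proof (cases "hd_data (s 0) = Leaf")
      case True
      then show ?thesis using exec.IfFalse[OF _ u(1), of "Hd_E (Var 0)" c] u(2)
        by (intro exI conjI) (simp, simp)
    next
      case False
      then show ?thesis using exec.IfTrue[OF _ t(1), of "Hd_E (Var 0)" c'] t(2)
        by (intro exI conjI) (simp, simp)
    qed
  qed
  then show ?thesis by (auto simp: ptime_def)
qed

lemma ptime_if [intro!]:
  assumes "ptimeB P" "ptime f" "ptime g" shows "ptime (\<lambda>e. if P e then f e else g e)"
proof -
  have "(if truth (P e) \<noteq> Leaf then f e else g e) = (if P e then f e else g e)" for e
    by (simp add: truth_def)
  then show ?thesis
    using ptime_comp[OF ptime_cond[OF assms(2,3)] ptime_Node[OF assms(1)[unfolded ptimeB_def] ptime_id]]
    by (simp only: hd_data.simps tl_data.simps)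
qed

lemma ptimeB_const [intro!]: "ptimeB (\<lambda>_. b)"
  by (auto simp: ptimeB_def)

lemma ptimeB_If [intro!]: "ptimeB P \<Longrightarrow> ptimeB Q \<Longrightarrow> ptimeB R \<Longrightarrow> ptimeB (\<lambda>e. if P e then Q e else R e)"
  using ptime_if[of P "\<lambda>e. truth (Q e)" "\<lambda>e. truth (R e)"] by (simp add: ptimeB_def if_distrib[of truth])

lemma ptimeB_conj [intro!]: "ptimeB P \<Longrightarrow> ptimeB Q \<Longrightarrow> ptimeB (\<lambda>e. P e \<and> Q e)"
  using ptimeB_If[of P Q "\<lambda>_. False"] by (simp add: ptimeB_const if_bool_eq_conj imp_conjL conj_commute cong: conj_cong)

lemma ptimeB_not [intro!]: "ptimeB P \<Longrightarrow> ptimeB (\<lambda>e. \<not> P e)"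
  using ptimeB_If[of P "\<lambda>_. False" "\<lambda>_. True"] by (simp add: ptimeB_const if_bool_eq_conj)

lemma ptimeB_disj [intro!]: "ptimeB P \<Longrightarrow> ptimeB Q \<Longrightarrow> ptimeB (\<lambda>e. P e \<or> Q e)"
  using ptimeB_not[OF ptimeB_conj[OF ptimeB_not ptimeB_not], of P Q] by simp

section \<open>Iteration over a list with an accumulator\<close>

text \<open>The body receives the whole remaining list and not just its first element: later
  constructions number an element by the length of its suffix and test membership in that
  suffix.\<close>

fun loop :: "(data \<Rightarrow> data) \<Rightarrow> data \<Rightarrow> data \<Rightarrow> data \<Rightarrow> data" where
  "loop g Leaf env acc = acc"
| "loop g (Node x xs) env acc = loop g xs env (g (Node (Node x xs) (Node env acc)))"

definition loop_com :: "com \<Rightarrow> nat \<Rightarrow> com" where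
  "loop_com c m = While (Var m) (Seq (Assign 0 (Cons_E (Var m) (Cons_E (Var (m + 1)) (Var (m + 2)))))
      (Seq c (Seq (Assign (m + 2) (Var 0)) (Assign m (Tl_E (Var m))))))"

text \<open>The quantity \<open>size acc + size xs * h N\<close> does not increase from round to
  round: a round adds at most \<open>h N\<close> to the accumulator and shortens the list. So
  \<open>M\<close> bounds the accumulator throughout, and each round costs at most the second factor
  of the time bound. The value \<open>a\<close> is whatever the last round leaves in variable
  \<open>0\<close>.\<close>

lemma loop_runs:
  assumes g: "runs c m g q" and "0 < m"
    and h: "mono h" "\<And>xs env acc. size (g (Node xs (Node env acc))) \<le> size acc + h (size xs + size env)"
    and s: "\<And>i. 0 < i \<Longrightarrow> i < m \<Longrightarrow> s i = Leaf"
    and N: "size (s m) + size (s (m + 1)) \<le> N" "size (s (m + 2)) + size (s m) * h N \<le> M"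
  shows "\<exists>t a. exec (loop_com c m) s t
      (s(0 := a, m := Leaf, m + 2 := loop g (s m) (s (m + 1)) (s (m + 2)))) \<and>
      t \<le> Suc (size (s m)) * (10 * N + 10 * M + 40 + q (N + M + 2)) \<and>
      size (loop g (s m) (s (m + 1)) (s (m + 2))) \<le> M"
    (is "\<exists>t a. exec ?W _ _ _ \<and> _ \<le> Suc _ * ?K \<and> _")
  using s N
proof (induction "s m" arbitrary: s)
  case Leaf
  have "s = s(0 := s 0, m := Leaf, m + 2 := loop g (s m) (s (m + 1)) (s (m + 2)))"
    using Leaf(1) by (auto simp: fun_eq_iff)
  moreover have "exec ?W s (Suc (cost (Var m) s)) s"
    unfolding loop_com_def using Leaf(1)[symmetric] by (intro exec.WhileFalse) simp
  ultimately have W: "exec ?W s (Suc (cost (Var m) s))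
      (s(0 := s 0, m := Leaf, m + 2 := loop g (s m) (s (m + 1)) (s (m + 2))))"
    by simp
  show ?case
    by (rule exI, rule exI, intro conjI, rule W) (use Leaf(1)[symmetric] Leaf(4) in auto)
next
  case (Node x xs)
  note sm = Node(3)[symmetric]
  define env where "env = s (m + 1)"
  define acc where "acc = s (m + 2)"
  define z where "z = Node (Node x xs) (Node env acc)"
  define s1 where "s1 = s(0 := z)"
  define s2 where "s2 = s1(0 := g z)"
  define s3 where "s3 = s2(m + 2 := g z)"
  define s4 where "s4 = s3(m := xs)"
  have sz: "size x + size xs + 1 + size env \<le> N" "size acc + (size x + size xs + 1) * h N \<le> M"
    using Node.prems(2,3) by (simp_all add: sm env_def acc_def)
  have "h (size (Node x xs) + size env) \<le> h N"
    using sz by (intro monoD[OF h(1)]) simp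
  then have gz: "size (g z) \<le> size acc + h N"
    using h(2)[of "Node x xs" env acc] by (simp add: z_def)
  have M: "size (g z) + size xs * h N \<le> M"
    using gz sz(2) by (simp add: algebra_simps)
  have "size z \<le> N + M + 2"
    using sz by (simp add: z_def)
  then have qz: "q (size z) \<le> q (N + M + 2)"
    using g by (intro pbounded_mono[of q]) (auto simp: runs_def)
  have s1_0: "s1 0 = z" by (simp add: s1_def)
  obtain t where t: "exec c s1 t s2" "t \<le> q (N + M + 2)"
    by (rule runsE[OF g, of s1]) (use Node.prems(1) qz in \<open>auto simp: s1_def s2_def\<close>)
  have e1: "exec (Assign 0 (Cons_E (Var m) (Cons_E (Var (m + 1)) (Var (m + 2))))) s
      (Suc (cost (Cons_E (Var m) (Cons_E (Var (m + 1)) (Var (m + 2)))) s)) s1"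
    using exec.Assign[of 0 "Cons_E (Var m) (Cons_E (Var (m + 1)) (Var (m + 2)))" s]
    by (simp add: s1_def z_def env_def acc_def sm)
  have e2: "exec (Assign (m + 2) (Var 0)) s2 (Suc (cost (Var 0) s2)) s3"
    using exec.Assign[of "m + 2" "Var 0" s2] by (simp add: s3_def s2_def)
  have e3: "exec (Assign m (Tl_E (Var m))) s3 (Suc (cost (Tl_E (Var m)) s3)) s4"
    using exec.Assign[of "m" "Tl_E (Var m)" s3] \<open>0 < m\<close>
    by (simp add: s4_def s3_def s2_def s1_def sm)
  have s4: "s4 m = xs" "s4 (m + 1) = env" "s4 (m + 2) = g z"
    using \<open>0 < m\<close> by (simp_all add: s4_def s3_def s2_def s1_def env_def)
  have "\<exists>t a. exec ?W s4 t (s4(0 := a, m := Leaf, m + 2 := loop g (s4 m) (s4 (m + 1)) (s4 (m + 2)))) \<and>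
      t \<le> Suc (size (s4 m)) * ?K \<and> size (loop g (s4 m) (s4 (m + 1)) (s4 (m + 2))) \<le> M"
  proof (rule Node.hyps(2))
    show "xs = s4 m" by (simp add: s4)
    show "s4 i = Leaf" if "0 < i" "i < m" for i
      using that Node.prems(1)[OF that] by (simp add: s4_def s3_def s2_def s1_def)
    show "size (s4 m) + size (s4 (m + 1)) \<le> N" using sz unfolding s4 by simp
    show "size (s4 (m + 2)) + size (s4 m) * h N \<le> M" using M unfolding s4 .
  qed
  then obtain u a where u: "exec ?W s4 u (s4(0 := a, m := Leaf, m + 2 := loop g xs env (g z)))"
      "u \<le> Suc (size xs) * ?K" "size (loop g xs env (g z)) \<le> M"
    unfolding s4 by blast
  have lp: "loop g (s m) (s (m + 1)) (s (m + 2)) = loop g xs env (g z)"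
    by (simp add: sm z_def env_def acc_def)
  have "s4(0 := a, m := Leaf, m + 2 := loop g xs env (g z)) =
      s(0 := a, m := Leaf, m + 2 := loop g xs env (g z))"
    by (auto simp: s4_def s3_def s2_def s1_def fun_eq_iff)
  note u' = u(1)[unfolded this]
  have "val (Var m) s \<noteq> Leaf" by (simp add: sm)
  note W = exec.WhileTrue[OF this exec.Seq[OF e1 exec.Seq[OF t(1) exec.Seq[OF e2 e3]]] u'[unfolded loop_com_def],
    folded loop_com_def]
  have b1: "cost (Var m) s \<le> N + 2"
    using sz by (simp add: sm)
  have b2: "cost (Cons_E (Var m) (Cons_E (Var (m + 1)) (Var (m + 2)))) s \<le> 3 * N + 3 * M + 12"
    using sz by (simp add: sm env_def acc_def)
  have b3: "cost (Var 0) s2 \<le> M + 1"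
    using M by (simp add: s2_def)
  have "s3 m = s m"
    using \<open>0 < m\<close> by (simp add: s3_def s2_def s1_def)
  then have b4: "cost (Tl_E (Var m)) s3 \<le> 2 * N + 4"
    using sz by (simp add: sm)
  have K: "Suc (size (s m)) * ?K = size x * ?K + ?K + Suc (size xs) * ?K"
    by (simp add: sm algebra_simps)
  show ?case
    unfolding lp
    by (rule exI, rule exI, intro conjI, rule W, unfold K)
      (use b1 b2 b3 b4 u(2,3) t(2) in linarith)+
qed

lemma ptime_loop:
  assumes g: "ptime g" and h: "pbounded h"
    "\<And>xs env acc. size (g (Node xs (Node env acc))) \<le> size acc + h (size xs + size env)"
  shows "ptime (\<lambda>z. loop g (hd_data z) (hd_data (tl_data z)) (tl_data (tl_data z)))"
proof -
  obtain c n q where "\<forall>m'\<ge>n. runs c m' g q" using ptime_runs[OF g] by (elim exE) (rule that)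
  then have g: "runs c (Suc n) g q" by simp
  then have q: "pbounded q" by (simp add: runs_def)
  define m where "m = Suc n"
  have m: "0 < m" by (simp add: m_def)
  note g = g[folded m_def]
  \<comment> \<open>Initial accumulator plus at most \<open>n\<close> rounds, each adding at most
    \<open>h n\<close>.\<close>
  define M where "M = (\<lambda>n. n + n * h n)"
  define K where "K = (\<lambda>n. Suc n * (10 * n + 10 * M n + 40 + q (n + M n + 2)))"
  define r where "r = (\<lambda>n. K n + M n + M n + (20 * n + 100))"
  have M: "pbounded M" unfolding M_def by (intro pbounded_add pbounded_mult pbounded_id h(1))
  have K: "pbounded K" unfolding K_def
    by (intro pbounded_mult pbounded_add pbounded_Suc pbounded_id pbounded_const M pbounded_comp[OF q])
  have r: "pbounded r" unfolding r_def by (intro pbounded_mult pbounded_add pbounded_id pbounded_const M K)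
  let ?W = "loop_com c m"
  let ?c = "Seq (Assign m (Hd_E (Var 0))) (Seq (Assign (m + 1) (Hd_E (Tl_E (Var 0))))
    (Seq (Assign (m + 2) (Tl_E (Tl_E (Var 0)))) (Seq ?W (Seq (Assign 0 (Var (m + 2)))
    (Seq (Assign (m + 1) Nil_E) (Assign (m + 2) Nil_E))))))"
  have "runs ?c (m + 3) (\<lambda>z. loop g (hd_data z) (hd_data (tl_data z)) (tl_data (tl_data z))) r"
    unfolding runs_def
  proof (intro conjI allI impI r)
    fix s :: store assume s: "\<forall>i. 0 < i \<and> i < m + 3 \<longrightarrow> s i = Leaf"
    define z where "z = s 0"
    define d where "d = size z"
    define xs env acc where "xs = hd_data z" and "env = hd_data (tl_data z)" and "acc = tl_data (tl_data z)"
    define res where "res = loop g xs env acc"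
    have sz: "size xs + size env \<le> d" "size acc \<le> d" "size xs \<le> d" "size (tl_data z) \<le> d"
      unfolding d_def xs_def env_def acc_def
      by (cases z; cases "tl_data z"; simp)+
    define s1 where "s1 = s(m := xs)"
    define s2 where "s2 = s1(m + 1 := env)"
    define s3 where "s3 = s2(m + 2 := acc)"
    have e1: "exec (Assign m (Hd_E (Var 0))) s (Suc (cost (Hd_E (Var 0)) s)) s1"
      using exec.Assign[of m "Hd_E (Var 0)" s] by (simp add: s1_def xs_def z_def)
    have e2: "exec (Assign (m + 1) (Hd_E (Tl_E (Var 0)))) s1 (Suc (cost (Hd_E (Tl_E (Var 0))) s1)) s2"
      using exec.Assign[of "m + 1" "Hd_E (Tl_E (Var 0))" s1] m by (simp add: s2_def s1_def env_def z_def)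
    have e3: "exec (Assign (m + 2) (Tl_E (Tl_E (Var 0)))) s2 (Suc (cost (Tl_E (Tl_E (Var 0))) s2)) s3"
      using exec.Assign[of "m + 2" "Tl_E (Tl_E (Var 0))" s2] m by (simp add: s3_def s2_def s1_def acc_def z_def)
    have c1: "cost (Hd_E (Var 0)) s \<le> 2 * d + 4" by (simp add: d_def z_def)
    have c2: "cost (Hd_E (Tl_E (Var 0))) s1 \<le> 3 * d + 6"
      using sz(4) m by (simp add: d_def z_def s1_def)
    have c3: "cost (Tl_E (Tl_E (Var 0))) s2 \<le> 3 * d + 6"
      using sz(4) m by (simp add: d_def z_def s2_def s1_def)
    have s3: "s3 m = xs" "s3 (m + 1) = env" "s3 (m + 2) = acc"
      by (simp_all add: s3_def s2_def s1_def)
    have "\<exists>t a. exec ?W s3 t (s3(0 := a, m := Leaf, m + 2 := loop g (s3 m) (s3 (m + 1)) (s3 (m + 2)))) \<and>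
      t \<le> Suc (size (s3 m)) * (10 * d + 10 * M d + 40 + q (d + M d + 2)) \<and>
      size (loop g (s3 m) (s3 (m + 1)) (s3 (m + 2))) \<le> M d"
    proof (rule loop_runs[OF g m _ h(2)])
      show "mono h" using h(1) by (simp add: pbounded_def)
      show "s3 i = Leaf" if "0 < i" "i < m" for i
        using that s by (simp add: s3_def s2_def s1_def)
      show "size (s3 m) + size (s3 (m + 1)) \<le> d" using sz(1) unfolding s3 .
      show "size (s3 (m + 2)) + size (s3 m) * h d \<le> M d"
        unfolding s3 M_def using sz by (intro add_mono mult_right_mono) auto
    qed
    then obtain t a where t: "exec ?W s3 t (s3(0 := a, m := Leaf, m + 2 := res))"
        "t \<le> Suc (size xs) * (10 * d + 10 * M d + 40 + q (d + M d + 2))" "size res \<le> M d"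
      unfolding s3 res_def by blast
    have "Suc (size xs) * (10 * d + 10 * M d + 40 + q (d + M d + 2)) \<le> K d"
      unfolding K_def using sz by (intro mult_right_mono) auto
    with t(2) have tK: "t \<le> K d" by simp
    define s4 where "s4 = s3(0 := a, m := Leaf, m + 2 := res)"
    define s5 where "s5 = s4(0 := res)"
    define s6 where "s6 = s5(m + 1 := Leaf)"
    have e4: "exec (Assign 0 (Var (m + 2))) s4 (Suc (cost (Var (m + 2)) s4)) s5"
      using exec.Assign[of 0 "Var (m + 2)" s4] by (simp add: s5_def s4_def)
    have c4: "cost (Var (m + 2)) s4 \<le> M d + 1" using t(3) by (simp add: s4_def)
    have e5: "exec (Assign (m + 1) Nil_E) s5 (Suc (cost Nil_E s5)) s6"
      using exec.Assign[of "m + 1" Nil_E s5] by (simp add: s6_def)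
    have "s6(m + 2 := Leaf) = s(0 := res)"
      using s m by (auto simp: s6_def s5_def s4_def s3_def s2_def s1_def fun_eq_iff)
    then have e6: "exec (Assign (m + 2) Nil_E) s6 (Suc (cost Nil_E s6)) (s(0 := res))"
      using exec.Assign[of "m + 2" Nil_E s6] by simp
    have fin: "loop g (hd_data (s 0)) (hd_data (tl_data (s 0))) (tl_data (tl_data (s 0))) = res"
      by (simp add: res_def xs_def env_def acc_def z_def)
    have d: "size (s 0) = d" by (simp add: d_def z_def)
    show "\<exists>t. exec ?c s t (s(0 := loop g (hd_data (s 0)) (hd_data (tl_data (s 0))) (tl_data (tl_data (s 0))))) \<and>
        t + size (loop g (hd_data (s 0)) (hd_data (tl_data (s 0))) (tl_data (tl_data (s 0)))) \<le> r (size (s 0))"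
      unfolding fin
      by (intro exI conjI, rule exec.Seq[OF e1 exec.Seq[OF e2 exec.Seq[OF e3 exec.Seq[OF t(1)[folded s4_def]
          exec.Seq[OF e4 exec.Seq[OF e5 e6]]]]]])
        (use c1 c2 c3 c4 tK t(3) in \<open>simp add: r_def d\<close>)
  qed
  then show ?thesis by (auto simp: ptime_def)
qed

lemma ptime_size:
  assumes "ptime f" obtains q where "pbounded q" "\<And>d. size (f d) \<le> q (size d)"
proof -
  obtain c m q where r: "runs c m f q" using assms by (auto simp: ptime_def)
  have "size (f d) \<le> q (size d)" for d
    by (rule runsE[OF r, of "(\<lambda>_. Leaf)(0 := d)"]) auto
  with r show ?thesis using that by (auto simp: runs_def)
qed

section \<open>Closure rules for functions that return lists\<close>

fun to_list :: "data \<Rightarrow> data list" where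
  "to_list Leaf = []"
| "to_list (Node x xs) = x # to_list xs"

lemma to_list_enc_list [simp]: "to_list (enc_list xs) = xs"
  by (induction xs) auto

lemma enc_list_to_list [simp]: "enc_list (to_list d) = d"
  by (induction d) auto

lemma size_enc_list_append: "size (enc_list (xs @ ys)) = size (enc_list xs) + size (enc_list ys)"
  by (induction xs) auto

definition ptimeL :: "(data \<Rightarrow> data list) \<Rightarrow> bool" where
  "ptimeL F \<longleftrightarrow> ptime (\<lambda>e. enc_list (F e))"

lemma ptimeL_to_list: "ptime f \<Longrightarrow> ptimeL (\<lambda>e. to_list (f e))"
  by (simp add: ptimeL_def)

lemma ptime_enc_list: "ptimeL F \<Longrightarrow> ptime (\<lambda>e. enc_list (F e))"
  by (simp add: ptimeL_def)

lemma ptimeL_comp: "ptimeL F \<Longrightarrow> ptime g \<Longrightarrow> ptimeL (\<lambda>e. F (g e))"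
  unfolding ptimeL_def by (rule ptime_comp)

lemma ptimeL_const: "ptimeL (\<lambda>_. xs)"
  unfolding ptimeL_def by (rule ptime_const)

lemma ptimeL_Cons: "ptime f \<Longrightarrow> ptimeL F \<Longrightarrow> ptimeL (\<lambda>e. f e # F e)"
  unfolding ptimeL_def by (simp add: ptime_Node)

lemma ptimeL_if: "ptimeB P \<Longrightarrow> ptimeL F \<Longrightarrow> ptimeL G \<Longrightarrow> ptimeL (\<lambda>e. if P e then F e else G e)"
  unfolding ptimeL_def by (simp add: if_distrib[of enc_list] ptime_if)

fun foldt :: "('a \<Rightarrow> 'a list \<Rightarrow> 's \<Rightarrow> 's) \<Rightarrow> 'a list \<Rightarrow> 's \<Rightarrow> 's" where
  "foldt g [] s = s"
| "foldt g (x # xs) s = foldt g xs (g x xs s)"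

lemma ptime_foldt:
  assumes F: "ptimeL F" and s0: "ptime s0"
    and G: "ptime (\<lambda>z. G (hd_data (hd_data z)) (to_list (tl_data (hd_data z))) (tl_data (tl_data z)) (hd_data (tl_data z)))"
    and h: "pbounded h" "\<And>x xs s e. size (G x xs s e) \<le> size s + h (size x + size (enc_list xs) + size e)"
  shows "ptime (\<lambda>e. foldt (\<lambda>x xs s. G x xs s e) (F e) (s0 e))"
proof -
  let ?g = "\<lambda>z. G (hd_data (hd_data z)) (to_list (tl_data (hd_data z))) (tl_data (tl_data z)) (hd_data (tl_data z))"
  have "size (?g (Node xs (Node env acc))) \<le> size acc + h (size xs + size env)" for xs env acc
  proof -
    have "h (size (hd_data xs) + size (tl_data xs) + size env) \<le> h (size xs + size env)"
      by (intro pbounded_mono[OF h(1)]) (cases xs; simp)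
    then show ?thesis
      using h(2)[of "hd_data xs" "to_list (tl_data xs)" acc env] by simp
  qed
  note L = ptime_loop[OF G h(1) this]
  have L: "ptime (\<lambda>e. loop ?g (enc_list (F e)) e (s0 e))"
    using ptime_comp[OF L ptime_Node[OF F[unfolded ptimeL_def] ptime_Node[OF ptime_id s0]]]
    unfolding hd_data.simps tl_data.simps .
  have "loop ?g (enc_list xs) e s = foldt (\<lambda>x xs s. G x xs s e) xs s" for xs e s
    by (induction xs arbitrary: s) auto
  with L show ?thesis by simp
qed

lemma foldt_Node: "foldt (\<lambda>x _ s. Node x s) xs s = enc_list (rev xs @ to_list s)"
  by (induction xs arbitrary: s) auto

lemma ptime_foldt_Node:
  assumes "ptimeL F" "ptime s0" shows "ptime (\<lambda>e. foldt (\<lambda>x _ s. Node x s) (F e) (s0 e))"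
  by (rule ptime_foldt[OF assms, where h = Suc and G = "\<lambda>x _ s _. Node x s"]) auto

text \<open>Pushing the elements of one list onto another reverses them, so the first list is
  reversed beforehand by the same operation.\<close>

lemma ptimeL_append: assumes "ptimeL F" "ptimeL G" shows "ptimeL (\<lambda>e. F e @ G e)"
proof -
  have "ptimeL (\<lambda>e. rev (F e))"
    using ptime_foldt_Node[OF assms(1) ptime_const[of Leaf]] by (simp add: ptimeL_def foldt_Node)
  from ptime_foldt_Node[OF this assms(2)[unfolded ptimeL_def]] show ?thesis by (simp add: ptimeL_def foldt_Node)
qed

text \<open>A concatenated map whose function also sees the suffix behind the current element. This
  suffices to drop duplicates and to invent distinct names without keeping a counter.\<close>

fun ctails :: "('a \<Rightarrow> 'a list \<Rightarrow> 'b list) \<Rightarrow> 'a list \<Rightarrow> 'b list" where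
  "ctails g [] = []"
| "ctails g (x # xs) = g x xs @ ctails g xs"

lemma ptimeL_ctails:
  assumes F: "ptimeL F" and G: "ptimeL (\<lambda>z. G (hd_data (hd_data z)) (to_list (tl_data (hd_data z))) (tl_data z))"
  shows "ptimeL (\<lambda>e. ctails (\<lambda>x xs. G x xs e) (F e))"
proof -
  let ?G = "\<lambda>x xs s e. enc_list (to_list s @ G x xs e)"
  have "foldt (\<lambda>x xs s. ?G x xs s e) xs s = enc_list (to_list s @ ctails (\<lambda>x xs. G x xs e) xs)" for e xs s
    by (induction xs arbitrary: s) auto
  then have eq: "enc_list (ctails (\<lambda>x xs. G x xs e) (F e)) = foldt (\<lambda>x xs s. ?G x xs s e) (F e) Leaf" for e
    by simp
  obtain q where q: "pbounded q" "\<And>z. size (enc_list (G (hd_data (hd_data z)) (to_list (tl_data (hd_data z))) (tl_data z))) \<le> q (size z)"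
    using ptime_size[OF G[unfolded ptimeL_def]] by blast
  have "ptimeL (\<lambda>z. to_list (tl_data (tl_data z)) @ G (hd_data (hd_data z)) (to_list (tl_data (hd_data z))) (hd_data (tl_data z)))"
    using ptimeL_comp[OF G ptime_Node[OF ptime_hd[OF ptime_id] ptime_hd[OF ptime_tl[OF ptime_id]]]]
    by (intro ptimeL_append ptimeL_to_list ptime_tl ptime_id) simp
  then have "ptime (\<lambda>e. foldt (\<lambda>x xs s. ?G x xs s e) (F e) Leaf)"
  \<comment> \<open>The \<open>2\<close> accounts for the two \<open>Node\<close> constructors that
    pack element, suffix and environment into one argument.\<close>
  proof (intro ptime_foldt[OF F ptime_const, where h = "\<lambda>n. q (n + 2)"])
    show "pbounded (\<lambda>n. q (n + 2))" by (intro pbounded_comp[OF q(1)] pbounded_add pbounded_id pbounded_const)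
    show "size (?G x xs s e) \<le> size s + q (size x + size (enc_list xs) + size e + 2)" for x xs s e
      using q(2)[of "Node (Node x (enc_list xs)) e"] by (simp add: size_enc_list_append)
  qed (simp add: ptimeL_def)
  then show ?thesis unfolding ptimeL_def eq .
qed

lemma ptimeL_concat_map:
  assumes "ptimeL F" "ptimeL (\<lambda>z. G (hd_data z) (tl_data z))"
  shows "ptimeL (\<lambda>e. concat (map (\<lambda>x. G x e) (F e)))"
proof -
  have "concat (map (\<lambda>x. G x e) xs) = ctails (\<lambda>x _. G x e) xs" for e xs
    by (induction xs) auto
  moreover have "ptimeL (\<lambda>z. G (hd_data (hd_data z)) (tl_data z))"
    using ptimeL_comp[OF assms(2) ptime_Node[OF ptime_hd[OF ptime_hd[OF ptime_id]] ptime_tl[OF ptime_id]]] by simp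
  ultimately show ?thesis
    using ptimeL_ctails[OF assms(1), of "\<lambda>x xs e. G x e"] by simp
qed

lemma ptimeL_map:
  assumes "ptimeL F" "ptime (\<lambda>z. g (hd_data z) (tl_data z))"
  shows "ptimeL (\<lambda>e. map (\<lambda>x. g x e) (F e))"
  using ptimeL_concat_map[OF assms(1) ptimeL_Cons[OF assms(2) ptimeL_const[of "[]"]]] by simp

lemma ptimeL_filter:
  assumes "ptimeL F" "ptimeB (\<lambda>z. P (hd_data z) (tl_data z))"
  shows "ptimeL (\<lambda>e. filter (\<lambda>x. P x e) (F e))"
proof -
  have "filter (\<lambda>x. P x e) xs = concat (map (\<lambda>x. if P x e then [x] else []) xs)" for e xs
    by (induction xs) auto
  then show ?thesis
    using ptimeL_concat_map[OF assms(1), of "\<lambda>x e. if P x e then [x] else []"]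
      ptimeL_if[OF assms(2) ptimeL_Cons[OF ptime_hd[OF ptime_id] ptimeL_const] ptimeL_const] by simp
qed

lemma ptimeB_Bex:
  assumes "ptimeL F" "ptimeB (\<lambda>z. P (hd_data z) (tl_data z))"
  shows "ptimeB (\<lambda>e. \<exists>x\<in>set (F e). P x e)"
proof -
  have "(\<exists>x\<in>set xs. P x e) \<longleftrightarrow> \<not> enc_list (filter (\<lambda>x. P x e) xs) = Leaf" for xs e
    by (induction xs) auto
  then show ?thesis
    using ptimeB_not[OF ptimeB_eq[OF ptime_enc_list[OF ptimeL_filter[OF assms]] ptime_const[of Leaf]]] by simp
qed

lemma ptimeB_Ball:
  assumes "ptimeL F" "ptimeB (\<lambda>z. P (hd_data z) (tl_data z))"
  shows "ptimeB (\<lambda>e. \<forall>x\<in>set (F e). P x e)"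
  using ptimeB_not[OF ptimeB_Bex[OF assms(1) ptimeB_not[OF assms(2)]]] by simp

lemma ptimeB_comp: "ptimeB P \<Longrightarrow> ptime g \<Longrightarrow> ptimeB (\<lambda>e. P (g e))"
  unfolding ptimeB_def by (rule ptime_comp)

lemma ptimeB_member:
  assumes "ptime f" "ptimeL F" shows "ptimeB (\<lambda>e. f e \<in> set (F e))"
proof -
  have "ptimeB (\<lambda>z. hd_data z = f (tl_data z))"
    by (intro ptimeB_eq ptime_hd ptime_id ptime_comp[OF assms(1)] ptime_tl)
  then have "ptimeB (\<lambda>e. \<exists>x\<in>set (F e). x = f e)"
    by (rule ptimeB_Bex[OF assms(2), of "\<lambda>x e. x = f e"])
  then show ?thesis by simp
qed

lemmas ptime_intros = ptime_const ptimeB_const ptimeL_const ptime_id ptime_hd ptime_tl ptime_Node ptime_if ptime_enc_list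
  ptimeB_eq ptimeB_not ptimeB_conj ptimeB_disj ptimeB_member ptimeB_Bex ptimeB_Ball
  ptimeL_to_list ptimeL_Cons ptimeL_append ptimeL_concat_map ptimeL_map ptimeL_filter ptimeL_if ptimeL_ctails

text \<open>The time bound is required of \<open>F \<nu>\<close> on all trees, correctness only on
  encodings. Dependence on \<nu> lets finite tables about \<open>H\<close> be compiled into the
  program.\<close>

lemma admits_vc_kernelI:
  fixes H :: "'h graph" and F :: "('h \<Rightarrow> nat) \<Rightarrow> data \<Rightarrow> data"
  assumes "\<And>\<nu>. ptime (F \<nu>)"
    and F: "\<And>\<nu> (G :: nat graph) L d. inj_on \<nu> (verts H) \<Longrightarrow> instance_of H G L \<Longrightarrow> encodes \<nu> G L d \<Longrightarrow>
      \<exists>(G' :: nat graph) L'. instance_of H G' L' \<and> encodes \<nu> G' L' (F \<nu> d) \<and>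
        (list_colorable H G' L' \<longleftrightarrow> list_colorable H G L) \<and>
        real (card (verts G') + card (edges G')) \<le> f (vc_number G)"
  shows "admits_vc_kernel H f"
  unfolding admits_vc_kernel_def
proof (intro allI impI)
  fix \<nu> :: "'h \<Rightarrow> nat" assume inj: "inj_on \<nu> (verts H)"
  from assms(1) obtain c m q where r: "runs c m (F \<nu>) q" unfolding ptime_def by meson
  then obtain p where p: "\<And>n. q n \<le> poly p n" by (auto simp: runs_def pbounded_def)
  have "computes_within c d (poly p (size d)) (F \<nu> d)" for d
  proof -
    obtain t where "exec c ((\<lambda>_. Leaf)(0 := d)) t ((\<lambda>_. Leaf)(0 := F \<nu> d))" "t + size (F \<nu> d) \<le> q (size d)"
      by (rule runsE[OF r, of "(\<lambda>_. Leaf)(0 := d)"]) auto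
    then show ?thesis
      using p[of "size d"] unfolding computes_within_def
      by (intro exI[of _ t] exI[of _ "(\<lambda>_. Leaf)(0 := F \<nu> d)"]) auto
  qed
  with F[OF inj] show "\<exists>(c :: com) (p :: nat poly). \<forall>(G :: nat graph) L d. instance_of H G L \<and> encodes \<nu> G L d \<longrightarrow>
      (\<exists>(G' :: nat graph) L' d'. computes_within c d (poly p (size d)) d' \<and>
         instance_of H G' L' \<and> encodes \<nu> G' L' d' \<and> (list_colorable H G' L' \<longleftrightarrow> list_colorable H G L) \<and>
         real (card (verts G') + card (edges G')) \<le> f (vc_number G))"
    by meson
qed

section \<open>Tuples without boxes\<close>

definition corners :: "'a list \<Rightarrow> 'a list \<Rightarrow> 'a list set" where
  "corners s t = {ys. length ys = length s \<and> (\<forall>i<length s. ys ! i = s ! i \<or> ys ! i = t ! i)}"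

lemma corners_Nil [simp]: "corners [] t = {[]}"
  by (auto simp: corners_def)

lemma corners_Cons: "corners (a # s) (b # t) = (#) a ` corners s t \<union> (#) b ` corners s t"
proof -
  have "ys \<in> corners (a # s) (b # t) \<longleftrightarrow> (\<exists>y zs. ys = y # zs \<and> (y = a \<or> y = b) \<and> zs \<in> corners s t)" for ys
    by (cases ys) (auto simp: corners_def nth_Cons less_Suc_eq_0_disj split: nat.splits)
  then show ?thesis by blast
qed

text \<open>The corners of \<open>s\<close> and \<open>t\<close> form a genuine box only if the
  tuples differ everywhere; otherwise \<open>s = t\<close> would already turn every single tuple
  into a box.\<close>

definition box_free :: "'a list set \<Rightarrow> bool" where
  "box_free R \<longleftrightarrow> (\<forall>s t. list_all2 (\<noteq>) s t \<longrightarrow> \<not> corners s t \<subseteq> R)"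

text \<open>
  Erdos' bound for \<open>K(2,\<dots>,2)\<close>-free hypergraphs, in its partite form: count the pairs of
  tuples in \<open>R\<close> differing at most in the first coordinate and apply Cauchy-Schwarz.
\<close>

lemma box_free_card_bound:
  "\<exists>C\<ge>0. \<forall>(X :: 'a set) R (N :: nat). finite X \<longrightarrow> card X \<le> N \<longrightarrow> 1 \<le> N \<longrightarrow>
     R \<subseteq> {xs. set xs \<subseteq> X \<and> length xs = Suc n} \<longrightarrow> box_free R \<longrightarrow>
     real (card R) \<le> C * real N powr (real (Suc n) - 2 powr (- real n))"
proof (induction n)
  case 0
  \<comment> \<open>The exponent is \<open>1 - 1 = 0\<close>, so at most one tuple is allowed: two
    different ones of length 1 are a box.\<close>
  have "real (card R) \<le> 1 * real N powr (real (Suc 0) - 2 powr (- real 0))"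
    if X: "finite X" "1 \<le> N" "R \<subseteq> {xs. set xs \<subseteq> X \<and> length xs = Suc 0}" "box_free R"
    for X :: "'a set" and R and N :: nat
  proof -
    have "xs = ys" if "xs \<in> R" "ys \<in> R" for xs ys
    proof (rule ccontr)
      assume "xs \<noteq> ys"
      have "length xs = Suc 0" "length ys = Suc 0" using X(3) that by auto
      then obtain x y where [simp]: "xs = [x]" "ys = [y]"
        by (auto simp: length_Suc_conv)
      have "list_all2 (\<noteq>) xs ys" using \<open>xs \<noteq> ys\<close> by simp
      moreover have "corners xs ys \<subseteq> R" using that by (simp add: corners_Cons)
      ultimately show False using X(4) by (auto simp: box_free_def)
    qed
    moreover have "finite R" by (rule finite_subset[OF X(3)]) (simp add: finite_lists_length_eq X(1))
    ultimately have "card R \<le> 1" by (auto simp: card_le_Suc0_iff_eq)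
    then show ?thesis using X(2) by simp
  qed
  then show ?case by (intro exI[of _ 1] conjI) auto
next
  case (Suc n)
  define e where "e = real (Suc n) - 2 powr (- real n)"
  define e' where "e' = real (Suc (Suc n)) - 2 powr (- real (Suc n))"
  obtain C where C: "0 \<le> C" and IH: "\<And>(X :: 'a set) R N. finite X \<Longrightarrow> card X \<le> N \<Longrightarrow> 1 \<le> N \<Longrightarrow>
      R \<subseteq> {xs. set xs \<subseteq> X \<and> length xs = Suc n} \<Longrightarrow> box_free R \<Longrightarrow> real (card R) \<le> C * real N powr e"
    using Suc unfolding e_def by blast
  have p: "2 powr (- real n) = 2 * 2 powr (- real (Suc n))"
  proof -
    have "- real n = 1 + - real (Suc n)" by simp
    then show ?thesis by (simp only: powr_add) simp
  qed
  have "real (card R) \<le> (1 + C) * real N powr e'"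
    if X: "finite X" "card X \<le> N" "1 \<le> N" "R \<subseteq> {xs. set xs \<subseteq> X \<and> length xs = Suc (Suc n)}" "box_free R"
    for X :: "'a set" and R N
  proof -
    define Y where "Y = {ys. set ys \<subseteq> X \<and> length ys = Suc n}"
    define D where "D ys = {x \<in> X. x # ys \<in> R}" for ys
    define r where "r = real (card R)"
    define P where "P x x' = {ys \<in> Y. x # ys \<in> R \<and> x' # ys \<in> R}" for x x'
    have "finite Y" using X(1) by (simp add: Y_def finite_lists_length_eq)
    then have fin: "finite Y" "\<And>ys. finite (D ys)" "\<And>x x'. finite (P x x')"
      using X(1) by (auto simp: D_def P_def)
    have finR: "finite R" by (rule finite_subset[OF X(4)]) (simp add: finite_lists_length_eq X(1))
    have "R = (\<lambda>(ys, x). x # ys) ` Sigma Y D"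
    proof (intro set_eqI iffI)
      fix xs assume "xs \<in> R"
      with X(4) obtain x ys where "xs = x # ys" "set xs \<subseteq> X" "length ys = Suc n"
        by (cases xs) auto
      with \<open>xs \<in> R\<close> show "xs \<in> (\<lambda>(ys, x). x # ys) ` Sigma Y D"
        by (auto simp: Y_def D_def image_iff)
    qed (auto simp: D_def)
    moreover have "inj_on (\<lambda>(ys, x). x # ys) (Sigma Y D)" by (auto simp: inj_on_def)
    ultimately have "card R = card (Sigma Y D)" by (simp add: card_image)
    then have r: "r = (\<Sum>ys\<in>Y. real (card (D ys)))"
      using fin by (simp add: r_def card_SigmaI)
    have "(\<Sum>ys\<in>Y. (real (card (D ys)))\<^sup>2) = real (card (Sigma Y (\<lambda>ys. D ys \<times> D ys)))"
      using fin by (simp add: card_SigmaI card_cartesian_product power2_eq_square)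
    also have "Sigma Y (\<lambda>ys. D ys \<times> D ys) = (\<lambda>((x, x'), ys). (ys, x, x')) ` Sigma (X \<times> X) (\<lambda>(x, x'). P x x')"
      by (auto simp: P_def D_def image_iff)
    also have "card \<dots> = card (Sigma (X \<times> X) (\<lambda>(x, x'). P x x'))"
      by (intro card_image) (auto simp: inj_on_def)
    also have "\<dots> = (\<Sum>(x, x')\<in>X \<times> X. card (P x x'))"
      using fin X(1) by (subst card_SigmaI) (auto simp: case_prod_unfold)
    also have "real \<dots> = (\<Sum>(x, x')\<in>X \<times> X. real (card (P x x')))"
      by (simp add: case_prod_unfold)
    \<comment> \<open>Pairs with \<open>x \<noteq> x'\<close> are bounded by induction. The diagonal
      pairs are kept apart because together they contribute only \<open>card R\<close>.\<close>
    also have "\<dots> \<le> (\<Sum>(x, x')\<in>X \<times> X. (if x = x' then real (card (P x x)) else 0) + C * real N powr e)"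
    proof (intro sum_mono, clarify)
      fix x x'
      assume "x \<in> X" "x' \<in> X"
      show "real (card (P x x')) \<le> (if x = x' then real (card (P x x)) else 0) + C * real N powr e"
      proof (cases "x = x'")
        case False
        \<comment> \<open>A box among the common continuations of \<open>x\<close> and
          \<open>x'\<close> extends by these two entries to a box in \<open>R\<close>.\<close>
        have "box_free (P x x')"
          unfolding box_free_def
        proof (intro allI impI notI)
          fix s t assume "list_all2 (\<noteq>) s t" "corners s t \<subseteq> P x x'"
          with False have "list_all2 (\<noteq>) (x # s) (x' # t)" "corners (x # s) (x' # t) \<subseteq> R"
            by (auto simp: corners_Cons P_def)
          with X(5) show False by (auto simp: box_free_def)
        qed
        then show ?thesis using IH[of X N "P x x'"] X(1-3) False by (simp add: P_def Y_def subset_iff)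
      qed (use C in simp)
    qed
    also have "\<dots> = (\<Sum>(x, x')\<in>X \<times> X. if x = x' then real (card (P x x)) else 0)
        + real (card X) * real (card X) * (C * real N powr e)"
      by (simp add: case_prod_unfold sum.distrib card_cartesian_product)
    also have "(\<Sum>(x, x')\<in>X \<times> X. if x = x' then real (card (P x x)) else 0) = (\<Sum>x\<in>X. real (card (P x x)))"
      using X(1) by (simp add: sum.cartesian_product[symmetric])
    also have "\<dots> = real (card (Sigma X (\<lambda>x. P x x)))"
      using fin X(1) by (simp add: card_SigmaI)
    also have "card (Sigma X (\<lambda>x. P x x)) = card ((\<lambda>(x, ys). x # ys) ` Sigma X (\<lambda>x. P x x))"
      by (intro card_image[symmetric]) (auto simp: inj_on_def)
    also have "\<dots> \<le> card R"
      using finR by (intro card_mono) (auto simp: P_def)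
    also have "real (card X) * real (card X) * (C * real N powr e) \<le> real N * real N * (C * real N powr e)"
      using X(2) C by (intro mult_right_mono mult_mono) auto
    finally have sq: "(\<Sum>ys\<in>Y. (real (card (D ys)))\<^sup>2) \<le> r + real N * real N * (C * real N powr e)"
      by (simp add: r_def)
    have cY: "real (card Y) \<le> real N ^ Suc n"
    proof -
      have "card Y = card X ^ Suc n" unfolding Y_def by (rule card_lists_length_eq[OF X(1)])
      then show ?thesis using X(2) by (simp only: of_nat_power) (intro power_mono; simp)
    qed
    have "r\<^sup>2 \<le> (\<Sum>ys\<in>Y. (real (card (D ys)))\<^sup>2) * real (card Y)"
      unfolding r by (rule sum_squared_le_sum_of_squares)
    also have "\<dots> \<le> (r + real N * real N * (C * real N powr e)) * real N ^ Suc n"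
      using sq cY C by (intro mult_mono) (auto simp: r_def)
    finally have main: "r\<^sup>2 \<le> r * real N ^ Suc n + C * (real N * real N * real N powr e * real N ^ Suc n)"
      by (simp add: algebra_simps)
    define M where "M = real N powr e'"
    have N: "real N \<ge> 1" using X(3) by simp
    have "real N ^ Suc n = real N powr real (Suc n)"
      using N by (intro powr_realpow[symmetric]) simp
    moreover have "real N * real N = real N powr 2" using N by (simp add: power2_eq_square)
    ultimately have "real N * real N * real N powr e * real N ^ Suc n = real N powr (2 + e + real (Suc n))"
      by (simp only: powr_add[symmetric])
    \<comment> \<open>Taking the square root halves the defect: \<open>2 powr (- n)\<close> becomes
      \<open>2 powr (- (n + 1))\<close>, which is where the form of \<epsilon> comes from.\<close>
    also have "2 + e + real (Suc n) = e' + e'" unfolding e_def e'_def p by simp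
    finally have MM: "real N * real N * real N powr e * real N ^ Suc n = M\<^sup>2"
      by (simp only: M_def power2_eq_square powr_add)
    have "2 powr (- real (Suc n)) \<le> (1::real)" using powr_mono[of "- real (Suc n)" 0 2] by simp
    then have "real N powr real (Suc n) \<le> M"
      unfolding M_def e'_def using N by (intro powr_mono) auto
    then have "real N ^ Suc n \<le> M" using N by (subst powr_realpow[symmetric]) auto
    then have "r * real N ^ Suc n \<le> r * M" by (intro mult_left_mono) (auto simp: r_def)
    with main MM have q: "r\<^sup>2 \<le> r * M + C * M\<^sup>2" by simp
    have "0 < M" using N by (simp add: M_def)
    \<comment> \<open>If \<open>r > (1 + C) * M\<close>, then in particular
      \<open>r \<ge> M\<close>, so
      \<open>r * M + C * M\<^sup>2 \<le> r * ((1 + C) * M) < r * r\<close>, against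
      \<open>q\<close>.\<close>
    show "r \<le> (1 + C) * M"
    proof (rule ccontr)
      assume "\<not> r \<le> (1 + C) * M"
      then have r: "(1 + C) * M < r" by simp
      have "M \<le> r" using r \<open>0 < M\<close> C by (simp add: algebra_simps) (smt (verit) mult_nonneg_nonneg)
      have "r * M + C * M\<^sup>2 \<le> r * M + C * (M * r)"
        using \<open>M \<le> r\<close> \<open>0 < M\<close> C by (intro add_left_mono mult_left_mono) (auto simp: power2_eq_square)
      also have "\<dots> = r * ((1 + C) * M)" by (simp add: algebra_simps)
      also have "\<dots> < r * r" using r \<open>M \<le> r\<close> \<open>0 < M\<close> by (intro mult_strict_left_mono) auto
      finally show False using q by (simp add: power2_eq_square)
    qed
  qed
  then show ?case using C unfolding e'_def by (intro exI[of _ "1 + C"] conjI) auto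
qed

abbreviation delete_fold :: "('a list \<Rightarrow> 'a \<Rightarrow> bool) \<Rightarrow> 'a list \<Rightarrow> 'a list \<Rightarrow> 'a list" where
  "delete_fold red \<equiv> foldt (\<lambda>r _ S. if red S r then filter (\<lambda>s. s \<noteq> r) S else S)"

text \<open>A single pass over the original list; each element is tested against the elements that
  survive at that moment.\<close>

definition greedy_delete :: "('a list \<Rightarrow> 'a \<Rightarrow> bool) \<Rightarrow> 'a list \<Rightarrow> 'a list" where
  "greedy_delete red R = delete_fold red R R"

lemma foldt_filter_subset:
  "set (delete_fold red Q S) \<subseteq> set S"
proof (induction Q arbitrary: S)
  case (Cons r Q)
  have "set (if red S r then filter (\<lambda>s. s \<noteq> r) S else S) \<subseteq> set S" by auto
  with Cons[of "if red S r then filter (\<lambda>s. s \<noteq> r) S else S"] show ?case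
    unfolding foldt.simps by (rule subset_trans)
qed simp

lemma greedy_delete_subset: "set (greedy_delete red R) \<subseteq> set R"
  by (simp add: greedy_delete_def foldt_filter_subset)

lemma distinct_greedy_delete: assumes "distinct R" shows "distinct (greedy_delete red R)"
proof -
  have "distinct S \<Longrightarrow> distinct (delete_fold red Q S)" for Q S
    by (induction Q arbitrary: S) auto
  then show ?thesis using assms by (simp add: greedy_delete_def)
qed

text \<open>The deletions are undone from last to first: when \<open>r\<close> is put back,
  \<open>P\<close> already holds for the elements that survived its deletion. Elements outside
  \<open>del\<close> are never removed, so \<open>P\<close> on all of them may be used at every
  stage, even where \<open>red\<close> does not mention them.\<close>

lemma greedy_delete_equiv:
  assumes red: "\<And>S r. red S r \<Longrightarrow> set S \<subseteq> set R \<Longrightarrow> r \<in> set R \<Longrightarrow> \<forall>s\<in>set S - {r}. P s \<Longrightarrow>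
      \<forall>s\<in>set R. \<not> del s \<longrightarrow> P s \<Longrightarrow> P r"
    and low: "\<And>S r. red S r \<Longrightarrow> del r"
    and P: "\<forall>s\<in>set (greedy_delete red R). P s"
  shows "\<forall>s\<in>set R. P s"
proof -
  let ?f = "delete_fold red"
  have keep: "{s \<in> set S. \<not> del s} \<subseteq> set (?f Q S)" for Q S
  proof (induction Q arbitrary: S)
    case (Cons r Q)
    have "{s \<in> set S. \<not> del s} \<subseteq> {s \<in> set (if red S r then filter (\<lambda>s. s \<noteq> r) S else S). \<not> del s}"
      using low by auto
    with Cons[of "if red S r then filter (\<lambda>s. s \<noteq> r) S else S"] show ?case by auto
  qed auto
  have "\<forall>s\<in>set S. P s" if "set S \<subseteq> set R" "set Q \<subseteq> set R" "\<forall>s\<in>set (?f Q S). P s" "{s \<in> set R. \<not> del s} \<subseteq> set S" for Q S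
    using that
  proof (induction Q arbitrary: S)
    case (Cons r Q)
    let ?S = "if red S r then filter (\<lambda>s. s \<noteq> r) S else S"
    have S: "\<forall>s\<in>set ?S. P s"
    proof (rule Cons.IH)
      show "{s \<in> set R. \<not> del s} \<subseteq> set ?S" using Cons.prems(4) low by auto
    qed (use Cons.prems in auto)
    show ?case
    proof (cases "red S r")
      case True
      have "\<forall>s\<in>set R. \<not> del s \<longrightarrow> P s" using Cons.prems(4) S low[OF True] True by force
      then have "P r" using red[OF True] Cons.prems(1,2) S True by auto
      with S True show ?thesis by auto
    qed (use S in simp)
  qed auto
  from this[of R R] P show ?thesis by (auto simp: greedy_delete_def)
qed

text \<open>An element redundant in the final list was also redundant in the larger list present at
  its inspection, and was deleted then. This is why one pass is enough.\<close>

lemma greedy_delete_irredundant: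
  assumes mono: "\<And>S S' r. red S r \<Longrightarrow> set S \<subseteq> set S' \<Longrightarrow> red S' r"
    and r: "r \<in> set (greedy_delete red R)"
  shows "\<not> red (greedy_delete red R) r"
proof -
  let ?f = "delete_fold red"
  note sub = foldt_filter_subset[of red]
  have "r \<in> set (?f Q S) \<Longrightarrow> r \<in> set Q \<Longrightarrow> \<not> red (?f Q S) r" for Q S
  proof (induction Q arbitrary: S)
    case (Cons x Q)
    let ?S = "if red S x then filter (\<lambda>s. s \<noteq> x) S else S"
    show ?case
    proof (cases "r \<in> set Q")
      case True
      then show ?thesis using Cons.IH[of ?S] Cons.prems by simp
    next
      case False
      then have [simp]: "x = r" using Cons.prems by simp
      have "r \<in> set ?S" using Cons.prems sub[of Q ?S] by auto
      then have "\<not> red S r" by (auto split: if_splits)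
      then show ?thesis using mono[of "?f (x # Q) S" r S] sub[of "x # Q" S] by blast
    qed
  qed auto
  moreover have "r \<in> set R" using r greedy_delete_subset[of red R] by auto
  ultimately show ?thesis using r by (simp add: greedy_delete_def)
qed

section \<open>Common neighbors and lower bound structures\<close>

lemma exists_minimal_without_common_nbr:
  assumes "graph H" "S \<subseteq> verts H" "\<not> has_common_nbr H L S"
  obtains T where "T \<subseteq> S" "minimal_without_common_nbr H L T"
proof -
  have "finite S" using assms(1,2) by (auto simp: graph_def intro: finite_subset)
  then have "\<exists>T\<subseteq>S. minimal_without_common_nbr H L T"
    using assms(2,3)
  proof (induction rule: finite_psubset_induct)
    case (psubset S)
    show ?case
    proof (cases "minimal_without_common_nbr H L S")
      case False
      then obtain T where "T \<subset> S" "\<not> has_common_nbr H L T"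
        using psubset.prems by (auto simp: minimal_without_common_nbr_def)
      then show ?thesis using psubset.IH[of T] psubset.prems by blast
    qed auto
  qed
  then show ?thesis using that by blast
qed

lemma finite_c_star_set:
  assumes "graph H"
  shows "finite {card S |L S. L \<subseteq> verts H \<and> minimal_without_common_nbr H L S}"
proof (rule finite_subset)
  show "{card S |L S. L \<subseteq> verts H \<and> minimal_without_common_nbr H L S} \<subseteq> {..card (verts H)}"
    using assms by (auto simp: graph_def minimal_without_common_nbr_def intro: card_mono)
qed auto

lemma card_le_c_star:
  assumes "graph H" "L \<subseteq> verts H" "minimal_without_common_nbr H L S"
  shows "card S \<le> c_star H"
  unfolding c_star_def by (rule Max_ge[OF finite_c_star_set[OF assms(1)]]) (use assms in blast)

lemma c_star_witness:
  assumes "graph H"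
  obtains L S where "L \<subseteq> verts H" "minimal_without_common_nbr H L S" "card S = c_star H"
proof -
  have "minimal_without_common_nbr H {} {}"
    by (auto simp: minimal_without_common_nbr_def has_common_nbr_def)
  then have "{card S |L S. L \<subseteq> verts H \<and> minimal_without_common_nbr H L S} \<noteq> {}" by auto
  from Max_in[OF finite_c_star_set[OF assms] this] show ?thesis
    using that by (auto simp: c_star_def)
qed

lemma order_le_d_star:
  assumes "graph H" "lower_bound_structure H d L x x'"
  shows "d \<le> d_star H"
  unfolding d_star_def
proof (rule Max_ge)
  have "d \<le> card (verts H)" if "lower_bound_structure H d L x x'" for d L x x'
  proof -
    have "card (x ` {..<d}) \<le> card (verts H)"
      using that assms(1) by (intro card_mono) (auto simp: lower_bound_structure_def graph_def)
    then show ?thesis using that by (simp add: lower_bound_structure_def card_image)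
  qed
  then have "{d. \<exists>L x x'. lower_bound_structure H d L x x'} \<subseteq> {..card (verts H)}" by blast
  then show "finite {d. \<exists>L x x'. lower_bound_structure H d L x x'}"
    by (rule finite_subset) simp
qed (use assms(2) in auto)

text \<open>A common neighbor of \<open>S - {s}\<close> exists by minimality and must miss
  \<open>s\<close>, since \<open>S\<close> itself has none.\<close>

lemma minimal_without_common_nbrD:
  assumes "minimal_without_common_nbr H L S" "s \<in> S"
  obtains z where "z \<in> L" "\<And>u. u \<in> S \<Longrightarrow> z \<in> nbh H u \<longleftrightarrow> u \<noteq> s"
proof -
  have "S - {s} \<subset> S" using assms(2) by auto
  then have "has_common_nbr H L (S - {s})" "\<not> has_common_nbr H L S"
    using assms(1) by (simp_all add: minimal_without_common_nbr_def)
  then obtain z where z: "z \<in> L" "\<forall>u\<in>S - {s}. z \<in> nbh H u" "\<not> (\<forall>u\<in>S. z \<in> nbh H u)"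
    unfolding has_common_nbr_def by blast
  then have "z \<in> nbh H u \<longleftrightarrow> u \<noteq> s" if "u \<in> S" for u using that by blast
  with z(1) show ?thesis by (rule that)
qed

text \<open>Each element of a minimal set may be exchanged for the last one, which misses only itself.\<close>

lemma c_star_le_d_star: assumes "graph H" shows "c_star H \<le> d_star H + 1"
proof (cases "c_star H")
  case (Suc d)
  obtain L S where L: "L \<subseteq> verts H" and S: "minimal_without_common_nbr H L S" and c: "card S = Suc d"
    using c_star_witness[OF assms] Suc by metis
  have "finite S" using c by (metis card.infinite nat.distinct(1))
  then obtain x where x: "bij_betw x {..<Suc d} S"
    using c ex_bij_betw_nat_finite[of S] by (auto simp: atLeast0LessThan)
  then have inj: "inj_on x {..<Suc d}" and xS: "\<And>i. i \<le> d \<Longrightarrow> x i \<in> S"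
    by (auto simp: bij_betw_def)
  have neq: "x i \<noteq> x j" if "i \<le> d" "j \<le> d" "i \<noteq> j" for i j
    using inj that by (auto simp: inj_on_def)
  have "\<exists>z. z \<in> L \<and> (\<forall>u\<in>S. z \<in> nbh H u \<longleftrightarrow> u \<noteq> x i)" if "i \<le> d" for i
    by (rule minimal_without_common_nbrD[OF S xS[OF that]]) blast
  then have "\<forall>i\<in>{..d}. \<exists>z. z \<in> L \<and> (\<forall>u\<in>S. z \<in> nbh H u \<longleftrightarrow> u \<noteq> x i)" by simp
  from bchoice[OF this] obtain z where "\<forall>i\<in>{..d}. z i \<in> L \<and> (\<forall>u\<in>S. z i \<in> nbh H u \<longleftrightarrow> u \<noteq> x i)" ..
  then have z: "\<And>i. i \<le> d \<Longrightarrow> z i \<in> L" "\<And>i u. i \<le> d \<Longrightarrow> u \<in> S \<Longrightarrow> z i \<in> nbh H u \<longleftrightarrow> u \<noteq> x i"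
    by simp_all
  \<comment> \<open>The witness \<open>z d\<close> is left out of the set, being adjacent to all of
    \<open>x 0\<close>, ..., \<open>x (d - 1)\<close>. It is used only to show incomparability,
    together with \<open>z i\<close>.\<close>
  have "lower_bound_structure H d (z ` {..<d}) x (\<lambda>_. x d)" if "0 < d"
    unfolding lower_bound_structure_def
  proof (intro conjI allI impI)
    show "z ` {..<d} \<subseteq> verts H" using L z(1) by (intro image_subsetI) (meson lessThan_iff less_imp_le subsetD)
    show "x i \<in> verts H" if "i < d" for i
      using xS[of i] that S by (auto simp: minimal_without_common_nbr_def)
    show "x d \<in> verts H"
      using xS[of d] S by (auto simp: minimal_without_common_nbr_def)
    show "incomparable H (x i) (x d)" if "i < d" for i
    proof -
      have "z i \<in> nbh H (x d)" "z i \<notin> nbh H (x i)" "z d \<in> nbh H (x i)" "z d \<notin> nbh H (x d)"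
        using that z(2)[of i "x d"] z(2)[of i "x i"] z(2)[of d "x i"] z(2)[of d "x d"]
          xS[of i] xS[of d] neq[of i d] by simp_all
      then show ?thesis by (auto simp: incomparable_def)
    qed
    show "inj_on x {..<d}" using inj by (rule inj_on_subset) auto
    show "(\<Inter>i<d. nbh H (x i)) \<inter> z ` {..<d} = {}"
    proof -
      have "z i \<notin> nbh H (x i)" if "i < d" for i using z(2)[of i "x i"] xS[of i] that by simp
      then show ?thesis by blast
    qed
    fix y assume "(\<forall>i<d. y i = x i \<or> y i = x d) \<and> (\<exists>i<d. y i = x d)"
    then obtain j where y: "\<And>i. i < d \<Longrightarrow> y i = x i \<or> y i = x d" and j: "j < d" "y j = x d" by auto
    \<comment> \<open>Once position \<open>j\<close> is switched to \<open>x d\<close>, no entry of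
      \<open>y\<close> equals \<open>x j\<close>, the only element of \<open>S\<close> that
      \<open>z j\<close> misses.\<close>
    have "z j \<in> nbh H (y i)" if "i < d" for i
    proof -
      have "y i = x d \<or> y i = x i \<and> i \<noteq> j" using y[OF that] j by blast
      then have "y i \<in> S" "y i \<noteq> x j"
        using xS[of i] xS[of d] that neq[of i j] neq[of d j] j by auto
      then show ?thesis using z(2)[of j "y i"] j by simp
    qed
    then show "(\<Inter>i<d. nbh H (y i)) \<inter> z ` {..<d} \<noteq> {}" using j by auto
  qed
  then have "d \<le> d_star H" using order_le_d_star[OF assms] by (cases "d = 0") auto
  then show ?thesis using Suc by simp
qed simp

text \<open>With private neighbors \<open>y\<close> of \<open>a\<close> and \<open>z\<close> of
  \<open>b\<close>, every set of at most one of \<open>a\<close>, \<open>b\<close> has a common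
  neighbor in \<open>{y, z}\<close>, but \<open>{a, b}\<close> has none; this would force
  \<open>c_star H \<ge> 2\<close>.\<close>

lemma chain_if_c_star_le_1:
  assumes "graph H" "c_star H \<le> 1" "a \<in> verts H" "b \<in> verts H"
  shows "nbh H a \<subseteq> nbh H b \<or> nbh H b \<subseteq> nbh H a"
proof (rule ccontr)
  assume "\<not> ?thesis"
  then obtain y z where yz: "y \<in> nbh H a" "y \<notin> nbh H b" "z \<in> nbh H b" "z \<notin> nbh H a" by auto
  let ?L = "{y, z}"
  have bad: "\<not> has_common_nbr H ?L {a, b}" using yz by (auto simp: has_common_nbr_def)
  obtain T where T: "T \<subseteq> {a, b}" "minimal_without_common_nbr H ?L T"
    by (rule exists_minimal_without_common_nbr[OF assms(1) _ bad]) (use assms(3,4) in auto)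
  have "card T \<le> 1"
    using card_le_c_star[OF assms(1) _ T(2)] assms(2) yz by (auto simp: nbh_def)
  moreover have "finite T" using T(1) by (rule finite_subset) simp
  ultimately have "T = {} \<or> T = {a} \<or> T = {b}" using T(1) by (auto simp: card_le_Suc0_iff_eq)
  then have "has_common_nbr H ?L T" using yz by (auto simp: has_common_nbr_def)
  then show False using T(2) by (simp add: minimal_without_common_nbr_def)
qed

text \<open>A missing edge, or a missing loop if \<open>a = b\<close>, makes \<open>{a}\<close>
  minimal without a common neighbor in \<open>{b}\<close>.\<close>

lemma complete_if_c_star_0:
  assumes "graph H" "c_star H = 0" "a \<in> verts H" "b \<in> verts H"
  shows "{a, b} \<in> edges H"
proof (rule ccontr)
  assume "{a, b} \<notin> edges H"
  then have "minimal_without_common_nbr H {b} {a}"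
    using assms(3) by (auto simp: minimal_without_common_nbr_def has_common_nbr_def nbh_def insert_commute)
  then show False using card_le_c_star[OF assms(1), of "{b}" "{a}"] assms(2,4) by simp
qed

text \<open>All vertices get the same two disjoint arcs: the one from angle \<open>pi / 4\<close> to
  \<open>3 * pi / 4\<close> around \<open>p = \<i>\<close>, and its negative around
  \<open>q = - \<i>\<close>. The sign of the imaginary part separates them.\<close>

lemma bi_arc_graph_if_complete:
  assumes "\<And>a b. a \<in> verts H \<Longrightarrow> b \<in> verts H \<Longrightarrow> {a, b} \<in> edges H"
  shows "bi_arc_graph H"
proof -
  define g :: "real \<Rightarrow> complex" where "g x = cis (pi / 4 * (1 + 2 * x))" for x
  let ?N = "path_image g" and ?S = "path_image (\<lambda>x. - g x)"
  have angle: "0 < pi / 4 * (1 + 2 * x)" "pi / 4 * (1 + 2 * x) < pi" if "x \<in> {0..1}" for x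
  proof -
    show "0 < pi / 4 * (1 + 2 * x)" using that by (intro mult_pos_pos add_pos_nonneg) auto
    have "pi / 4 * (1 + 2 * x) \<le> pi / 4 * 3" using that by (intro mult_left_mono) auto
    then show "pi / 4 * (1 + 2 * x) < pi" using pi_gt_zero by linarith
  qed
  have Im_g: "0 < Im (g x)" if "x \<in> {0..1}" for x
    using angle[OF that] by (simp add: g_def sin_gt_zero)
  have inj: "inj_on g {0..1}"
  proof (rule inj_onI)
    fix x y assume xy: "x \<in> {0..1}" "y \<in> {0..1}" "g x = g y"
    have "cos (pi / 4 * (1 + 2 * x)) = cos (pi / 4 * (1 + 2 * y))"
      using arg_cong[OF xy(3), of Re] unfolding g_def cis.sel .
    then have "pi / 4 * (1 + 2 * x) = pi / 4 * (1 + 2 * y)"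
      by (rule cos_inj_pi[rotated 4]) (use angle[OF xy(1)] angle[OF xy(2)] in simp_all)
    then show "x = y" by simp
  qed
  have cont: "continuous_on {0..1} g"
    unfolding g_def cis_conv_exp by (intro continuous_intros)
  have "arc g" using inj cont by (simp add: arc_def path_def)
  moreover have "arc (\<lambda>x. - g x)"
    using inj cont by (auto simp: arc_def path_def inj_on_def intro: continuous_on_minus)
  moreover have "?N \<subseteq> circle" "?S \<subseteq> circle"
    by (auto simp: circle_def path_image_def g_def)
  ultimately have circ: "circle_arc ?N" "circle_arc ?S"
    unfolding circle_arc_def by blast+
  have "g (1 / 2) = \<i>" by (simp add: g_def complex_eq_iff)
  then have "\<i> \<in> ?N" "- \<i> \<in> ?S" by (auto simp: path_image_def image_iff intro!: bexI[of _ "1 / 2"])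
  moreover have "0 < Im z" if "z \<in> ?N" for z using that Im_g by (auto simp: path_image_def)
  moreover have "Im z < 0" if "z \<in> ?S" for z using that Im_g by (auto simp: path_image_def)
  ultimately have "\<i> \<in> ?N" "- \<i> \<in> ?S" "?N \<inter> ?S = {}" "- \<i> \<notin> ?N" "\<i> \<notin> ?S"
    by (auto, fastforce+)
  then have "bi_arc \<i> (- \<i>) ?N ?S" "?N \<inter> ?S = {}"
    using circ by (auto simp: bi_arc_def)
  then show ?thesis
    unfolding bi_arc_graph_def using assms
    by (intro bexI[of _ \<i>] bexI[of _ "- \<i>"] conjI exI[of _ "\<lambda>_. ?N"] exI[of _ "\<lambda>_. ?S"])
      (auto simp: circle_def complex_eq_iff)
qed

text \<open>
  If only the corner \<open>s\<close> of the box were violated, then \<open>\<phi>\<close> on \<open>s\<close> and \<open>t\<close> would be a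
  lower bound structure of order \<open>c_star H\<close>.
\<close>

lemma box_has_common_nbr:
  assumes H: "graph H" and d: "d_star H < c_star H" and L: "L \<subseteq> verts H"
    and len: "length s = c_star H" "list_all2 (\<noteq>) s t"
    and \<phi>: "\<And>i. i < length s \<Longrightarrow> \<phi> (s ! i) \<in> verts H \<and> \<phi> (t ! i) \<in> verts H \<and>
      (\<phi> (s ! i) = \<phi> (t ! i) \<or> incomparable H (\<phi> (s ! i)) (\<phi> (t ! i)))"
    and box: "\<And>y. y \<in> corners s t \<Longrightarrow> y \<noteq> s \<Longrightarrow> has_common_nbr H L (\<phi> ` set y)"
    and low: "\<And>T. T \<subseteq> \<phi> ` set s \<Longrightarrow> card T < c_star H \<Longrightarrow> has_common_nbr H L T"
  shows "has_common_nbr H L (\<phi> ` set s)"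
proof (rule ccontr)
  assume bad: "\<not> has_common_nbr H L (\<phi> ` set s)"
  define c where "c = c_star H"
  have ls: "length s = c" "length t = c" using len by (auto simp: c_def list_all2_lengthD)
  have neq: "s ! i \<noteq> t ! i" if "i < c" for i
    using len that ls by (simp add: list_all2_conv_all_nth)
  have "\<phi> ` set s \<subseteq> verts H" using \<phi> by (auto simp: in_set_conv_nth)
  \<comment> \<open>By \<open>low\<close>, such a \<open>T\<close> has at least \<open>c\<close>
    elements. So the \<open>c\<close> entries of \<open>s\<close> have pairwise distinct colors, as
    the distinctness in a lower bound structure demands.\<close>
  from H this bad obtain T where T: "T \<subseteq> \<phi> ` set s" "minimal_without_common_nbr H L T"
    by (rule exists_minimal_without_common_nbr)
  then have "\<not> card T < c" using low[of T] by (auto simp: c_def minimal_without_common_nbr_def)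
  moreover have "card T \<le> card (\<phi> ` set s)" using T(1) by (intro card_mono) auto
  moreover have img: "\<phi> ` set s = (\<lambda>i. \<phi> (s ! i)) ` {..<c}"
    by (auto simp: set_conv_nth ls(1))
  ultimately have "c \<le> card ((\<lambda>i. \<phi> (s ! i)) ` {..<c})" by simp
  then have inj: "inj_on (\<lambda>i. \<phi> (s ! i)) {..<c}"
    using card_image_le[of "{..<c}" "\<lambda>i. \<phi> (s ! i)"] by (intro eq_card_imp_inj_on) simp_all
  \<comment> \<open>Otherwise exchanging only entry \<open>i\<close> gives a corner other than
    \<open>s\<close> with the same colors as \<open>s\<close>. With equality excluded, the
    hypothesis on \<phi> yields incomparability.\<close>
  have ne: "\<phi> (s ! i) \<noteq> \<phi> (t ! i)" if i: "i < c" for i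
  proof
    assume eq: "\<phi> (s ! i) = \<phi> (t ! i)"
    let ?y = "s[i := t ! i]"
    have "?y \<in> corners s t" using i by (auto simp: corners_def nth_list_update ls)
    moreover have "?y ! i \<noteq> s ! i" using neq[OF i] i ls by simp
    then have "?y \<noteq> s" by metis
    moreover have "map \<phi> ?y = map \<phi> s" using eq by (simp add: map_update list_update_same_conv i ls)
    then have "\<phi> ` set ?y = \<phi> ` set s" by (metis set_map)
    ultimately show False using box bad by metis
  qed
  have "lower_bound_structure H c L (\<lambda>i. \<phi> (s ! i)) (\<lambda>i. \<phi> (t ! i))"
    unfolding lower_bound_structure_def
  proof (intro conjI allI impI)
    show "(\<Inter>i<c. nbh H (\<phi> (s ! i))) \<inter> L = {}"
      using bad unfolding img has_common_nbr_def by auto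
    fix y
    assume "(\<forall>i<c. y i = \<phi> (s ! i) \<or> y i = \<phi> (t ! i)) \<and> (\<exists>i<c. y i = \<phi> (t ! i))"
    then obtain j where y: "\<And>i. i < c \<Longrightarrow> y i = \<phi> (s ! i) \<or> y i = \<phi> (t ! i)"
        and j: "j < c" "y j = \<phi> (t ! j)" by auto
    \<comment> \<open>The choice \<open>y\<close> of colors is lifted to a corner of the box; at
      \<open>j\<close> it takes the entry of \<open>t\<close>, so it is not
      \<open>s\<close>.\<close>
    define ys where "ys = map (\<lambda>i. if y i = \<phi> (s ! i) then s ! i else t ! i) [0..<c]"
    have "ys \<in> corners s t" by (auto simp: ys_def corners_def ls)
    moreover have "ys ! j = t ! j" using j ne[OF j(1)] by (simp add: ys_def)
    then have "ys \<noteq> s" using neq[OF j(1)] by metis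
    ultimately have "has_common_nbr H L (\<phi> ` set ys)" by (rule box)
    then obtain z where z: "z \<in> L" "\<And>u. u \<in> \<phi> ` set ys \<Longrightarrow> z \<in> nbh H u"
      unfolding has_common_nbr_def by blast
    have yi: "y i \<in> \<phi> ` set ys" if "i < c" for i
    proof -
      have "length ys = c" "\<phi> (ys ! i) = y i" using y[OF that] that by (auto simp: ys_def)
      then show ?thesis using nth_mem[of i ys] that by (metis image_eqI)
    qed
    have "z \<in> (\<Inter>i<c. nbh H (y i))" by (rule INT_I) (use yi z(2) in simp)
    then show "(\<Inter>i<c. nbh H (y i)) \<inter> L \<noteq> {}" using z(1) by blast
  qed (use L \<phi> ls inj ne in auto)
  then show False using order_le_d_star[OF H] d by (force simp: c_def)
qed

text \<open>
  Three edges of a \<open>2\<close>-by-\<open>2\<close> box without the fourth contain, with a private neighbor \<open>p\<close> of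
  \<open>a\<close>, the path \<open>p - a - b' - a' - b\<close>: a lower bound structure of order \<open>2\<close>.
\<close>

lemma box_edge:
  assumes H: "graph H" and d: "d_star H < 2"
    and V: "a \<in> verts H" "b \<in> verts H" "a' \<in> verts H" "b' \<in> verts H"
    and inc: "a = a' \<or> incomparable H a a'" "b = b' \<or> incomparable H b b'"
    and E: "{a', b} \<in> edges H" "{a, b'} \<in> edges H" "{a', b'} \<in> edges H"
  shows "{a, b} \<in> edges H"
proof (rule ccontr)
  assume nE: "{a, b} \<notin> edges H"
  then have "incomparable H a a'" "incomparable H b b'" using inc E by auto
  then obtain p where p: "p \<in> verts H" "{p, a} \<in> edges H" "{p, a'} \<notin> edges H"
    by (auto simp: incomparable_def nbh_def)
  have n: "x \<in> nbh H y \<longleftrightarrow> {x, y} \<in> edges H" if "x \<in> verts H" for x y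
    using that by (simp add: nbh_def)
  \<comment> \<open>The pairs are \<open>(b, b')\<close> and \<open>(p, b)\<close>, with
    \<open>b\<close> occurring in both. In \<open>{a, a'}\<close> the vertex \<open>a\<close> misses
    \<open>b\<close> and \<open>a'\<close> misses \<open>p\<close>; the choice \<open>b', p\<close>
    is served by \<open>a\<close>, the choices \<open>b', b\<close> and \<open>b, b\<close> by
    \<open>a'\<close>.\<close>
  let ?x = "\<lambda>i::nat. if i = 0 then b else p" and ?x' = "\<lambda>i::nat. if i = 0 then b' else b"
  have two: "{..<2::nat} = {0, 1}" by (auto simp: numeral_2_eq_2)
  have e: "a \<in> nbh H p" "a \<in> nbh H b'" "a \<notin> nbh H b" "a' \<in> nbh H b" "a' \<in> nbh H b'" "a' \<notin> nbh H p"
    unfolding n[OF V(1)] n[OF V(3)] using p E nE by (simp_all add: insert_commute)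
  have "lower_bound_structure H 2 {a, a'} ?x ?x'"
    unfolding lower_bound_structure_def
  proof (intro conjI allI impI)
    have "incomparable H p b" unfolding incomparable_def using e by blast
    then show "incomparable H (?x i) (?x' i)" for i
      using \<open>incomparable H b b'\<close> by simp
    show "inj_on ?x {..<2}" using e by (auto simp: two inj_on_def)
    show "(\<Inter>i<2. nbh H (?x i)) \<inter> {a, a'} = {}" using e by (auto simp: two)
    fix y
    assume "(\<forall>i<2. y i = ?x i \<or> y i = ?x' i) \<and> (\<exists>i<2. y i = ?x' i)"
    then have "(y 0 = b \<or> y 0 = b') \<and> (y 1 = p \<or> y 1 = b) \<and> (y 0 = b' \<or> y 1 = b)"
      by (auto simp: less_2_cases_iff)
    then show "(\<Inter>i<2. nbh H (y i)) \<inter> {a, a'} \<noteq> {}" using e by (auto simp: two)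
  qed (use V p in auto)
  then show False using order_le_d_star[OF H] d by force
qed

section \<open>The kernelization algorithm\<close>

text \<open>
  Vertices of the input are represented by their items \<open>Node name list\<close> and a
  constraint is written \<open>Node label tuple\<close>. The label \<open>Leaf\<close> stands for an edge inside
  the vertex cover, and \<open>Node Leaf l\<close> for a vertex with list \<open>l\<close> outside of it, adjacent
  to the entries of the tuple.
\<close>

definition reduce_list :: "data list \<Rightarrow> data list \<Rightarrow> data list" where
  "reduce_list BT l = filter (\<lambda>a. \<not> (\<exists>b\<in>set l. Node b a \<in> set BT)) l"

definition items :: "data list \<Rightarrow> data \<Rightarrow> data list" where
  "items BT d = map (\<lambda>i. Node (hd_data i) (enc_list (reduce_list BT (to_list (tl_data i))))) (to_list (hd_data d))"

definition edge_list :: "data \<Rightarrow> data list" where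
  "edge_list d = to_list (tl_data d)"

text \<open>Both endpoints of a greedily built maximal matching. A loop puts its vertex in twice,
  which does not affect the set of collected vertices.\<close>

abbreviation cover_fold :: "data list \<Rightarrow> data \<Rightarrow> data" where
  "cover_fold \<equiv> foldt (\<lambda>e _ s. if hd_data e \<in> set (to_list s) \<or> tl_data e \<in> set (to_list s) then s
     else Node (hd_data e) (Node (tl_data e) s))"

definition greedy_cover :: "data list \<Rightarrow> data list" where
  "greedy_cover es = to_list (cover_fold es Leaf)"

definition adjacent :: "data list \<Rightarrow> data \<Rightarrow> data \<Rightarrow> bool" where
  "adjacent es i j \<longleftrightarrow> Node (hd_data i) (hd_data j) \<in> set es \<or> Node (hd_data j) (hd_data i) \<in> set es"

definition cover_items :: "data list \<Rightarrow> data \<Rightarrow> data list" where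
  "cover_items BT d = filter (\<lambda>i. hd_data i \<in> set (greedy_cover (edge_list d))) (items BT d)"

definition other_items :: "data list \<Rightarrow> data \<Rightarrow> data list" where
  "other_items BT d = filter (\<lambda>i. hd_data i \<notin> set (greedy_cover (edge_list d))) (items BT d)"

fun tuples :: "nat \<Rightarrow> data list \<Rightarrow> data list" where
  "tuples 0 N = [Leaf]"
| "tuples (Suc n) N = Leaf # concat (map (\<lambda>x. map (\<lambda>t. Node x t) (tuples n N)) N)"

text \<open>A neighborhood constraint records the list of the outside vertex but not its name, so
  \<open>remdups\<close> performs the sharing among vertices with equal lists. Edges of the cover
  enter in both orientations.\<close>

definition constraints :: "nat \<Rightarrow> data list \<Rightarrow> data \<Rightarrow> data list" where
  "constraints c BT d = remdups
     (concat (map (\<lambda>i. map (\<lambda>j. Node Leaf (Node i (Node j Leaf)))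
        (filter (adjacent (edge_list d) i) (cover_items BT d))) (cover_items BT d)) @
      concat (map (\<lambda>i. map (\<lambda>t. Node (Node Leaf (tl_data i)) t)
        (tuples c (filter (adjacent (edge_list d) i) (cover_items BT d)))) (other_items BT d)))"

fun has_length :: "nat \<Rightarrow> data \<Rightarrow> bool" where
  "has_length 0 t \<longleftrightarrow> t = Leaf"
| "has_length (Suc n) t \<longleftrightarrow> t \<noteq> Leaf \<and> has_length n (tl_data t)"

text \<open>Lists are compared as codes, so the order of colors counts. This only refines the
  classes of tuples, whose number still depends on \<open>H\<close> and \<open>c\<close>
  alone.\<close>

fun same_lists :: "nat \<Rightarrow> data \<Rightarrow> data \<Rightarrow> bool" where
  "same_lists 0 s t \<longleftrightarrow> True"
| "same_lists (Suc n) s t \<longleftrightarrow> tl_data (hd_data s) = tl_data (hd_data t) \<and> hd_data s \<noteq> hd_data t \<and>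
     same_lists n (tl_data s) (tl_data t)"

fun corner_list :: "nat \<Rightarrow> data \<Rightarrow> data \<Rightarrow> data list" where
  "corner_list 0 s t = [Leaf]"
| "corner_list (Suc n) s t =
     concat (map (\<lambda>y. [Node (hd_data s) y, Node (hd_data t) y]) (corner_list n (tl_data s) (tl_data t)))"

text \<open>The length test confines deletion to tuples of full length \<open>c\<close>. Edge
  constraints have length 2, so they are candidates exactly if \<open>c = 2\<close>. All corners
  other than \<open>r\<close> itself, in particular \<open>r'\<close>, must still be present in
  \<open>S\<close>.\<close>

definition redundant :: "nat \<Rightarrow> data list \<Rightarrow> data \<Rightarrow> bool" where
  "redundant c S r \<longleftrightarrow> has_length c (tl_data r) \<and>
     (\<exists>r'\<in>set S. hd_data r' = hd_data r \<and> has_length c (tl_data r') \<and>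
        same_lists c (tl_data r) (tl_data r') \<and>
        (\<forall>y\<in>set (corner_list c (tl_data r) (tl_data r')). y = tl_data r \<or> Node (hd_data r) y \<in> set S))"

definition kept :: "bool \<Rightarrow> nat \<Rightarrow> data list \<Rightarrow> data \<Rightarrow> data list" where
  "kept b c BT d = (if b then greedy_delete (redundant c) (constraints c BT d) else constraints c BT d)"

text \<open>
  Cover vertex \<open>v\<close> is renamed to \<open>2 * v + 1\<close>; the constraint followed by \<open>k\<close> others becomes
  the vertex \<open>2 ^ (k + 1)\<close>.
\<close>

definition cover_name :: "data \<Rightarrow> data" where
  "cover_name i = Node (Node Leaf Leaf) (hd_data i)"

definition fresh_name :: "data list \<Rightarrow> data" where
  "fresh_name rest = enc_list (Leaf # map (\<lambda>_. Leaf) rest @ [Node Leaf Leaf])"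

definition kernel_verts :: "data list \<Rightarrow> data list \<Rightarrow> data list" where
  "kernel_verts X S = map (\<lambda>i. Node (cover_name i) (tl_data i)) X @
     ctails (\<lambda>r rest. if hd_data r = Leaf then [] else [Node (fresh_name rest) (tl_data (hd_data r))]) S"

definition reversed :: "data \<Rightarrow> data" where
  "reversed r = Node Leaf (Node (hd_data (tl_data (tl_data r))) (Node (hd_data (tl_data r)) Leaf))"

text \<open>Encodings must not repeat an edge. If both orientations of an edge constraint survive,
  only the later one emits the edge, and repeated entries of a tuple are merged.\<close>

definition kernel_edges :: "data list \<Rightarrow> data list" where
  "kernel_edges S = ctails (\<lambda>r rest.
     if hd_data r = Leaf then
       (if reversed r \<in> set rest then []
        else [Node (cover_name (hd_data (tl_data r))) (cover_name (hd_data (tl_data (tl_data r))))])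
     else map (\<lambda>i. Node (fresh_name rest) (cover_name i)) (remdups (to_list (tl_data r)))) S"

definition kernel :: "bool \<Rightarrow> nat \<Rightarrow> data list \<Rightarrow> data \<Rightarrow> data" where
  "kernel b c BT d =
     Node (enc_list (kernel_verts (cover_items BT d) (kept b c BT d))) (enc_list (kernel_edges (kept b c BT d)))"

section \<open>Running time of the kernelization\<close>

lemma ptimeL_remdups: assumes "ptimeL F" shows "ptimeL (\<lambda>e. remdups (F e))"
proof -
  have "remdups xs = ctails (\<lambda>x xs. if x \<in> set xs then [] else [x]) xs" for xs :: "data list"
    by (induction xs) auto
  then show ?thesis by (simp only:) (intro ptime_intros assms)
qed

lemma ptimeL_reduce_list: "ptimeL F \<Longrightarrow> ptimeL (\<lambda>e. reduce_list BT (F e))"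
proof -
  have "ptimeL (\<lambda>e. reduce_list BT (to_list e))"
    unfolding reduce_list_def by (intro ptime_intros)
  then show "ptimeL F \<Longrightarrow> ptimeL (\<lambda>e. reduce_list BT (F e))"
    using ptimeL_comp[of "\<lambda>e. reduce_list BT (to_list e)" "\<lambda>e. enc_list (F e)"] by (simp add: ptimeL_def)
qed

lemma ptimeL_items: "ptimeL (items BT)"
  unfolding items_def[abs_def] by (intro ptime_intros ptimeL_reduce_list)

lemma ptimeL_edge_list: "ptimeL edge_list"
  unfolding edge_list_def[abs_def] by (intro ptime_intros)

lemma ptimeL_greedy_cover: "ptimeL (\<lambda>d. greedy_cover (edge_list d))"
proof -
  have "ptime (\<lambda>d. cover_fold (edge_list d) Leaf)"
  proof (rule ptime_foldt[where h = "\<lambda>n. n + n + 2" and G = "\<lambda>e _ s _.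
     if hd_data e \<in> set (to_list s) \<or> tl_data e \<in> set (to_list s) then s
     else Node (hd_data e) (Node (tl_data e) s)"])
    show "pbounded (\<lambda>n. n + n + 2)" by (intro pbounded_add pbounded_id pbounded_const)
    show "size (if hd_data x \<in> set (to_list s) \<or> tl_data x \<in> set (to_list s) then s
        else Node (hd_data x) (Node (tl_data x) s))
      \<le> size s + (size x + size (enc_list xs) + size e + (size x + size (enc_list xs) + size e) + 2)" for x xs s e
      using size_hd_tl_data[of x] by auto
  qed (intro ptime_intros ptimeL_edge_list)+
  then show ?thesis by (simp add: greedy_cover_def ptimeL_def)
qed

lemma ptimeL_cover_items: "ptimeL (cover_items BT)"
  unfolding cover_items_def[abs_def]
  by (intro ptime_intros ptimeL_items ptimeL_comp[OF ptimeL_greedy_cover])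

lemma ptimeL_other_items: "ptimeL (other_items BT)"
  unfolding other_items_def[abs_def]
  by (intro ptime_intros ptimeL_items ptimeL_comp[OF ptimeL_greedy_cover])

text \<open>Here \<open>n\<close> is a constant of the program: the recursion unrolls to nested
  loops and so affects only the degree of the polynomial. The same holds for the recursions of
  \<open>has_length\<close>, \<open>same_lists\<close> and \<open>corner_list\<close>.\<close>

lemma ptimeL_tuples: "ptimeL F \<Longrightarrow> ptimeL (\<lambda>e. tuples n (F e))"
proof (induction n arbitrary: F)
  case (Suc n)
  have "ptimeL (\<lambda>z. F (tl_data z))" by (intro ptimeL_comp[OF Suc.prems] ptime_intros)
  then show ?case unfolding tuples.simps by (intro ptime_intros Suc)
qed (simp add: ptimeL_const)

lemma ptimeL_constraints: "ptimeL (constraints c BT)"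
  unfolding constraints_def[abs_def] adjacent_def
  by (intro ptimeL_remdups ptime_intros ptimeL_tuples ptimeL_cover_items ptimeL_other_items ptimeL_comp[OF ptimeL_cover_items] ptimeL_comp[OF ptimeL_edge_list])

lemma ptimeB_has_length: "ptime f \<Longrightarrow> ptimeB (\<lambda>e. has_length n (f e))"
  by (induction n arbitrary: f) (auto intro!: ptime_intros)

lemma ptimeB_same_lists: "ptime f \<Longrightarrow> ptime g \<Longrightarrow> ptimeB (\<lambda>e. same_lists n (f e) (g e))"
  by (induction n arbitrary: f g) (auto intro!: ptime_intros)

lemma ptimeL_corner_list: "ptime f \<Longrightarrow> ptime g \<Longrightarrow> ptimeL (\<lambda>e. corner_list n (f e) (g e))"
proof (induction n arbitrary: f g)
  case (Suc n)
  have "ptime (\<lambda>z. f (tl_data z))" "ptime (\<lambda>z. g (tl_data z))"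
    by (intro ptime_comp[OF Suc.prems(1)] ptime_comp[OF Suc.prems(2)] ptime_intros)+
  then show ?case unfolding corner_list.simps by (intro ptime_intros Suc)
qed (simp add: ptimeL_const)

lemma ptimeB_redundant: "ptimeB (\<lambda>z. redundant c (to_list (hd_data z)) (tl_data z))"
  unfolding redundant_def
  by (intro ptime_intros ptimeB_has_length ptimeB_same_lists ptimeL_corner_list)

lemma size_filter_le: "size (enc_list (filter P xs)) \<le> size (enc_list xs)"
  by (induction xs) auto

lemma ptimeL_kept: "ptimeL (kept b c BT)"
proof -
  let ?G = "\<lambda>r (_ :: data list) s (_ :: data). enc_list (if redundant c (to_list s) r then filter (\<lambda>t. t \<noteq> r) (to_list s) else to_list s)"
  have "foldt (\<lambda>r xs s. ?G r xs s e) Q s =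
      enc_list (foldt (\<lambda>r _ S. if redundant c S r then filter (\<lambda>s. s \<noteq> r) S else S) Q (to_list s))" for Q s e
    by (induction Q arbitrary: s) auto
  then have eq: "enc_list (greedy_delete (redundant c) (constraints c BT d)) =
      foldt (\<lambda>r xs s. ?G r xs s d) (constraints c BT d) (enc_list (constraints c BT d))" for d
    by (simp add: greedy_delete_def)
  have red: "ptimeB (\<lambda>z. redundant c (to_list (tl_data (tl_data z))) (hd_data (hd_data z)))"
    using ptimeB_comp[OF ptimeB_redundant, of "\<lambda>z. Node (tl_data (tl_data z)) (hd_data (hd_data z))"]
    by (simp add: ptime_Node ptime_hd ptime_tl ptime_id)
  have "ptime (\<lambda>d. foldt (\<lambda>r xs s. ?G r xs s d) (constraints c BT d) (enc_list (constraints c BT d)))"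
  \<comment> \<open>The accumulator is the list of survivors, which never grows.\<close>
  proof (rule ptime_foldt[where h = "\<lambda>_. 0"])
    show "size (?G x xs s e) \<le> size s + 0" for x xs s e
      using size_filter_le[of "\<lambda>t. t \<noteq> x" "to_list s"] by simp
  qed (intro ptime_intros ptimeL_constraints red pbounded_const)+
  then have "ptimeL (\<lambda>d. greedy_delete (redundant c) (constraints c BT d))"
    by (simp add: ptimeL_def eq)
  then show ?thesis by (cases b) (simp_all add: kept_def[abs_def] ptimeL_constraints)
qed

lemma ptime_kernel: "ptime (kernel b c BT)"
  unfolding kernel_def[abs_def] kernel_verts_def kernel_edges_def cover_name_def fresh_name_def reversed_def
  by (intro ptime_intros ptimeL_remdups ptimeL_cover_items ptimeL_kept)

section \<open>Constraints on a vertex cover\<close>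

lemma graph_edgeD: "graph G \<Longrightarrow> {u, v} \<in> edges G \<Longrightarrow> u \<in> verts G \<and> v \<in> verts G"
proof -
  assume "graph G" "{u, v} \<in> edges G"
  then obtain a b where "a \<in> verts G" "b \<in> verts G" "{u, v} = {a, b}" unfolding graph_def by meson
  then show "u \<in> verts G \<and> v \<in> verts G" by (auto simp: doubleton_eq_iff)
qed

text \<open>
  \<open>\<nu>\<close> breaks ties between colors with equal neighborhoods, so that maximal colors of a list are
  pairwise incomparable.
\<close>

definition better :: "'h graph \<Rightarrow> ('h \<Rightarrow> nat) \<Rightarrow> 'h \<Rightarrow> 'h \<Rightarrow> bool" where
  "better H \<nu> b a \<longleftrightarrow> nbh H a \<subset> nbh H b \<or> nbh H a = nbh H b \<and> \<nu> b < \<nu> a"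

definition best :: "'h graph \<Rightarrow> ('h \<Rightarrow> nat) \<Rightarrow> 'h set \<Rightarrow> 'h set" where
  "best H \<nu> A = {a \<in> A. \<not> (\<exists>b\<in>A. better H \<nu> b a)}"

lemma best_incomparable:
  assumes "inj_on \<nu> (verts H)" "A \<subseteq> verts H" "a \<in> best H \<nu> A" "b \<in> best H \<nu> A"
  shows "a = b \<or> incomparable H a b"
proof (rule ccontr)
  assume "\<not> ?thesis"
  then have "a \<noteq> b" "nbh H a \<subseteq> nbh H b \<or> nbh H b \<subseteq> nbh H a" by (auto simp: incomparable_def)
  moreover have "\<nu> a \<noteq> \<nu> b" using assms \<open>a \<noteq> b\<close> by (auto simp: best_def inj_on_def)
  ultimately have "better H \<nu> a b \<or> better H \<nu> b a"
    unfolding better_def by (metis nat_neq_iff psubsetI)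
  then show False using assms(3,4) unfolding best_def by blast
qed

text \<open>\<open>better H \<nu>\<close> is a strict order, so among the finitely many colors that
  dominate \<open>a\<close> there is one that no color of \<open>A\<close> improves.\<close>

lemma best_dominates:
  assumes "finite A" "a \<in> A" shows "\<exists>m\<in>best H \<nu> A. nbh H a \<subseteq> nbh H m"
proof -
  let ?r = "{(x, y). x \<in> A \<and> y \<in> A \<and> better H \<nu> x y}"
  have "trans ?r" by (auto simp: trans_def better_def)
  moreover have "finite ?r" by (rule finite_subset[of _ "A \<times> A"]) (use assms(1) in auto)
  moreover have "(x, x) \<notin> ?r" for x by (simp add: better_def)
  ultimately have "wf ?r"
    by (intro finite_acyclic_wf) (simp_all add: acyclic_def trancl_id)
  moreover have "a \<in> {x \<in> A. nbh H a \<subseteq> nbh H x}" using assms(2) by simp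
  ultimately obtain m where m: "m \<in> {x \<in> A. nbh H a \<subseteq> nbh H x}"
      "\<And>y. (y, m) \<in> ?r \<Longrightarrow> y \<notin> {x \<in> A. nbh H a \<subseteq> nbh H x}"
    by (rule wfE_min) (rule that, assumption, blast)
  have "\<not> better H \<nu> b m" if "b \<in> A" for b
  proof
    assume b: "better H \<nu> b m"
    then have "nbh H m \<subseteq> nbh H b" unfolding better_def by (elim disjE) (simp_all add: psubset_imp_subset)
    then have "nbh H a \<subseteq> nbh H b" using m(1) by auto
    moreover have "(b, m) \<in> ?r" using b m(1) that by simp
    ultimately show False using m(2)[of b] that by simp
  qed
  with m(1) have "m \<in> best H \<nu> A" "nbh H a \<subseteq> nbh H m" by (simp_all add: best_def)
  then show ?thesis ..
qed

text \<open>The endpoints are replaced one after the other: from \<open>{a, b}\<close> to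
  \<open>{m, b}\<close> to \<open>{m, m'}\<close>. Hence colors may always be exchanged for
  dominating ones.\<close>

lemma dominated_edge:
  assumes "{a, b} \<in> edges H" "b \<in> verts H" "m \<in> verts H" "nbh H a \<subseteq> nbh H m" "nbh H b \<subseteq> nbh H m'"
  shows "{m, m'} \<in> edges H"
proof -
  have "b \<in> nbh H a" using assms(1,2) by (simp add: nbh_def insert_commute)
  then have "b \<in> nbh H m" by (rule subsetD[OF assms(4)])
  then have "m \<in> nbh H b" using assms(3) by (simp add: nbh_def insert_commute)
  then have "m \<in> nbh H m'" by (rule subsetD[OF assms(5)])
  then show ?thesis by (simp add: nbh_def)
qed

lemma list_colorable_best:
  assumes "graph H" "instance_of H G L"
  shows "list_colorable H G (\<lambda>v. best H \<nu> (L v)) \<longleftrightarrow> list_colorable H G L"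
proof
  assume "list_colorable H G L"
  then obtain \<phi> where \<phi>: "\<And>v. v \<in> verts G \<Longrightarrow> \<phi> v \<in> L v"
      "\<And>u v. {u, v} \<in> edges G \<Longrightarrow> {\<phi> u, \<phi> v} \<in> edges H"
    by (auto simp: list_colorable_def)
  have L: "L v \<subseteq> verts H" if "v \<in> verts G" for v
    using that assms(2) by (auto simp: instance_of_def)
  have "\<exists>m\<in>best H \<nu> (L v). nbh H (\<phi> v) \<subseteq> nbh H m" if "v \<in> verts G" for v
    using assms(1) L[OF that] \<phi>(1)[OF that]
    by (intro best_dominates) (auto simp: graph_def intro: finite_subset)
  then have "\<forall>v\<in>verts G. \<exists>m. m \<in> best H \<nu> (L v) \<and> nbh H (\<phi> v) \<subseteq> nbh H m" by blast
  from bchoice[OF this] obtain m where "\<forall>v\<in>verts G. m v \<in> best H \<nu> (L v) \<and> nbh H (\<phi> v) \<subseteq> nbh H (m v)" ..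
  then have m: "\<And>v. v \<in> verts G \<Longrightarrow> m v \<in> best H \<nu> (L v)"
      "\<And>v. v \<in> verts G \<Longrightarrow> nbh H (\<phi> v) \<subseteq> nbh H (m v)" by simp_all
  have "{m u, m v} \<in> edges H" if e: "{u, v} \<in> edges G" for u v
  proof -
    have uv: "u \<in> verts G" "v \<in> verts G"
      using graph_edgeD[OF _ e] assms(2) by (simp_all add: instance_of_def)
    have mu: "m u \<in> verts H" using m(1)[OF uv(1)] L[OF uv(1)] by (auto simp: best_def)
    have "\<phi> v \<in> verts H" using \<phi>(1) L uv by blast
    then show ?thesis using dominated_edge[OF \<phi>(2)[OF e] _ mu m(2)[OF uv(1)] m(2)[OF uv(2)]] by simp
  qed
  then show "list_colorable H G (\<lambda>v. best H \<nu> (L v))"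
    using m(1) by (auto simp: list_colorable_def)
qed (auto simp: list_colorable_def best_def)

text \<open>If the colors around \<open>w\<close> have no common neighbor in \<open>L w\<close>,
  some minimal subset of them has none, and this has at most \<open>c_star H\<close> elements by the
  very definition of \<open>c_star\<close>. One neighbor per color then gives a set \<open>T\<close>
  of the same size. Conversely, vertices outside the cover are pairwise nonadjacent, so their colors
  can be chosen independently.\<close>

lemma list_colorable_iff_constraints:
  assumes H: "graph H" and G: "instance_of H G L" and C: "vertex_cover G C"
  shows "list_colorable H G L \<longleftrightarrow> (\<exists>\<phi>. (\<forall>v\<in>C. \<phi> v \<in> L v) \<and>
    (\<forall>u\<in>C. \<forall>v\<in>C. {u, v} \<in> edges G \<longrightarrow> {\<phi> u, \<phi> v} \<in> edges H) \<and>
    (\<forall>w\<in>verts G - C. \<forall>T\<subseteq>nbh G w. finite T \<and> card T \<le> c_star H \<longrightarrow> has_common_nbr H (L w) (\<phi> ` T)))"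
    (is "?L \<longleftrightarrow> ?R")
proof
  assume ?L
  then obtain \<phi> where \<phi>: "\<And>v. v \<in> verts G \<Longrightarrow> \<phi> v \<in> L v"
      "\<And>u v. {u, v} \<in> edges G \<Longrightarrow> {\<phi> u, \<phi> v} \<in> edges H"
    by (auto simp: list_colorable_def)
  have "has_common_nbr H (L w) (\<phi> ` T)" if w: "w \<in> verts G" and T: "T \<subseteq> nbh G w" for w T
    unfolding has_common_nbr_def
  proof (intro bexI ballI)
    show "\<phi> w \<in> L w" using \<phi>(1) w .
    fix s assume "s \<in> \<phi> ` T"
    then obtain u where "s = \<phi> u" "{u, w} \<in> edges G" using T by (auto simp: nbh_def)
    then show "\<phi> w \<in> nbh H s"
      using \<phi>(2)[of u w] \<phi>(1)[OF w] w G by (auto simp: nbh_def insert_commute instance_of_def)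
  qed
  moreover have "C \<subseteq> verts G" using C by (simp add: vertex_cover_def)
  ultimately show ?R using \<phi> by (intro exI[of _ \<phi>]) (simp add: subset_iff)
next
  assume ?R
  then obtain \<phi> where *: "\<forall>v\<in>C. \<phi> v \<in> L v"
      "\<forall>u\<in>C. \<forall>v\<in>C. {u, v} \<in> edges G \<longrightarrow> {\<phi> u, \<phi> v} \<in> edges H"
      "\<forall>w\<in>verts G - C. \<forall>T\<subseteq>nbh G w. finite T \<and> card T \<le> c_star H \<longrightarrow> has_common_nbr H (L w) (\<phi> ` T)"
    by (elim exE conjE) (rule that)
  have \<phi>: "\<And>v. v \<in> C \<Longrightarrow> \<phi> v \<in> L v"
      "\<And>u v. u \<in> C \<Longrightarrow> v \<in> C \<Longrightarrow> {u, v} \<in> edges G \<Longrightarrow> {\<phi> u, \<phi> v} \<in> edges H"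
    using *(1,2) by simp_all
  have T: "has_common_nbr H (L w) (\<phi> ` T)"
    if "w \<in> verts G - C" "T \<subseteq> nbh G w" "finite T" "card T \<le> c_star H" for w T
    using *(3) that by simp
  have CG: "C \<subseteq> verts G" using C by (simp add: vertex_cover_def)
  have nb: "nbh G w \<subseteq> C" if "w \<in> verts G - C" for w
  proof
    fix u assume "u \<in> nbh G w"
    then have "{u, w} \<inter> C \<noteq> {}" using C unfolding nbh_def vertex_cover_def by blast
    with that show "u \<in> C" by blast
  qed
  have "has_common_nbr H (L w) (\<phi> ` nbh G w)" if w: "w \<in> verts G - C" for w
  proof (rule ccontr)
    assume bad: "\<not> ?thesis"
    have "\<phi> ` nbh G w \<subseteq> verts H"
      using nb[OF w] \<phi>(1) CG G unfolding instance_of_def by blast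
    from H this bad obtain S where S: "S \<subseteq> \<phi> ` nbh G w" "minimal_without_common_nbr H (L w) S"
      by (rule exists_minimal_without_common_nbr)
    have "card S \<le> c_star H"
      using w G by (intro card_le_c_star[OF H _ S(2)]) (auto simp: instance_of_def)
    moreover obtain T' where T': "T' \<subseteq> nbh G w" "inj_on \<phi> T'" "S = \<phi> ` T'"
      using S(1) unfolding subset_image_inj by (elim exE conjE) (rule that)
    moreover have "finite (nbh G w)" using G by (simp add: instance_of_def graph_def nbh_def)
    then have "finite T'" using T'(1) finite_subset by blast
    ultimately have "has_common_nbr H (L w) S" using T[OF w, of T'] by (simp add: card_image)
    then show False using S(2) by (simp add: minimal_without_common_nbr_def)
  qed
  then have "\<forall>w\<in>verts G - C. \<exists>z. z \<in> L w \<and> (\<forall>u\<in>nbh G w. z \<in> nbh H (\<phi> u))"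
    unfolding has_common_nbr_def by blast
  from bchoice[OF this] obtain z
    where "\<forall>w\<in>verts G - C. z w \<in> L w \<and> (\<forall>u\<in>nbh G w. z w \<in> nbh H (\<phi> u))" ..
  then have z: "\<And>w. w \<in> verts G - C \<Longrightarrow> z w \<in> L w"
      "\<And>w u. w \<in> verts G - C \<Longrightarrow> u \<in> nbh G w \<Longrightarrow> z w \<in> nbh H (\<phi> u)"
    by blast+
  define \<psi> where "\<psi> v = (if v \<in> C then \<phi> v else z v)" for v
  have "\<psi> v \<in> L v" if "v \<in> verts G" for v using that z(1) \<phi>(1) by (simp add: \<psi>_def)
  moreover have "{\<psi> u, \<psi> v} \<in> edges H" if e: "{u, v} \<in> edges G" for u v
  proof -
    have uv: "u \<in> verts G" "v \<in> verts G" "u \<in> C \<or> v \<in> C"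
      using graph_edgeD[OF _ e] e G C by (auto simp: instance_of_def vertex_cover_def)
    have "{\<phi> a, z b} \<in> edges H" if "a \<in> C" "b \<in> verts G - C" "{a, b} \<in> edges G" for a b
    proof -
      have "a \<in> nbh G b" using that CG by (auto simp: nbh_def)
      then have "z b \<in> nbh H (\<phi> a)" using z(2) that by blast
      then show ?thesis by (simp add: nbh_def insert_commute)
    qed
    then have "u \<notin> C \<Longrightarrow> {\<phi> v, z u} \<in> edges H" "v \<notin> C \<Longrightarrow> {\<phi> u, z v} \<in> edges H"
      using uv e by (auto simp: insert_commute)
    then show ?thesis
      using uv e \<phi>(2) by (cases "u \<in> C"; cases "v \<in> C") (simp_all add: \<psi>_def insert_commute)
  qed
  ultimately show ?L by (auto simp: list_colorable_def)
qed

definition colors :: "'h graph \<Rightarrow> ('h \<Rightarrow> nat) \<Rightarrow> data \<Rightarrow> 'h set" where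
  "colors H \<nu> l = {a \<in> verts H. enc_nat (\<nu> a) \<in> set (to_list l)}"

text \<open>Assignments color items instead of vertices because a constraint mentions only items;
  the label \<open>Leaf\<close> selects the edge semantics.\<close>

definition sat :: "'h graph \<Rightarrow> ('h \<Rightarrow> nat) \<Rightarrow> (data \<Rightarrow> 'h) \<Rightarrow> data \<Rightarrow> bool" where
  "sat H \<nu> \<phi> r \<longleftrightarrow> (if hd_data r = Leaf
     then {\<phi> (hd_data (tl_data r)), \<phi> (hd_data (tl_data (tl_data r)))} \<in> edges H
     else has_common_nbr H (colors H \<nu> (tl_data (hd_data r))) (\<phi> ` set (to_list (tl_data r))))"

lemma has_length_enc_list [simp]: "has_length n (enc_list s) \<longleftrightarrow> length s = n"
  by (induction n arbitrary: s) (case_tac s; simp)+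

lemma same_lists_enc_list:
  "length s = n \<Longrightarrow> length t = n \<Longrightarrow>
     same_lists n (enc_list s) (enc_list t) \<longleftrightarrow> map tl_data s = map tl_data t \<and> list_all2 (\<noteq>) s t"
proof (induction n arbitrary: s t)
  case (Suc n)
  then show ?case by (cases s; cases t) auto
qed simp

lemma corner_list_enc_list:
  "length s = n \<Longrightarrow> length t = n \<Longrightarrow> set (corner_list n (enc_list s) (enc_list t)) = enc_list ` corners s t"
proof (induction n arbitrary: s t)
  case (Suc n)
  obtain a s' b t' where st: "s = a # s'" "t = b # t'" "length s' = n" "length t' = n"
    using Suc.prems by (auto simp: length_Suc_conv)
  have "set (corner_list (Suc n) (enc_list s) (enc_list t)) =
      Node a ` enc_list ` corners s' t' \<union> Node b ` enc_list ` corners s' t'"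
    using Suc.IH[OF st(3,4)] by (auto simp: st)
  also have "\<dots> = enc_list ` corners s t"
    by (simp add: st corners_Cons image_Un image_image)
  finally show ?case .
qed simp

lemma enc_list_eq_iff [simp]: "enc_list s = enc_list t \<longleftrightarrow> s = t"
  by (metis to_list_enc_list)

lemma redundant_iff:
  assumes "0 < c"
  shows "redundant c S (Node l (enc_list s)) \<longleftrightarrow> length s = c \<and>
    (\<exists>t. Node l (enc_list t) \<in> set S \<and> length t = c \<and> map tl_data s = map tl_data t \<and> list_all2 (\<noteq>) s t \<and>
       (\<forall>y\<in>corners s t. y = s \<or> Node l (enc_list y) \<in> set S))" (is "?L \<longleftrightarrow> ?R")
proof
  assume ?L
  then obtain r' where r': "r' \<in> set S" "hd_data r' = l" "has_length c (tl_data r')"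
      "same_lists c (enc_list s) (tl_data r')" "length s = c"
      "\<forall>y\<in>set (corner_list c (enc_list s) (tl_data r')). y = enc_list s \<or> Node l y \<in> set S"
    by (auto simp: redundant_def)
  define t where "t = to_list (tl_data r')"
  have t: "tl_data r' = enc_list t" by (simp add: t_def)
  \<comment> \<open>This is where \<open>0 < c\<close> enters: as
    \<open>tl_data Leaf = Leaf\<close>, the tree \<open>Leaf\<close> would pass for a constraint
    with an empty tuple.\<close>
  have "r' \<noteq> Leaf" using r'(3) assms by (cases c) auto
  then have "r' = Node l (enc_list t)" using r'(2) t by (cases r') auto
  then show ?R using r' unfolding t
    by (intro conjI exI[of _ t]) (auto simp: same_lists_enc_list corner_list_enc_list)
next
  assume ?R
  then obtain t where t: "length s = c" "Node l (enc_list t) \<in> set S" "length t = c"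
      "map tl_data s = map tl_data t" "list_all2 (\<noteq>) s t" "\<forall>y\<in>corners s t. y = s \<or> Node l (enc_list y) \<in> set S"
    by auto
  then show ?L unfolding redundant_def
    by (auto intro!: bexI[OF _ t(2)] simp: same_lists_enc_list corner_list_enc_list)
qed

text \<open>A left inverse for the proofs only: it gives injectivity of \<open>enc_nat\<close> and
  reads the vertex back from its item.\<close>

fun dec_nat :: "data \<Rightarrow> nat" where
  "dec_nat Leaf = 0"
| "dec_nat (Node b x) = (if b = Leaf then 0 else 1) + 2 * dec_nat x"

lemma dec_enc_nat [simp]: "dec_nat (enc_nat n) = n"
proof (induction n rule: less_induct)
  case (less n)
  show ?case
  proof (cases "n = 0")
    case False
    then show ?thesis using less[of "n div 2"] by (subst enc_nat.simps) (auto simp: odd_two_times_div_two_succ)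
  qed (simp add: enc_nat.simps)
qed

lemma enc_nat_eq_iff [simp]: "enc_nat m = enc_nat n \<longleftrightarrow> m = n"
  by (metis dec_enc_nat)

lemma set_tuples: "set (tuples n N) = enc_list ` {t. set t \<subseteq> set N \<and> length t \<le> n}"
proof (induction n)
  case (Suc n)
  have "{t. set t \<subseteq> set N \<and> length t \<le> Suc n} =
      insert [] (\<Union>x\<in>set N. (#) x ` {t. set t \<subseteq> set N \<and> length t \<le> n})" (is "?A = ?B")
  proof (intro set_eqI)
    fix t show "t \<in> ?A \<longleftrightarrow> t \<in> ?B" by (cases t) auto
  qed
  then have "enc_list ` {t. set t \<subseteq> set N \<and> length t \<le> Suc n} =
      insert Leaf (\<Union>x\<in>set N. Node x ` enc_list ` {t. set t \<subseteq> set N \<and> length t \<le> n})"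
    by (simp add: image_UN image_image)
  then show ?case using Suc by simp
qed (auto simp: image_def)

lemma cover_fold_mono: "set (to_list s) \<subseteq> set (to_list (cover_fold es s))"
proof (induction es arbitrary: s)
  case (Cons e es)
  show ?case
    using Cons[of s] Cons[of "Node (hd_data e) (Node (tl_data e) s)"] by auto
qed simp

lemma cover_fold_covers:
  "e \<in> set es \<Longrightarrow> hd_data e \<in> set (to_list (cover_fold es s)) \<or> tl_data e \<in> set (to_list (cover_fold es s))"
proof (induction es arbitrary: s)
  case (Cons x es)
  show ?case
  proof (cases "e \<in> set es")
    case True
    then show ?thesis unfolding foldt.simps by (rule Cons.IH)
  next
    case False
    then have "x = e" using Cons.prems by simp
    then show ?thesis
      using cover_fold_mono[of s es] cover_fold_mono[of "Node (hd_data e) (Node (tl_data e) s)" es] by auto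
  qed
qed simp

text \<open>Whenever a pair is added, both entries are new and at least one lies in the cover
  \<open>K\<close>. So \<open>K\<close> keeps at least half of the collected elements.\<close>

lemma cover_fold_card:
  assumes "finite K" "\<And>e. e \<in> set es \<Longrightarrow> hd_data e \<in> K \<or> tl_data e \<in> K"
    and "card (set (to_list s)) \<le> 2 * card (K \<inter> set (to_list s))"
  shows "card (set (to_list (cover_fold es s))) \<le> 2 * card (K \<inter> set (to_list (cover_fold es s)))"
  using assms(2,3)
proof (induction es arbitrary: s)
  case (Cons e es)
  show ?case
  proof (cases "hd_data e \<in> set (to_list s) \<or> tl_data e \<in> set (to_list s)")
    case True
    then show ?thesis using Cons.IH[of s] Cons.prems by simp
  next
    case False
    let ?A = "set (to_list s)" and ?P = "{hd_data e, tl_data e}"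
    have "card (?P \<union> ?A) \<le> 2 + card ?A"
      by (rule order_trans[OF card_Un_le]) (auto simp: card_insert_if)
    also have "\<dots> \<le> 2 * (card (K \<inter> ?P) + card (K \<inter> ?A))"
    proof -
      have "K \<inter> ?P \<noteq> {}" using Cons.prems(1)[of e] by auto
      then have "1 \<le> card (K \<inter> ?P)" by (simp add: Suc_le_eq card_gt_0_iff)
      then show ?thesis using Cons.prems(2) by simp
    qed
    also have "card (K \<inter> ?P) + card (K \<inter> ?A) = card (K \<inter> (?P \<union> ?A))"
      using False by (subst card_Un_disjoint[symmetric]) (auto intro: arg_cong[of _ _ card])
    finally show ?thesis
      using Cons.IH[of "Node (hd_data e) (Node (tl_data e) s)"] Cons.prems(1) False by simp
  qed
qed simp

abbreviation enc_colors :: "('h \<Rightarrow> nat) \<Rightarrow> 'h list \<Rightarrow> data" where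
  "enc_colors \<nu> xs \<equiv> enc_list (map (enc_nat \<circ> \<nu>) xs)"

definition pair_codes :: "'h graph \<Rightarrow> ('h \<Rightarrow> nat) \<Rightarrow> ('h \<Rightarrow> 'h \<Rightarrow> bool) \<Rightarrow> data set" where
  "pair_codes H \<nu> P = {Node (enc_nat (\<nu> a)) (enc_nat (\<nu> b)) |a b. a \<in> verts H \<and> b \<in> verts H \<and> P a b}"

text \<open>A finite relation on the vertices of \<open>H\<close> as a constant of the program. Only
  its set of entries matters, so any order will do.\<close>

definition pair_table :: "'h graph \<Rightarrow> ('h \<Rightarrow> nat) \<Rightarrow> ('h \<Rightarrow> 'h \<Rightarrow> bool) \<Rightarrow> data list" where
  "pair_table H \<nu> P = (SOME xs. set xs = pair_codes H \<nu> P)"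

lemma set_pair_table: assumes "graph H" shows "set (pair_table H \<nu> P) = pair_codes H \<nu> P"
proof -
  have "pair_codes H \<nu> P \<subseteq> (\<lambda>(a, b). Node (enc_nat (\<nu> a)) (enc_nat (\<nu> b))) ` (verts H \<times> verts H)"
    by (auto simp: pair_codes_def)
  then have "finite (pair_codes H \<nu> P)"
    by (rule finite_subset) (use assms in \<open>intro finite_imageI finite_cartesian_product, simp_all add: graph_def\<close>)
  from someI_ex[OF finite_list[OF this]] show ?thesis unfolding pair_table_def .
qed

lemma pair_codes_iff:
  assumes "inj_on \<nu> (verts H)" "a \<in> verts H" "b \<in> verts H"
  shows "Node (enc_nat (\<nu> a)) (enc_nat (\<nu> b)) \<in> pair_codes H \<nu> P \<longleftrightarrow> P a b"
proof
  assume "Node (enc_nat (\<nu> a)) (enc_nat (\<nu> b)) \<in> pair_codes H \<nu> P"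
  then obtain a' b' where "a' \<in> verts H" "b' \<in> verts H" "P a' b'" "\<nu> a = \<nu> a'" "\<nu> b = \<nu> b'"
    unfolding pair_codes_def by auto
  moreover from this have "a = a'" "b = b'" using assms by (auto dest: inj_onD)
  ultimately show "P a b" by simp
next
  assume "P a b"
  then show "Node (enc_nat (\<nu> a)) (enc_nat (\<nu> b)) \<in> pair_codes H \<nu> P" unfolding pair_codes_def using assms by blast
qed

section \<open>The constraints of an encoded input\<close>

locale encoded_instance =
  fixes H :: "'h graph" and \<nu> :: "'h \<Rightarrow> nat" and G :: "nat graph" and L :: "nat \<Rightarrow> 'h set"
    and d :: data and vs :: "nat list" and ls :: "nat \<Rightarrow> 'h list" and es :: "(nat \<times> nat) list"
    and BT :: "data list" and c :: nat
  assumes H: "graph H" and inj: "inj_on \<nu> (verts H)" and G: "instance_of H G L"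
    and vs: "distinct vs" "set vs = verts G"
    and ls: "\<And>v. v \<in> verts G \<Longrightarrow> distinct (ls v) \<and> set (ls v) = L v"
    and es: "(\<lambda>(u, v). {u, v}) ` set es = edges G"
    and d: "d = Node
          (enc_list (map (\<lambda>v. Node (enc_nat v) (enc_colors \<nu> (ls v))) vs))
          (enc_list (map (\<lambda>(u, v). Node (enc_nat u) (enc_nat v)) es))"
    and BT: "set BT = pair_codes H \<nu> (better H \<nu>)"
    and c: "c = c_star H"
begin

definition item :: "nat \<Rightarrow> data" where
  "item v = Node (enc_nat v) (enc_list (reduce_list BT (map (enc_nat \<circ> \<nu>) (ls v))))"

definition C :: "nat set" where
  "C = {v \<in> verts G. enc_nat v \<in> set (greedy_cover (edge_list d))}"

abbreviation edge_con :: "nat \<Rightarrow> nat \<Rightarrow> data" where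
  "edge_con u v \<equiv> Node Leaf (enc_list [item u, item v])"

abbreviation nbr_con :: "nat \<Rightarrow> nat list \<Rightarrow> data" where
  "nbr_con w t \<equiv> Node (Node Leaf (tl_data (item w))) (enc_list (map item t))"

lemma item_eq_iff [simp]: "item u = item v \<longleftrightarrow> u = v"
  by (auto simp: item_def)

lemma hd_item [simp]: "hd_data (item v) = enc_nat v"
  by (simp add: item_def)

lemma items: "items BT d = map item vs"
  by (simp add: items_def d item_def)

lemma edge_list: "edge_list d = map (\<lambda>(u, v). Node (enc_nat u) (enc_nat v)) es"
  by (simp add: edge_list_def d)

lemma cover_items: "cover_items BT d = map item (filter (\<lambda>v. v \<in> C) vs)"
proof -
  have "filter (\<lambda>v. enc_nat v \<in> set (greedy_cover (edge_list d))) vs = filter (\<lambda>v. v \<in> C) vs"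
    by (rule filter_cong) (simp_all add: C_def vs(2))
  then show ?thesis by (simp add: cover_items_def items filter_map o_def)
qed

lemma set_other_items: "set (other_items BT d) = item ` (verts G - C)"
  by (auto simp: other_items_def items C_def vs(2))

lemma mem_edge_list: "Node (enc_nat u) (enc_nat v) \<in> set (edge_list d) \<longleftrightarrow> (u, v) \<in> set es"
proof
  assume "(u, v) \<in> set es"
  then show "Node (enc_nat u) (enc_nat v) \<in> set (edge_list d)"
    unfolding edge_list set_map by (rule rev_image_eqI) simp
qed (auto simp: edge_list)

lemma mem_edges: "{u, v} \<in> edges G \<longleftrightarrow> (u, v) \<in> set es \<or> (v, u) \<in> set es"
proof
  assume "{u, v} \<in> edges G"
  then have "{u, v} \<in> (\<lambda>(u, v). {u, v}) ` set es" by (simp add: es)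
  then obtain a b where "(a, b) \<in> set es" "{u, v} = {a, b}" by auto
  then show "(u, v) \<in> set es \<or> (v, u) \<in> set es" by (auto simp: doubleton_eq_iff)
next
  have "{a, b} \<in> edges G" if "(a, b) \<in> set es" for a b
    unfolding es[symmetric] using that by (rule rev_image_eqI) simp
  then show "(u, v) \<in> set es \<or> (v, u) \<in> set es \<Longrightarrow> {u, v} \<in> edges G"
    by (metis insert_commute)
qed

lemma adjacent: "adjacent (edge_list d) (item u) (item v) \<longleftrightarrow> {u, v} \<in> edges G"
  by (simp add: adjacent_def mem_edge_list mem_edges)

lemma C_subset: "C \<subseteq> verts G"
  by (auto simp: C_def)

lemma finite_verts: "finite (verts G)"
  using G by (simp add: instance_of_def graph_def)

lemma vertex_cover_C: "vertex_cover G C"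
  unfolding vertex_cover_def
proof (intro conjI ballI C_subset)
  fix e assume "e \<in> edges G"
  then have "e \<in> (\<lambda>(u, v). {u, v}) ` set es" by (simp add: es)
  then obtain u v where uv: "(u, v) \<in> set es" "e = {u, v}" by auto
  have "u \<in> verts G" "v \<in> verts G"
    using graph_edgeD[of G u v] G \<open>e \<in> edges G\<close> uv(2) by (auto simp: instance_of_def)
  moreover have "enc_nat u \<in> set (greedy_cover (edge_list d)) \<or> enc_nat v \<in> set (greedy_cover (edge_list d))"
    using cover_fold_covers[of "Node (enc_nat u) (enc_nat v)" "edge_list d" Leaf] uv(1)
    by (simp add: greedy_cover_def mem_edge_list)
  ultimately show "e \<inter> C \<noteq> {}" unfolding uv(2) C_def by blast
qed

lemma card_C: "card C \<le> 2 * vc_number G"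
proof -
  have "vertex_cover G (verts G)"
    using G by (auto simp: vertex_cover_def instance_of_def graph_def)
  then have "\<exists>k C'. vertex_cover G C' \<and> card C' = k" by blast
  from LeastI_ex[OF this] obtain K where K: "vertex_cover G K" "card K = vc_number G"
    unfolding vc_number_def by blast
  have fK: "finite K" using K(1) finite_verts finite_subset by (auto simp: vertex_cover_def)
  let ?s = "cover_fold (edge_list d) Leaf"
  have "hd_data e \<in> enc_nat ` K \<or> tl_data e \<in> enc_nat ` K" if e: "e \<in> set (edge_list d)" for e
  proof -
    obtain u v where uv: "(u, v) \<in> set es" "e = Node (enc_nat u) (enc_nat v)"
      using e by (auto simp: edge_list)
    then have "{u, v} \<in> edges G" by (simp add: mem_edges)
    moreover have "\<And>e. e \<in> edges G \<Longrightarrow> e \<inter> K \<noteq> {}" using K(1) by (simp add: vertex_cover_def)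
    ultimately have "{u, v} \<inter> K \<noteq> {}" by blast
    then have "u \<in> K \<or> v \<in> K" by blast
    then show ?thesis by (auto simp: uv)
  qed
  then have "card (set (to_list ?s)) \<le> 2 * card (enc_nat ` K \<inter> set (to_list ?s))"
    using fK by (intro cover_fold_card) auto
  also have "card (enc_nat ` K \<inter> set (to_list ?s)) \<le> card (enc_nat ` K)"
    using fK by (intro card_mono) auto
  also have "\<dots> \<le> card K" using fK by (rule card_image_le)
  finally have "card (set (greedy_cover (edge_list d))) \<le> 2 * vc_number G"
    by (simp add: greedy_cover_def K(2))
  moreover have "card (enc_nat ` C) \<le> card (set (greedy_cover (edge_list d)))"
    by (intro card_mono) (auto simp: C_def)
  moreover have "card (enc_nat ` C) = card C" by (intro card_image) (simp add: inj_on_def)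
  ultimately show ?thesis by simp
qed

lemma L_subset: "v \<in> verts G \<Longrightarrow> L v \<subseteq> verts H"
  using G by (simp add: instance_of_def)

text \<open>It keeps the order of \<open>ls v\<close>, so that its code is literally the tree
  computed by \<open>reduce_list\<close>.\<close>

definition best_list :: "nat \<Rightarrow> 'h list" where
  "best_list v = filter (\<lambda>a. a \<in> best H \<nu> (L v)) (ls v)"

lemma best_list:
  assumes "v \<in> verts G"
  shows "distinct (best_list v)" "set (best_list v) = best H \<nu> (L v)"
    "tl_data (item v) = enc_colors \<nu> (best_list v)"
proof -
  show "distinct (best_list v)" using ls[OF assms] by (simp add: best_list_def)
  show "set (best_list v) = best H \<nu> (L v)" using ls[OF assms] by (auto simp: best_list_def best_def)
  have BT_iff: "Node (enc_nat (\<nu> b)) (enc_nat (\<nu> a)) \<in> set BT \<longleftrightarrow> better H \<nu> b a" if "a \<in> L v" "b \<in> L v" for a b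
    unfolding BT using that L_subset[OF assms] by (intro pair_codes_iff[OF inj]) auto
  have "reduce_list BT (map (enc_nat \<circ> \<nu>) (ls v)) =
      map (enc_nat \<circ> \<nu>) (filter (\<lambda>a. \<not> (\<exists>b\<in>L v. Node (enc_nat (\<nu> b)) (enc_nat (\<nu> a)) \<in> set BT)) (ls v))"
    using ls[OF assms] by (auto simp: reduce_list_def filter_map o_def)
  also have "filter (\<lambda>a. \<not> (\<exists>b\<in>L v. Node (enc_nat (\<nu> b)) (enc_nat (\<nu> a)) \<in> set BT)) (ls v) =
      best_list v"
    unfolding best_list_def using ls[OF assms] BT_iff by (intro filter_cong) (auto simp: best_def)
  finally show "tl_data (item v) = enc_colors \<nu> (best_list v)"
    by (simp only: item_def tl_data.simps)
qed

lemma colors_enc: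
  assumes "set xs \<subseteq> verts H" shows "colors H \<nu> (enc_colors \<nu> xs) = set xs"
proof
  show "set xs \<subseteq> colors H \<nu> (enc_colors \<nu> xs)"
    using assms by (auto simp: colors_def)
  show "colors H \<nu> (enc_colors \<nu> xs) \<subseteq> set xs"
  proof
    fix a assume "a \<in> colors H \<nu> (enc_colors \<nu> xs)"
    then obtain b where "a \<in> verts H" "b \<in> set xs" "\<nu> a = \<nu> b" by (auto simp: colors_def)
    then show "a \<in> set xs" using assms inj by (metis inj_onD subsetD)
  qed
qed

lemma colors_item: "v \<in> verts G \<Longrightarrow> colors H \<nu> (tl_data (item v)) = best H \<nu> (L v)"
  unfolding best_list(3) by (subst colors_enc) (use best_list(2) L_subset[of v] in \<open>auto simp: best_def\<close>)

lemma nbh_subset_C: assumes "w \<in> verts G - C" shows "nbh G w \<subseteq> C"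
proof
  fix u assume "u \<in> nbh G w"
  then have "{u, w} \<inter> C \<noteq> {}" using vertex_cover_C unfolding nbh_def vertex_cover_def by blast
  with assms show "u \<in> C" by blast
qed

lemma nbh_iff: "w \<in> verts G - C \<Longrightarrow> u \<in> nbh G w \<longleftrightarrow> u \<in> C \<and> {w, u} \<in> edges G"
  using nbh_subset_C[of w] C_subset unfolding nbh_def insert_commute[of w] by blast

lemma set_constraints:
  "set (constraints c BT d) =
     {edge_con u v |u v. u \<in> C \<and> v \<in> C \<and> {u, v} \<in> edges G} \<union>
     {nbr_con w t |w t.
        w \<in> verts G - C \<and> set t \<subseteq> nbh G w \<and> length t \<le> c}"
proof -
  have CI: "set (cover_items BT d) = item ` C" using vs(2) C_subset by (auto simp: cover_items)
  have tup: "set (tuples c (filter (adjacent (edge_list d) (item w)) (cover_items BT d))) =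
      (\<lambda>t. enc_list (map item t)) ` {t. set t \<subseteq> nbh G w \<and> length t \<le> c}" if w: "w \<in> verts G - C" for w
  proof -
    have "{i \<in> item ` C. adjacent (edge_list d) (item w) i} = item ` nbh G w"
      using nbh_iff[OF w] by (auto simp: adjacent)
    moreover have "{t. set t \<subseteq> item ` A \<and> length t \<le> c} = map item ` {t. set t \<subseteq> A \<and> length t \<le> c}" for A
    proof -
      have "{t. set t \<subseteq> item ` A \<and> length t \<le> c} = {t \<in> lists (item ` A). length t \<le> c}"
        by (simp add: lists_eq_set)
      also have "\<dots> = map item ` {t \<in> lists A. length t \<le> c}"
        unfolding lists_image by auto
      finally show ?thesis by (simp add: lists_eq_set)
    qed
    ultimately show ?thesis by (simp add: set_tuples CI image_image)
  qed
  have 1: "set (concat (map (\<lambda>i. map (\<lambda>j. Node Leaf (Node i (Node j Leaf)))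
        (filter (adjacent (edge_list d) i) (cover_items BT d))) (cover_items BT d))) =
      {edge_con u v |u v. u \<in> C \<and> v \<in> C \<and> {u, v} \<in> edges G}"
    by (auto simp: CI adjacent)
  have "set (concat (map (\<lambda>i. map (\<lambda>t. Node (Node Leaf (tl_data i)) t)
        (tuples c (filter (adjacent (edge_list d) i) (cover_items BT d)))) (other_items BT d))) =
      (\<Union>w\<in>verts G - C. Node (Node Leaf (tl_data (item w))) `
         set (tuples c (filter (adjacent (edge_list d) (item w)) (cover_items BT d))))"
    by (simp add: set_other_items)
  also have "\<dots> = (\<Union>w\<in>verts G - C. Node (Node Leaf (tl_data (item w))) `
         (\<lambda>t. enc_list (map item t)) ` {t. set t \<subseteq> nbh G w \<and> length t \<le> c})"
    by (intro SUP_cong refl) (simp add: tup)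
  also have "\<dots> = {nbr_con w t |w t.
        w \<in> verts G - C \<and> set t \<subseteq> nbh G w \<and> length t \<le> c}"
    by blast
  finally have 2: "set (concat (map (\<lambda>i. map (\<lambda>t. Node (Node Leaf (tl_data i)) t)
        (tuples c (filter (adjacent (edge_list d) i) (cover_items BT d)))) (other_items BT d))) = \<dots>" .
  show ?thesis unfolding constraints_def set_remdups set_append 1 2 ..
qed

lemma constraint_cases:
  assumes "r \<in> set (constraints c BT d)"
  obtains (edge) u v where "r = edge_con u v" "u \<in> C" "v \<in> C"
  | (other) w t where "r = nbr_con w t"
      "w \<in> verts G - C" "set t \<subseteq> C" "length t \<le> c"
  using assms unfolding set_constraints
proof (elim UnE CollectE exE conjE)
  fix w t assume *: "r = nbr_con w t"
    "w \<in> verts G - C" "set t \<subseteq> nbh G w" "length t \<le> c"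
  from *(3) nbh_subset_C[OF *(2)] have "set t \<subseteq> C" by (rule subset_trans)
  with * show ?thesis by (intro other)
qed (rule edge)

lemma ball_constraints:
  "(\<forall>r\<in>set (constraints c BT d). Q r) \<longleftrightarrow>
     (\<forall>u\<in>C. \<forall>v\<in>C. {u, v} \<in> edges G \<longrightarrow> Q (edge_con u v)) \<and>
     (\<forall>w\<in>verts G - C. \<forall>t. set t \<subseteq> nbh G w \<and> length t \<le> c \<longrightarrow>
         Q (nbr_con w t))"
proof -
  have "(\<forall>r\<in>{f u v |u v. u \<in> C \<and> v \<in> C \<and> {u, v} \<in> edges G}. Q r) \<longleftrightarrow>
      (\<forall>u\<in>C. \<forall>v\<in>C. {u, v} \<in> edges G \<longrightarrow> Q (f u v))" for f by blast
  moreover have "(\<forall>r\<in>{f w t |w t. w \<in> verts G - C \<and> set t \<subseteq> nbh G w \<and> length t \<le> c}. Q r) \<longleftrightarrow>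
      (\<forall>w\<in>verts G - C. \<forall>t. set t \<subseteq> nbh G w \<and> length t \<le> c \<longrightarrow> Q (f w t))" for f by blast
  ultimately show ?thesis unfolding set_constraints ball_Un by (simp only:)
qed

lemma list_colorable_iff_sat:
  "list_colorable H G L \<longleftrightarrow> (\<exists>\<phi>. (\<forall>i\<in>item ` C. \<phi> i \<in> colors H \<nu> (tl_data i)) \<and>
     (\<forall>r\<in>set (constraints c BT d). sat H \<nu> \<phi> r))"
proof -
  have sat_E: "sat H \<nu> \<phi> (edge_con u v) \<longleftrightarrow> {\<phi> (item u), \<phi> (item v)} \<in> edges H" for \<phi> u v
    by (simp add: sat_def)
  have sat_L: "sat H \<nu> \<phi> (nbr_con w t) \<longleftrightarrow>
      has_common_nbr H (best H \<nu> (L w)) ((\<lambda>v. \<phi> (item v)) ` set t)" if "w \<in> verts G" for \<phi> w t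
    using that by (simp add: sat_def colors_item image_image)
  have inst: "instance_of H G (\<lambda>v. best H \<nu> (L v))"
    using G by (auto simp: instance_of_def best_def)
  \<comment> \<open>Sets of at most \<open>c\<close> vertices are exactly the ranges of tuples of
    length at most \<open>c\<close>; repetitions in a tuple only make the range smaller.\<close>
  have sets: "(\<forall>T\<subseteq>nbh G w. finite T \<and> card T \<le> c_star H \<longrightarrow> P T) \<longleftrightarrow>
      (\<forall>t. set t \<subseteq> nbh G w \<and> length t \<le> c \<longrightarrow> P (set t))" for w P
  proof (intro iffI allI impI)
    fix t assume *: "\<forall>T\<subseteq>nbh G w. finite T \<and> card T \<le> c_star H \<longrightarrow> P T" "set t \<subseteq> nbh G w \<and> length t \<le> c"
    then show "P (set t)" using card_length[of t] c by simp
  next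
    fix T assume *: "\<forall>t. set t \<subseteq> nbh G w \<and> length t \<le> c \<longrightarrow> P (set t)" "T \<subseteq> nbh G w" "finite T \<and> card T \<le> c_star H"
    then obtain t where "set t = T" "distinct t" using finite_distinct_list by blast
    then show "P T" using * c distinct_card[of t] by auto
  qed
  let ?P = "\<lambda>\<phi>. (\<forall>v\<in>C. \<phi> v \<in> best H \<nu> (L v)) \<and>
      (\<forall>u\<in>C. \<forall>v\<in>C. {u, v} \<in> edges G \<longrightarrow> {\<phi> u, \<phi> v} \<in> edges H) \<and>
      (\<forall>w\<in>verts G - C. \<forall>t. set t \<subseteq> nbh G w \<and> length t \<le> c \<longrightarrow> has_common_nbr H (best H \<nu> (L w)) (\<phi> ` set t))"
  have "list_colorable H G L \<longleftrightarrow> list_colorable H G (\<lambda>v. best H \<nu> (L v))"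
    using list_colorable_best[OF H G] by simp
  also have "\<dots> \<longleftrightarrow> (\<exists>\<phi>. ?P \<phi>)"
    unfolding list_colorable_iff_constraints[OF H inst vertex_cover_C] sets ..
  also have "\<dots> \<longleftrightarrow> (\<exists>\<phi>. ?P (\<lambda>v. \<phi> (item v)))"
  proof
    assume "\<exists>\<phi>. ?P \<phi>"
    then obtain \<phi> where "?P \<phi>" ..
    \<comment> \<open>A coloring of vertices becomes one of items by decoding the name stored in the
      item.\<close>
    then have "?P (\<lambda>v. (\<lambda>i. \<phi> (dec_nat (hd_data i))) (item v))" by (simp only: hd_item dec_enc_nat)
    then show "\<exists>\<phi>. ?P (\<lambda>v. \<phi> (item v))" by (rule exI[of _ "\<lambda>i. \<phi> (dec_nat (hd_data i))"])
  next
    assume "\<exists>\<phi>. ?P (\<lambda>v. \<phi> (item v))"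
    then obtain \<phi> where \<phi>: "?P (\<lambda>v. \<phi> (item v))" ..
    show "\<exists>\<phi>. ?P \<phi>" by (rule exI[of _ "\<lambda>v. \<phi> (item v)"], rule \<phi>)
  qed
  also have "\<dots> \<longleftrightarrow> (\<exists>\<phi>. (\<forall>i\<in>item ` C. \<phi> i \<in> colors H \<nu> (tl_data i)) \<and>
     (\<forall>r\<in>set (constraints c BT d). sat H \<nu> \<phi> r))"
  proof (intro ex_cong1)
    fix \<phi>
    have "(\<forall>i\<in>item ` C. \<phi> i \<in> colors H \<nu> (tl_data i)) \<longleftrightarrow> (\<forall>v\<in>C. \<phi> (item v) \<in> best H \<nu> (L v))"
      by (simp add: colors_item subsetD[OF C_subset])
    moreover have "(\<forall>r\<in>set (constraints c BT d). sat H \<nu> \<phi> r) \<longleftrightarrow>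
      (\<forall>u\<in>C. \<forall>v\<in>C. {u, v} \<in> edges G \<longrightarrow> sat H \<nu> \<phi> (edge_con u v)) \<and>
      (\<forall>w\<in>verts G - C. \<forall>t. set t \<subseteq> nbh G w \<and> length t \<le> c \<longrightarrow>
         sat H \<nu> \<phi> (nbr_con w t))"
      by (rule ball_constraints)
    ultimately show "?P (\<lambda>v. \<phi> (item v)) \<longleftrightarrow> (\<forall>i\<in>item ` C. \<phi> i \<in> colors H \<nu> (tl_data i)) \<and>
        (\<forall>r\<in>set (constraints c BT d). sat H \<nu> \<phi> r)"
      unfolding sat_E by (simp add: sat_L)
  qed
  finally show ?thesis .
qed

end

section \<open>The output graph and its equivalence with the constraints\<close>

definition after :: "'a list \<Rightarrow> 'a \<Rightarrow> 'a list" where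
  "after S r = tl (dropWhile (\<lambda>x. x \<noteq> r) S)"

lemma after_Cons: "after (x # S) r = (if x = r then S else after S r)"
  by (simp add: after_def)

text \<open>In a distinct list an element determines its suffix, so the position-dependent map
  becomes an ordinary one.\<close>

lemma ctails_after: "distinct S \<Longrightarrow> ctails g S = concat (map (\<lambda>r. g r (after S r)) S)"
proof (induction S)
  case (Cons x S)
  have eq: "map (\<lambda>r. g r (after (x # S) r)) S = map (\<lambda>r. g r (after S r)) S"
    using Cons.prems by (intro map_cong) (auto simp: after_Cons)
  have "ctails g (x # S) = g x S @ concat (map (\<lambda>r. g r (after (x # S) r)) S)"
    unfolding eq using Cons by simp
  then show ?case by (simp add: after_Cons)
qed simp

lemma after_subset: "set (after S r) \<subseteq> set S"
  by (induction S) (auto simp: after_Cons after_def)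

lemma length_after_less: "r \<in> set S \<Longrightarrow> length (after S r) < length S"
  by (induction S) (auto simp: after_Cons)

lemma length_after_inj:
  "distinct S \<Longrightarrow> r \<in> set S \<Longrightarrow> r' \<in> set S \<Longrightarrow> length (after S r) = length (after S r') \<Longrightarrow> r = r'"
proof (induction S)
  case (Cons x S)
  show ?case
    using Cons length_after_less[of r S] length_after_less[of r' S] by (auto simp: after_Cons split: if_splits)
qed simp

text \<open>Of two different entries exactly one comes later; applied to the two orientations of an
  edge, exactly one of them emits it.\<close>

lemma after_total:
  "distinct S \<Longrightarrow> r \<in> set S \<Longrightarrow> r' \<in> set S \<Longrightarrow> r \<noteq> r' \<Longrightarrow> r \<in> set (after S r') \<longleftrightarrow> r' \<notin> set (after S r)"
proof (induction S)
  case (Cons x S)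
  have "x \<notin> set (after S y)" for y using after_subset[of S y] Cons.prems(1) by auto
  then show ?case using Cons by (auto simp: after_Cons)
qed simp

lemma distinct_map_concat:
  assumes "distinct S" "\<And>r. r \<in> set S \<Longrightarrow> distinct (map f (h r))"
    and "\<And>r r' x x'. r \<in> set S \<Longrightarrow> r' \<in> set S \<Longrightarrow> x \<in> set (h r) \<Longrightarrow> x' \<in> set (h r') \<Longrightarrow> f x = f x' \<Longrightarrow> r = r'"
  shows "distinct (map f (concat (map h S)))"
  using assms
proof (induction S)
  case (Cons r S)
  have "f ` set (h r) \<inter> f ` (\<Union>r'\<in>set S. set (h r')) = {}"
  proof (rule ccontr)
    assume "\<not> ?thesis"
    then obtain x x' r' where "x \<in> set (h r)" "r' \<in> set S" "x' \<in> set (h r')" "f x = f x'" by auto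
    then have "r = r'" using Cons.prems(3)[of r r' x x'] by simp
    then show False using Cons.prems(1) \<open>r' \<in> set S\<close> by simp
  qed
  then show ?case using Cons by (simp add: image_UN)
qed simp

lemma enc_nat_double_Suc: "enc_nat (2 * n + 1) = Node (Node Leaf Leaf) (enc_nat n)"
  by (subst enc_nat.simps) simp

text \<open>With the least significant bit first, a power of two is a run of zero bits followed by a
  one. Such a name is written down by copying a list, without arithmetic, and its length is linear
  in the number of constraints.\<close>

lemma enc_nat_power: "enc_nat (2 ^ k) = enc_list (replicate k Leaf @ [Node Leaf Leaf])"
proof (induction k)
  case 0
  show ?case by (simp add: enc_nat.simps)
next
  case (Suc k)
  have "enc_nat (2 ^ Suc k) = Node Leaf (enc_nat (2 ^ k))"
    by (subst enc_nat.simps) simp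
  then show ?case using Suc by simp
qed

lemma fresh_name: "fresh_name rest = enc_nat (2 ^ Suc (length rest))"
  by (simp only: enc_nat_power fresh_name_def replicate_Suc map_replicate_const append_Cons)

locale kernel_output = encoded_instance H \<nu> G L d vs ls es BT c
  for H :: "'h graph" and \<nu> G L d vs ls es BT c +
  fixes S :: "data list"
  assumes S: "distinct S" "set S \<subseteq> set (constraints c BT d)"
begin

definition new_vertex :: "data \<Rightarrow> nat" where
  "new_vertex r = 2 ^ Suc (length (after S r))"

text \<open>A shared constraint vertex may stem from many outside vertices. Any one with the right
  list will do, since \<open>origin\<close> serves only to supply that list.\<close>

definition origin :: "nat \<Rightarrow> nat" where
  "origin n = (if odd n then n div 2
     else (SOME w. w \<in> verts G - C \<and> (\<exists>r\<in>set S. new_vertex r = n \<and> hd_data r = Node Leaf (tl_data (item w)))))"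

definition Cs :: "nat list" where
  "Cs = filter (\<lambda>v. v \<in> C) vs"

definition out_verts :: "nat list" where
  "out_verts = map (\<lambda>v. 2 * v + 1) Cs @ map new_vertex (filter (\<lambda>r. hd_data r \<noteq> Leaf) S)"

definition vertex :: "data \<Rightarrow> nat" where
  "vertex i = dec_nat (hd_data i)"

definition out_edges_of :: "data \<Rightarrow> (nat \<times> nat) list" where
  "out_edges_of r = (if hd_data r = Leaf then
       (if reversed r \<in> set (after S r) then []
        else [(2 * vertex (hd_data (tl_data r)) + 1, 2 * vertex (hd_data (tl_data (tl_data r))) + 1)])
     else map (\<lambda>i. (new_vertex r, 2 * vertex i + 1)) (remdups (to_list (tl_data r))))"

definition out_edges :: "(nat \<times> nat) list" where
  "out_edges = concat (map out_edges_of S)"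

definition out_graph :: "nat graph" where
  "out_graph = \<lparr>verts = set out_verts, edges = (\<lambda>(u, v). {u, v}) ` set out_edges\<rparr>"

definition out_lists :: "nat \<Rightarrow> 'h set" where
  "out_lists n = set (best_list (origin n))"

lemma vertex_item [simp]: "vertex (item v) = v"
  by (simp add: vertex_def)

lemma set_Cs: "set Cs = C" "distinct Cs" "length Cs = card C"
proof -
  show 1: "set Cs = C" using vs(2) C_subset by (auto simp: Cs_def)
  show 2: "distinct Cs" using vs(1) by (simp add: Cs_def)
  show "length Cs = card C" using distinct_card[OF 2] 1 by simp
qed

lemma new_vertex_inj: "r \<in> set S \<Longrightarrow> r' \<in> set S \<Longrightarrow> new_vertex r = new_vertex r' \<Longrightarrow> r = r'"
  using length_after_inj[OF S(1), of r r'] by (simp add: new_vertex_def)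

lemma even_new_vertex: "even (new_vertex r)"
  by (simp add: new_vertex_def)

lemmas S_cases [consumes 1, case_names edge other] = constraint_cases[OF subsetD[OF S(2)]]

lemma origin_odd [simp]: "origin (Suc (2 * v)) = v"
  by (simp add: origin_def)

lemma origin_new:
  assumes "r \<in> set S" "hd_data r \<noteq> Leaf"
  shows "origin (new_vertex r) \<in> verts G - C" "hd_data r = Node Leaf (tl_data (item (origin (new_vertex r))))"
proof -
  let ?P = "\<lambda>w. w \<in> verts G - C \<and> (\<exists>r'\<in>set S. new_vertex r' = new_vertex r \<and> hd_data r' = Node Leaf (tl_data (item w)))"
  have "\<exists>w. ?P w" using assms(1)
  proof (cases rule: S_cases)
    case (other w t)
    then have "?P w" using assms(1) by auto
    then show ?thesis ..
  qed (use assms(2) in simp)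
  then have P: "?P (SOME w. ?P w)" by (rule someI_ex)
  have "origin (new_vertex r) = (SOME w. ?P w)"
    using even_new_vertex[of r] by (simp add: origin_def)
  with P have P: "?P (origin (new_vertex r))" by simp
  then show "origin (new_vertex r) \<in> verts G - C" by blast
  obtain r' where r': "r' \<in> set S" "new_vertex r' = new_vertex r"
      "hd_data r' = Node Leaf (tl_data (item (origin (new_vertex r))))" using P by blast
  then have "r' = r" using assms(1) by (intro new_vertex_inj)
  then show "hd_data r = Node Leaf (tl_data (item (origin (new_vertex r))))" using r'(3) by simp
qed

lemma origin_verts: "n \<in> set out_verts \<Longrightarrow> origin n \<in> verts G"
  using origin_new(1) C_subset by (auto simp: out_verts_def set_Cs)

lemma distinct_out_verts: "distinct out_verts"
proof -
  have "distinct (map (\<lambda>v. 2 * v + 1) Cs)" using set_Cs(2) by (simp add: distinct_map inj_on_def)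
  moreover have "distinct (map new_vertex (filter (\<lambda>r. hd_data r \<noteq> Leaf) S))"
    using S(1) new_vertex_inj by (auto simp: distinct_map intro!: inj_onI)
  moreover have "2 * v + 1 \<noteq> new_vertex r" for v r using even_new_vertex[of r] by presburger
  ultimately show ?thesis by (auto simp: out_verts_def)
qed

lemma kernel_verts: "kernel_verts (cover_items BT d) S =
  map (\<lambda>n. Node (enc_nat n) (enc_colors \<nu> (best_list (origin n)))) out_verts"
proof -
  have 1: "Node (cover_name (item v)) (tl_data (item v)) =
      Node (enc_nat (2 * v + 1)) (enc_colors \<nu> (best_list (origin (2 * v + 1))))" if "v \<in> C" for v
  proof -
    have "v \<in> verts G" using that C_subset by blast
    then show ?thesis using best_list(3)[of v] enc_nat_double_Suc[of v] by (simp add: cover_name_def)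
  qed
  have 2: "ctails (\<lambda>r rest. if hd_data r = Leaf then [] else [Node (fresh_name rest) (tl_data (hd_data r))]) S =
      map (\<lambda>r. Node (enc_nat (new_vertex r)) (tl_data (hd_data r))) (filter (\<lambda>r. hd_data r \<noteq> Leaf) S)"
  proof -
    have *: "concat (map (\<lambda>r. if P r then [] else [f r]) Q) = map f (filter (\<lambda>r. \<not> P r) Q)" for P f and Q :: "data list"
      by (induction Q) auto
    show ?thesis unfolding ctails_after[OF S(1)] fresh_name new_vertex_def[symmetric] by (rule *)
  qed
  have 3: "Node (enc_nat (new_vertex r)) (tl_data (hd_data r)) =
      Node (enc_nat (new_vertex r)) (enc_colors \<nu> (best_list (origin (new_vertex r))))"
    if "r \<in> set S" "hd_data r \<noteq> Leaf" for r
    using origin_new[OF that] best_list(3)[of "origin (new_vertex r)"] by simp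
  have "map (\<lambda>i. Node (cover_name i) (tl_data i)) (cover_items BT d) =
      map (\<lambda>n. Node (enc_nat n) (enc_colors \<nu> (best_list (origin n)))) (map (\<lambda>v. 2 * v + 1) Cs)"
    unfolding cover_items Cs_def[symmetric] map_map o_def
    by (intro map_cong refl) (use 1 set_Cs(1) in \<open>simp add: o_def\<close>)
  moreover have "map (\<lambda>r. Node (enc_nat (new_vertex r)) (tl_data (hd_data r))) (filter (\<lambda>r. hd_data r \<noteq> Leaf) S) =
      map (\<lambda>n. Node (enc_nat n) (enc_colors \<nu> (best_list (origin n))))
        (map new_vertex (filter (\<lambda>r. hd_data r \<noteq> Leaf) S))"
    unfolding map_map o_def
    by (intro map_cong refl) (use 3 in \<open>simp add: o_def\<close>)
  ultimately show ?thesis by (simp add: kernel_verts_def out_verts_def 2)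
qed

lemma kernel_edges: "kernel_edges S = map (\<lambda>(u, v). Node (enc_nat u) (enc_nat v)) out_edges"
proof -
  have nm: "cover_name (item v) = enc_nat (2 * v + 1)" for v
    using enc_nat_double_Suc[of v] by (simp add: cover_name_def)
  have "(if hd_data r = Leaf then
       (if reversed r \<in> set (after S r) then []
        else [Node (cover_name (hd_data (tl_data r))) (cover_name (hd_data (tl_data (tl_data r))))])
     else map (\<lambda>i. Node (fresh_name (after S r)) (cover_name i)) (remdups (to_list (tl_data r)))) =
     map (\<lambda>(u, v). Node (enc_nat u) (enc_nat v)) (out_edges_of r)" if "r \<in> set S" for r
    using that
  proof (cases rule: S_cases)
    case (edge u v)
    then show ?thesis using nm by (simp add: out_edges_of_def)
  next
    case (other w t)
    have "\<And>i. i \<in> item ` set t \<Longrightarrow> cover_name i = enc_nat (2 * vertex i + 1)" using nm by auto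
    then show ?thesis using other(1) by (simp add: out_edges_of_def fresh_name new_vertex_def)
  qed
  then show ?thesis
    unfolding kernel_edges_def ctails_after[OF S(1)] out_edges_def map_concat map_map
    by (intro arg_cong[of _ _ concat] map_cong refl) simp
qed

lemma reversed_edge [simp]:
  "reversed (Node Leaf (enc_list [i, j])) = Node Leaf (enc_list [j, i])"
  by (simp add: reversed_def)

text \<open>If the reversed constraint occurs later, this one emits nothing, but the reversed one
  emits the same undirected edge. A loop is its own reversal and does not occur after
  itself.\<close>

lemma edge_of_edge:
  assumes "edge_con u v \<in> set S"
  shows "{2 * u + 1, 2 * v + 1} \<in> edges out_graph"
proof -
  let ?r = edge_con
  have e: "{2 * a + 1, 2 * b + 1} \<in> edges out_graph"
    if "?r a b \<in> set S" "?r b a \<notin> set (after S (?r a b))" for a b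
  proof -
    have "(2 * a + 1, 2 * b + 1) \<in> set (out_edges_of (?r a b))"
      using that(2) reversed_edge[of "item a" "item b"] by (simp add: out_edges_of_def)
    then have "(2 * a + 1, 2 * b + 1) \<in> set out_edges" using that(1) unfolding out_edges_def by auto
    then show ?thesis unfolding out_graph_def by (simp add: rev_image_eqI)
  qed
  show ?thesis
  proof (cases "?r v u \<in> set (after S (?r u v))")
    case True
    then have r: "?r v u \<in> set S" using after_subset[of S] by blast
    have "u \<noteq> v"
    proof
      assume "u = v"
      moreover have "x \<notin> set (after S x)" for x using S(1)
        by (induction S) (use after_subset in \<open>auto simp: after_Cons after_def\<close>)
      ultimately show False using True by simp
    qed
    then have "?r u v \<notin> set (after S (?r v u))"
      using after_total[OF S(1) assms r] True by simp
    then show ?thesis using e[OF r] by (simp add: insert_commute)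
  qed (use e assms in blast)
qed

lemma out_edges_cases:
  assumes "(a, b) \<in> set out_edges"
  obtains (edge) u v where "edge_con u v \<in> set S" "a = 2 * u + 1" "b = 2 * v + 1"
      "u \<in> C" "v \<in> C"
  | (other) r v where "r \<in> set S" "hd_data r \<noteq> Leaf" "a = new_vertex r" "b = 2 * v + 1"
      "item v \<in> set (to_list (tl_data r))" "v \<in> C"
proof -
  obtain r where r: "r \<in> set S" "(a, b) \<in> set (out_edges_of r)"
    using assms by (auto simp: out_edges_def)
  from r(1) show ?thesis
  proof (cases rule: S_cases)
    case (edge u v)
    then show ?thesis using r that(1)[of u v] by (auto simp: out_edges_of_def split: if_splits)
  next
    case (other w t)
    then obtain v where "v \<in> set t" "a = new_vertex r" "b = 2 * v + 1"
      using r by (auto simp: out_edges_of_def)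
    then show ?thesis using r(1) other that(2)[of r v] by auto
  qed
qed

end

context kernel_output
begin

text \<open>Parity tells the kinds of edges apart: a cover edge has two odd ends, any other edge has
  one even end, which determines its constraint. Two cover edges can coincide only through opposite
  orientations, of which one stays silent.\<close>

lemma distinct_out_edges: "distinct (map (\<lambda>(u, v). {u, v}) out_edges)"
  unfolding out_edges_def
proof (rule distinct_map_concat[OF S(1)])
  fix r assume "r \<in> set S"
  then show "distinct (map (\<lambda>(u, v). {u, v}) (out_edges_of r))"
  proof (cases rule: S_cases)
    case (other w t)
    have "inj_on (\<lambda>i. {new_vertex r, 2 * vertex i + 1}) (item ` set t)"
    proof (rule inj_onI)
      fix i j assume ij: "i \<in> item ` set t" "j \<in> item ` set t"
        "{new_vertex r, 2 * vertex i + 1} = {new_vertex r, 2 * vertex j + 1}"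
      have "new_vertex r \<noteq> 2 * vertex i + 1" using even_new_vertex[of r] by (metis even_plus_one_iff dvd_triv_left)
      then have "vertex i = vertex j" using ij(3) by (auto simp: doubleton_eq_iff)
      then show "i = j" using ij(1,2) by auto
    qed
    then show ?thesis using other(1) by (simp add: out_edges_of_def distinct_map o_def)
  qed (simp add: out_edges_of_def)
next
  fix r r' x x'
  assume r: "r \<in> set S" "r' \<in> set S" and x: "x \<in> set (out_edges_of r)" "x' \<in> set (out_edges_of r')"
    and eq: "(case x of (u, v) \<Rightarrow> {u, v}) = (case x' of (u, v) \<Rightarrow> {u, v})"
  have form: "(hd_data r = Leaf \<and> (\<exists>u v. r = edge_con u v \<and> x = (2 * u + 1, 2 * v + 1) \<and>
        edge_con v u \<notin> set (after S r))) \<or>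
      (\<exists>v. x = (new_vertex r, 2 * v + 1))"
    if "r \<in> set S" "x \<in> set (out_edges_of r)" for r x
    using that(1)
  proof (cases rule: S_cases)
    case (edge u v)
    then show ?thesis using that(2) reversed_edge[of "item u" "item v"]
      by (auto simp: out_edges_of_def split: if_splits)
  next
    case (other w t)
    then show ?thesis using that(2) by (auto simp: out_edges_of_def)
  qed
  have par: "new_vertex s \<noteq> Suc (2 * v)" "Suc (2 * v) \<noteq> new_vertex s" for s v
    using even_new_vertex[of s] by (metis even_Suc dvd_triv_left)+
  consider u v u' v' where "r = edge_con u v" "x = (2 * u + 1, 2 * v + 1)"
      "edge_con v u \<notin> set (after S r)"
      "r' = edge_con u' v'" "x' = (2 * u' + 1, 2 * v' + 1)"
      "edge_con v' u' \<notin> set (after S r')"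
    | v where "x = (new_vertex r, 2 * v + 1)" | v where "x' = (new_vertex r', 2 * v + 1)"
    using form[OF r(1) x(1)] form[OF r(2) x(2)] by blast
  then show "r = r'"
  proof cases
    case 1
    then have "u = u' \<and> v = v' \<or> u = v' \<and> v = u'" using eq by (auto simp: doubleton_eq_iff)
    then show ?thesis
    proof
      assume swap: "u = v' \<and> v = u'"
      show ?thesis
      proof (rule ccontr)
        assume "r \<noteq> r'"
        then show False using after_total[OF S(1) r] 1 swap by auto
      qed
    qed (use 1 in simp)
  next
    case 2
    then have "\<exists>v'. x' = (new_vertex r', 2 * v' + 1)" using form[OF r(2) x(2)] eq par by (auto simp: doubleton_eq_iff)
    then have "new_vertex r = new_vertex r'" using eq 2 par by (auto simp: doubleton_eq_iff)
    then show ?thesis by (rule new_vertex_inj[OF r])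
  next
    case 3
    then have "\<exists>v'. x = (new_vertex r, 2 * v' + 1)" using form[OF r(1) x(1)] eq par by (auto simp: doubleton_eq_iff)
    then have "new_vertex r = new_vertex r'" using eq 3 par by (auto simp: doubleton_eq_iff)
    then show ?thesis by (rule new_vertex_inj[OF r])
  qed
qed

lemma out_instance: "instance_of H out_graph out_lists"
proof -
  have "\<exists>u\<in>verts out_graph. \<exists>v\<in>verts out_graph. e = {u, v}" if e: "e \<in> edges out_graph" for e
  proof -
    obtain a b where ab: "(a, b) \<in> set out_edges" "e = {a, b}" using e by (auto simp: out_graph_def)
    from ab(1) have "a \<in> set out_verts \<and> b \<in> set out_verts"
      by (cases rule: out_edges_cases) (auto simp: out_verts_def set_Cs)
    then show ?thesis using ab(2) by (auto simp: out_graph_def)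
  qed
  moreover have "out_lists n \<subseteq> verts H" if "n \<in> verts out_graph" for n
  proof -
    have "origin n \<in> verts G" using that origin_verts by (simp add: out_graph_def)
    then show ?thesis using best_list(2)[of "origin n"] L_subset[of "origin n"] by (auto simp: out_lists_def best_def)
  qed
  ultimately show ?thesis by (auto simp: instance_of_def graph_def out_graph_def)
qed

lemma out_encodes:
  "encodes \<nu> out_graph out_lists (Node (enc_list (kernel_verts (cover_items BT d) S)) (enc_list (kernel_edges S)))"
  unfolding encodes_def
proof (intro exI conjI)
  show "distinct out_verts" by (rule distinct_out_verts)
  show "set out_verts = verts out_graph" by (simp add: out_graph_def)
  show "\<forall>v\<in>verts out_graph. distinct ((best_list \<circ> origin) v) \<and> set ((best_list \<circ> origin) v) = out_lists v"
    using origin_verts best_list(1) by (simp add: out_graph_def out_lists_def)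
  show "distinct (map (\<lambda>(u, v). {u, v}) out_edges)" by (rule distinct_out_edges)
  show "(\<lambda>(u, v). {u, v}) ` set out_edges = edges out_graph" by (simp add: out_graph_def)
qed (simp add: kernel_verts kernel_edges)

lemma out_colorable_iff:
  "list_colorable H out_graph out_lists \<longleftrightarrow>
     (\<exists>\<phi>. (\<forall>i\<in>item ` C. \<phi> i \<in> colors H \<nu> (tl_data i)) \<and> (\<forall>r\<in>set S. sat H \<nu> \<phi> r))"
proof
  assume "list_colorable H out_graph out_lists"
  then obtain \<psi> where \<psi>: "\<And>n. n \<in> set out_verts \<Longrightarrow> \<psi> n \<in> out_lists n"
      "\<And>a b. {a, b} \<in> edges out_graph \<Longrightarrow> {\<psi> a, \<psi> b} \<in> edges H"
    by (auto simp: list_colorable_def out_graph_def)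
  define \<phi> where "\<phi> i = \<psi> (2 * vertex i + 1)" for i
  have "\<phi> i \<in> colors H \<nu> (tl_data i)" if i: "i \<in> item ` C" for i
  proof -
    obtain v where v: "i = item v" "v \<in> C" using i by blast
    then have "v \<in> verts G" using C_subset by blast
    moreover have "2 * v + 1 \<in> set out_verts" using v(2) by (simp add: out_verts_def set_Cs)
    ultimately show ?thesis
      using \<psi>(1)[of "2 * v + 1"] by (simp add: v \<phi>_def out_lists_def best_list(2) colors_item)
  qed
  moreover have "sat H \<nu> \<phi> r" if r: "r \<in> set S" for r
    using r
  proof (cases rule: S_cases)
    case (edge u v)
    then have "{2 * u + 1, 2 * v + 1} \<in> edges out_graph" using r by (intro edge_of_edge) simp
    from \<psi>(2)[OF this] show ?thesis by (simp add: edge(1) sat_def \<phi>_def)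
  next
    case (other w t)
    let ?n = "new_vertex r"
    have hd: "hd_data r \<noteq> Leaf" by (simp add: other(1))
    have n: "?n \<in> set out_verts" using r hd by (simp add: out_verts_def)
    have w: "origin ?n \<in> verts G" using n by (rule origin_verts)
    have "tl_data (hd_data r) = tl_data (item (origin ?n))" using origin_new(2)[OF r hd] by simp
    then have col: "colors H \<nu> (tl_data (hd_data r)) = best H \<nu> (L (origin ?n))"
      using colors_item[OF w] by simp
    have "has_common_nbr H (best H \<nu> (L (origin ?n))) (\<phi> ` set (to_list (tl_data r)))"
      unfolding has_common_nbr_def
    proof (intro bexI ballI)
      show z: "\<psi> ?n \<in> best H \<nu> (L (origin ?n))" using \<psi>(1)[OF n] by (simp add: out_lists_def best_list(2)[OF w])
      fix s assume "s \<in> \<phi> ` set (to_list (tl_data r))"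
      then obtain v where v: "v \<in> set t" "s = \<phi> (item v)" by (auto simp: other(1))
      have "(?n, 2 * v + 1) \<in> set (out_edges_of r)"
        using hd v(1) by (auto simp: out_edges_of_def) (auto simp: other(1) image_iff intro!: bexI[of _ "item v"])
      then have "(?n, 2 * v + 1) \<in> set out_edges" using r by (auto simp: out_edges_def)
      then have "{?n, 2 * v + 1} \<in> edges out_graph" unfolding out_graph_def by (simp add: rev_image_eqI)
      from \<psi>(2)[OF this] have "{\<psi> ?n, s} \<in> edges H" by (simp add: v(2) \<phi>_def)
      moreover have "\<psi> ?n \<in> verts H" using z L_subset[OF w] by (auto simp: best_def)
      ultimately show "\<psi> ?n \<in> nbh H s" by (simp add: nbh_def)
    qed
    then show ?thesis using hd by (simp add: sat_def col)
  qed
  ultimately show "\<exists>\<phi>. (\<forall>i\<in>item ` C. \<phi> i \<in> colors H \<nu> (tl_data i)) \<and> (\<forall>r\<in>set S. sat H \<nu> \<phi> r)"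
    by blast
next
  assume "\<exists>\<phi>. (\<forall>i\<in>item ` C. \<phi> i \<in> colors H \<nu> (tl_data i)) \<and> (\<forall>r\<in>set S. sat H \<nu> \<phi> r)"
  then obtain \<phi> where \<phi>: "\<And>i. i \<in> item ` C \<Longrightarrow> \<phi> i \<in> colors H \<nu> (tl_data i)" "\<And>r. r \<in> set S \<Longrightarrow> sat H \<nu> \<phi> r"
    by blast
  have "\<forall>r\<in>{r \<in> set S. hd_data r \<noteq> Leaf}. \<exists>z. z \<in> colors H \<nu> (tl_data (hd_data r)) \<and>
      (\<forall>i\<in>set (to_list (tl_data r)). z \<in> nbh H (\<phi> i))"
    using \<phi>(2) by (fastforce simp: sat_def has_common_nbr_def)
  from bchoice[OF this] obtain z where z: "\<forall>r\<in>{r \<in> set S. hd_data r \<noteq> Leaf}. z r \<in> colors H \<nu> (tl_data (hd_data r)) \<and>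
      (\<forall>i\<in>set (to_list (tl_data r)). z r \<in> nbh H (\<phi> i))" ..
  \<comment> \<open>Odd names belong to cover vertices, whose color is given by \<phi>. An even name
    identifies its constraint, whose vertex takes the common neighbor \<open>z r\<close>.\<close>
  define \<psi> where "\<psi> n = (if odd n then \<phi> (item (n div 2)) else z (THE r. r \<in> set S \<and> new_vertex r = n))" for n
  have \<psi>_odd: "\<psi> (2 * v + 1) = \<phi> (item v)" for v by (simp add: \<psi>_def)
  have \<psi>_new: "\<psi> (new_vertex r) = z r" if "r \<in> set S" for r
  proof -
    have "(THE r'. r' \<in> set S \<and> new_vertex r' = new_vertex r) = r"
      using that new_vertex_inj by (intro the_equality) auto
    then show ?thesis using even_new_vertex[of r] by (simp add: \<psi>_def)
  qed
  have "\<psi> n \<in> out_lists n" if n: "n \<in> set out_verts" for n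
  proof -
    from n consider v where "n = 2 * v + 1" "v \<in> C" | r where "n = new_vertex r" "r \<in> set S" "hd_data r \<noteq> Leaf"
      by (auto simp: out_verts_def set_Cs)
    then show ?thesis
    proof cases
      case 1
      have v: "v \<in> verts G" using 1(2) C_subset by blast
      have "\<phi> (item v) \<in> best H \<nu> (L v)" using \<phi>(1)[of "item v"] 1(2) colors_item[OF v] by simp
      then show ?thesis unfolding 1(1) \<psi>_odd by (simp add: out_lists_def best_list(2)[OF v])
    next
      case 2
      have w: "origin n \<in> verts G" using n by (rule origin_verts)
      have "tl_data (hd_data r) = tl_data (item (origin n))" using origin_new(2)[OF 2(2,3)] 2(1) by simp
      moreover have "z r \<in> colors H \<nu> (tl_data (hd_data r))" using z 2(2,3) by blast
      ultimately have "z r \<in> best H \<nu> (L (origin n))" using colors_item[OF w] by simp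
      then show ?thesis
        unfolding out_lists_def best_list(2)[OF w] using \<psi>_new[OF 2(2)] 2(1) by simp
    qed
  qed
  moreover have "{\<psi> a, \<psi> b} \<in> edges H" if ab: "(a, b) \<in> set out_edges" for a b
    using ab
  proof (cases rule: out_edges_cases)
    case (edge u v)
    have "{\<phi> (item u), \<phi> (item v)} \<in> edges H" using \<phi>(2)[OF edge(1)] by (simp add: sat_def)
    then show ?thesis using edge(2,3) \<psi>_odd by simp
  next
    case (other r v)
    have "z r \<in> nbh H (\<phi> (item v))" using z other by blast
    then show ?thesis using other(3,4) \<psi>_odd \<psi>_new[OF other(1)] by (simp add: nbh_def)
  qed
  then have "{\<psi> a, \<psi> b} \<in> edges H" if e: "{a, b} \<in> edges out_graph" for a b
  proof -
    obtain a' b' where "(a', b') \<in> set out_edges" "{a, b} = {a', b'}" using e by (auto simp: out_graph_def)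
    then show ?thesis
      using \<open>\<And>a b. (a, b) \<in> set out_edges \<Longrightarrow> {\<psi> a, \<psi> b} \<in> edges H\<close>[of a' b']
      by (auto simp: doubleton_eq_iff insert_commute)
  qed
  ultimately show "list_colorable H out_graph out_lists"
    unfolding list_colorable_def by (intro exI[of _ \<psi>]) (simp add: out_graph_def)
qed

lemma out_size:
  "card (verts out_graph) \<le> card C + length S" "card (edges out_graph) \<le> max 1 c * length S"
proof -
  have "length out_verts \<le> card C + length S"
    using length_filter_le[of "\<lambda>r. hd_data r \<noteq> Leaf" S] by (simp add: out_verts_def set_Cs(3))
  then show "card (verts out_graph) \<le> card C + length S"
    using card_length[of out_verts] by (simp add: out_graph_def)
  have "length (out_edges_of r) \<le> max 1 c" if "r \<in> set S" for r
    using that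
  proof (cases rule: S_cases)
    case (other w t)
    have "length (remdups (map item t)) \<le> c" using length_remdups_leq[of "map item t"] other(4) by simp
    then show ?thesis by (simp add: out_edges_of_def other(1))
  qed (simp add: out_edges_of_def)
  then have "sum_list (map (length \<circ> out_edges_of) S) \<le> sum_list (map (\<lambda>_. max 1 c) S)"
    by (intro sum_list_mono) simp
  then have "length out_edges \<le> max 1 c * length S"
    by (simp add: out_edges_def length_concat sum_list_triv mult.commute)
  moreover have "card (edges out_graph) \<le> length out_edges"
    using card_length[of "map (\<lambda>(u, v). {u, v}) out_edges"] by (simp add: out_graph_def)
  ultimately show "card (edges out_graph) \<le> max 1 c * length S" by simp
qed

end

section \<open>The size of the kernel\<close>

text \<open>All trees that can arise as a list of colors. Their number is bounded in terms of
  \<open>H\<close> alone, so labels and sequences of lists cost only a constant factor.\<close>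

definition list_codes :: "'h graph \<Rightarrow> ('h \<Rightarrow> nat) \<Rightarrow> data set" where
  "list_codes H \<nu> = enc_list ` {xs. set xs \<subseteq> enc_nat ` \<nu> ` verts H \<and> distinct xs}"

definition labels :: "'h graph \<Rightarrow> ('h \<Rightarrow> nat) \<Rightarrow> data set" where
  "labels H \<nu> = insert Leaf (Node Leaf ` list_codes H \<nu>)"

lemma card_lists_length_le_bound:
  assumes "finite X" "card X \<le> N" "1 \<le> N"
  shows "card {xs. set xs \<subseteq> X \<and> length xs \<le> m} \<le> Suc m * N ^ m"
proof -
  have "card {xs. set xs \<subseteq> X \<and> length xs \<le> m} = (\<Sum>i\<le>m. card X ^ i)"
    by (rule card_lists_length_le[OF assms(1)])
  also have "\<dots> \<le> (\<Sum>i\<le>m. N ^ m)"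
  proof (rule sum_mono)
    fix i assume "i \<in> {..m}"
    have "card X ^ i \<le> N ^ i" using assms(2) by (intro power_mono) auto
    also have "\<dots> \<le> N ^ m" using \<open>i \<in> {..m}\<close> assms(3) by (intro power_increasing) auto
    finally show "card X ^ i \<le> N ^ m" .
  qed
  finally show ?thesis by simp
qed

lemma list_codes_bound:
  assumes "graph H"
  defines "n \<equiv> card (verts H)"
  shows "finite (list_codes H \<nu>)" "card (list_codes H \<nu>) \<le> Suc n * (max 1 n) ^ n"
    "card (labels H \<nu>) \<le> Suc (Suc n * (max 1 n) ^ n)"
proof -
  let ?A = "enc_nat ` \<nu> ` verts H"
  let ?X = "{xs. set xs \<subseteq> ?A \<and> length xs \<le> n}"
  have "finite (verts H)" using assms(1) by (simp add: graph_def)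
  then have fin: "finite ?A" and A: "card ?A \<le> n"
    unfolding n_def by (auto intro!: order_trans[OF card_image_le card_image_le])
  have X: "finite ?X" by (rule finite_lists_length_le[OF fin])
  have "{xs. set xs \<subseteq> ?A \<and> distinct xs} \<subseteq> ?X"
  proof safe
    fix xs assume "set xs \<subseteq> ?A" "distinct xs"
    then show "length xs \<le> n" using card_mono[OF fin, of "set xs"] A by (simp add: distinct_card)
  qed
  then have sub: "list_codes H \<nu> \<subseteq> enc_list ` ?X"
    unfolding list_codes_def by (rule image_mono)
  then show 1: "finite (list_codes H \<nu>)" using X finite_subset by blast
  have "card (list_codes H \<nu>) \<le> card (enc_list ` ?X)" using sub X by (intro card_mono finite_imageI)
  also have "\<dots> \<le> card ?X" using X by (rule card_image_le)
  also have "\<dots> \<le> Suc n * (max 1 n) ^ n"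
    using A by (intro card_lists_length_le_bound[OF fin]) (simp_all add: le_max_iff_disj)
  finally show 2: "card (list_codes H \<nu>) \<le> Suc n * (max 1 n) ^ n" .
  have "card (labels H \<nu>) \<le> Suc (card (list_codes H \<nu>))"
    unfolding labels_def using 1 card_image_le[OF 1, of "Node Leaf"] by (simp add: card_insert_if)
  then show "card (labels H \<nu>) \<le> Suc (Suc n * (max 1 n) ^ n)" using 2 by simp
qed

lemma redundant_mono: "redundant c S r \<Longrightarrow> set S \<subseteq> set S' \<Longrightarrow> redundant c S' r"
  unfolding redundant_def by blast

lemma power_le_powr: "1 \<le> N \<Longrightarrow> real m \<le> e \<Longrightarrow> real N ^ m \<le> real N powr e"
  by (subst powr_realpow[symmetric]) (auto intro: powr_mono)

context encoded_instance
begin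

lemma set_kept_subset: "set (kept b c BT d) \<subseteq> set (constraints c BT d)"
  using greedy_delete_subset[of "redundant c" "constraints c BT d"] by (simp add: kept_def)

lemma distinct_kept: "distinct (kept b c BT d)"
  using distinct_greedy_delete[of "constraints c BT d" "redundant c"] by (simp add: kept_def constraints_def)

lemma list_code_item: assumes v: "v \<in> verts G" shows "tl_data (item v) \<in> list_codes H \<nu>"
proof -
  have b: "distinct (best_list v)" "set (best_list v) \<subseteq> verts H"
    using best_list[OF v] L_subset[OF v] by (auto simp: best_def)
  have "inj_on (enc_nat \<circ> \<nu>) (set (best_list v))"
    using inj b(2) by (auto simp: inj_on_def)
  then show ?thesis unfolding list_codes_def best_list(3)[OF v] using b
    by (intro imageI) (auto simp: distinct_map)
qed

text \<open>\<open>2 \<le> c\<close> lets the edge constraints, which are pairs, share one shape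
  with the neighborhood constraints.\<close>

lemma constraint_form:
  assumes "2 \<le> c" "r \<in> set (constraints c BT d)"
  shows "\<exists>l t. r = Node l (enc_list t) \<and> l \<in> labels H \<nu> \<and> set t \<subseteq> item ` C \<and> length t \<le> c"
proof -
  from assms(2) show ?thesis
  proof (cases rule: constraint_cases)
    case (edge u v)
    then show ?thesis using assms(1) by (intro exI[of _ Leaf] exI[of _ "[item u, item v]"]) (auto simp: labels_def)
  next
    case (other w t)
    then show ?thesis using list_code_item[of w]
      by (intro exI[of _ "Node Leaf (tl_data (item w))"] exI[of _ "map item t"]) (auto simp: labels_def)
  qed
qed

text \<open>Tuples shorter than \<open>c\<close> number \<open>O(N ^ (c - 1))\<close>, and
  \<open>c - 1 \<le> d_star H\<close>, which is at most the target exponent. Full tuples are counted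
  trivially if \<open>c \<le> d_star H\<close>. Otherwise they split into constantly many classes,
  each box-free because no kept constraint is redundant, and Erdos' bound applies to each
  class.\<close>

lemma length_kept_bound:
  assumes c2: "2 \<le> c" and N: "card C \<le> N" "1 \<le> N" and C0: "0 \<le> C0"
    and erdos: "\<And>(X :: data set) R N. finite X \<Longrightarrow> card X \<le> N \<Longrightarrow> 1 \<le> N \<Longrightarrow>
      R \<subseteq> {xs. set xs \<subseteq> X \<and> length xs = c} \<Longrightarrow> box_free R \<Longrightarrow>
      real (card R) \<le> C0 * real N powr (real c - 2 powr (1 - real c))"
    and m: "card (labels H \<nu>) \<le> m" "card (list_codes H \<nu>) \<le> m"
  shows "real (length (kept (d_star H < c) c BT d)) \<le>
    (real m * real c + real m + real (m * m ^ c) * C0) * real N powr (real (d_star H) + 1 - 2 powr (1 - real c))"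
proof -
  define S where "S = kept (d_star H < c) c BT d"
  define X where "X = item ` C"
  define \<Lambda> where "\<Lambda> = labels H \<nu>"
  define K where "K = {k. set k \<subseteq> list_codes H \<nu> \<and> length k = c}"
  define e where "e = real (d_star H) + 1 - 2 powr (1 - real c)"
  have "finite C" using C_subset finite_verts by (rule finite_subset)
  then have X: "finite X" "card X \<le> N" using N(1) card_image_le[of C item] by (auto simp: X_def)
  have fin: "finite \<Lambda>" "finite K"
    using list_codes_bound(1)[OF H] by (auto simp: \<Lambda>_def labels_def K_def finite_lists_length_eq)
  have form: "\<exists>l t. r = Node l (enc_list t) \<and> l \<in> \<Lambda> \<and> set t \<subseteq> X \<and> length t \<le> c" if "r \<in> set S" for r
    using constraint_form[OF c2] that set_kept_subset unfolding S_def \<Lambda>_def X_def by blast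
  have cd: "c \<le> d_star H + 1" using c_star_le_d_star[OF H] c by simp
  have "2 powr (1 - real c) \<le> (1::real)" using powr_mono[of "1 - real c" 0 2] c2 by simp
  then have e: "real (d_star H) \<le> e" by (simp add: e_def)
  let ?node = "\<lambda>(l, t). Node l (enc_list t)"
  define low where "low = {r \<in> set S. length (to_list (tl_data r)) \<le> c - 1}"
  define top where "top = {r \<in> set S. length (to_list (tl_data r)) = c}"
  have "set S = low \<union> top" using form c2 by (fastforce simp: low_def top_def)
  then have "card (set S) \<le> card low + card top" by (metis card_Un_le)
  moreover have "length S = card (set S)" using distinct_kept by (simp add: S_def distinct_card)
  ultimately have len: "real (length S) \<le> real (card low) + real (card top)" by linarith
  have node: "card T \<le> card \<Lambda> * card Q" if "T \<subseteq> ?node ` (\<Lambda> \<times> Q)" "finite Q" for T Q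
    using card_mono[OF _ that(1)] card_image_le[of "\<Lambda> \<times> Q" ?node] fin that(2)
    by (simp add: card_cartesian_product)
  have "low \<subseteq> ?node ` (\<Lambda> \<times> {t. set t \<subseteq> X \<and> length t \<le> c - 1})"
    using form by (fastforce simp: low_def image_iff)
  then have "card low \<le> card \<Lambda> * card {t. set t \<subseteq> X \<and> length t \<le> c - 1}"
    by (rule node) (rule finite_lists_length_le[OF X(1)])
  also have "\<dots> \<le> card \<Lambda> * (Suc (c - 1) * N ^ (c - 1))"
    using card_lists_length_le_bound[OF X N(2), of "c - 1"] by (intro mult_left_mono) auto
  finally have "real (card low) \<le> real (card \<Lambda> * (Suc (c - 1) * N ^ (c - 1)))" by (rule of_nat_mono)
  also have "\<dots> = real (card \<Lambda>) * real c * real N ^ (c - 1)" using c2 by simp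
  also have "\<dots> \<le> real (card \<Lambda>) * real c * real N powr e"
    using cd e N(2) by (intro mult_left_mono power_le_powr) auto
  finally have low: "real (card low) \<le> real (card \<Lambda>) * real c * real N powr e" .
  have top: "real (card top) \<le> (real (card \<Lambda>) + real (card (\<Lambda> \<times> K)) * C0) * real N powr e"
  proof (cases "d_star H < c")
    case False
    have "top \<subseteq> ?node ` (\<Lambda> \<times> {t. set t \<subseteq> X \<and> length t = c})"
      using form by (fastforce simp: top_def image_iff)
    then have "card top \<le> card \<Lambda> * card {t. set t \<subseteq> X \<and> length t = c}"
      by (rule node) (rule finite_lists_length_eq[OF X(1)])
    also have "\<dots> = card \<Lambda> * card X ^ c" by (simp only: card_lists_length_eq[OF X(1)])
    also have "\<dots> \<le> card \<Lambda> * N ^ c" using X(2) by (intro mult_left_mono power_mono) auto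
    finally have "real (card top) \<le> real (card \<Lambda>) * real N ^ c" by (metis of_nat_mono of_nat_mult of_nat_power)
    also have "\<dots> \<le> real (card \<Lambda>) * real N powr e"
      using False e N(2) by (intro mult_left_mono power_le_powr) auto
    also have "\<dots> \<le> (real (card \<Lambda>) + real (card (\<Lambda> \<times> K)) * C0) * real N powr e"
      using C0 by (intro mult_right_mono) auto
    finally show ?thesis .
  next
    case True
    then have S_eq: "S = greedy_delete (redundant c) (constraints c BT d)" by (simp add: S_def kept_def)
    \<comment> \<open>Within a class, label and coordinatewise lists agree, so a box inside the
      class meets all conditions that make its corner \<open>s\<close> redundant.\<close>
    define R where "R l k = {t. Node l (enc_list t) \<in> set S \<and> length t = c \<and> map tl_data t = k}" for l k
    have R_X: "R l k \<subseteq> {t. set t \<subseteq> X \<and> length t = c}" for l k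
    proof
      fix t assume "t \<in> R l k"
      then have "Node l (enc_list t) \<in> set S" "length t = c" by (simp_all add: R_def)
      then show "t \<in> {t. set t \<subseteq> X \<and> length t = c}" using form[of "Node l (enc_list t)"] by auto
    qed
    have finR: "finite (R l k)" for l k
      by (rule finite_subset[OF R_X]) (simp add: finite_lists_length_eq X(1))
    have "box_free (R l k)" for l k
      unfolding box_free_def
    proof (intro allI impI notI)
      fix s t :: "data list"
      assume st: "list_all2 (\<noteq>) s t" "corners s t \<subseteq> R l k"
      have "length t = length s" using st(1) by (simp add: list_all2_lengthD)
      then have "s \<in> R l k" "t \<in> R l k" using st(2) by (auto simp: corners_def)
      then have s: "Node l (enc_list s) \<in> set S" "length s = c"
        and t: "Node l (enc_list t) \<in> set S" "length t = c" "map tl_data s = map tl_data t"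
        by (auto simp: R_def)
      have "\<forall>y\<in>corners s t. y = s \<or> Node l (enc_list y) \<in> set S" using st(2) by (auto simp: R_def)
      then have "redundant c S (Node l (enc_list s))"
        using c2 s t st(1) by (subst redundant_iff) auto
      moreover have "\<not> redundant c S (Node l (enc_list s))"
        unfolding S_eq
        by (rule greedy_delete_irredundant[OF _ s(1)[unfolded S_eq]]) (rule redundant_mono)
      ultimately show False by contradiction
    qed
    then have cR: "real (card (R l k)) \<le> C0 * real N powr (real c - 2 powr (1 - real c))" for l k
      using erdos[OF X N(2) R_X] by blast
    \<comment> \<open>In this case \<open>d_star H < c \<le> d_star H + 1\<close>, hence equality on
      the right.\<close>
    have ec: "real c - 2 powr (1 - real c) = e" using True cd by (simp add: e_def)
    have "top \<subseteq> (\<Union>(l, k)\<in>\<Lambda> \<times> K. (\<lambda>t. Node l (enc_list t)) ` R l k)"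
    proof
      fix r assume r: "r \<in> top"
      then obtain l t where lt: "r = Node l (enc_list t)" "l \<in> \<Lambda>" "set t \<subseteq> X"
        using form[of r] by (auto simp: top_def)
      have len: "length t = c" using r lt(1) by (simp add: top_def)
      have "tl_data i \<in> list_codes H \<nu>" if "i \<in> X" for i
        using that C_subset list_code_item by (auto simp: X_def)
      then have "map tl_data t \<in> K" using lt(3) len by (auto simp: K_def)
      moreover have "t \<in> R l (map tl_data t)" using r lt(1) len by (simp add: R_def top_def)
      ultimately show "r \<in> (\<Union>(l, k)\<in>\<Lambda> \<times> K. (\<lambda>t. Node l (enc_list t)) ` R l k)"
        using lt(1,2) by blast
    qed
    then have "card top \<le> card (\<Union>(l, k)\<in>\<Lambda> \<times> K. (\<lambda>t. Node l (enc_list t)) ` R l k)"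
      using fin finR by (intro card_mono) auto
    also have "\<dots> \<le> (\<Sum>(l, k)\<in>\<Lambda> \<times> K. card ((\<lambda>t. Node l (enc_list t)) ` R l k))"
      unfolding case_prod_unfold using fin by (intro card_UN_le) auto
    also have "\<dots> \<le> (\<Sum>(l, k)\<in>\<Lambda> \<times> K. card (R l k))"
      using finR by (intro sum_mono) (auto intro: card_image_le)
    finally have "real (card top) \<le> real (\<Sum>(l, k)\<in>\<Lambda> \<times> K. card (R l k))" by (rule of_nat_mono)
    also have "\<dots> = (\<Sum>(l, k)\<in>\<Lambda> \<times> K. real (card (R l k)))" by (simp add: case_prod_unfold)
    also have "\<dots> \<le> (\<Sum>(l, k)\<in>\<Lambda> \<times> K. C0 * real N powr e)"
      using cR unfolding ec by (intro sum_mono) auto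
    also have "\<dots> = real (card (\<Lambda> \<times> K)) * C0 * real N powr e" by (simp add: case_prod_unfold)
    also have "\<dots> \<le> (real (card \<Lambda>) + real (card (\<Lambda> \<times> K)) * C0) * real N powr e"
      by (intro mult_right_mono) auto
    finally show ?thesis .
  qed
  have "real (length S) \<le> real (card \<Lambda>) * real c * real N powr e +
      (real (card \<Lambda>) + real (card (\<Lambda> \<times> K)) * C0) * real N powr e"
    using len low top by linarith
  also have "\<dots> = (real (card \<Lambda>) * real c + real (card \<Lambda>) + real (card (\<Lambda> \<times> K)) * C0) * real N powr e"
    by (simp add: algebra_simps)
  also have "\<dots> \<le> (real m * real c + real m + real (m * m ^ c) * C0) * real N powr e"
  proof (intro mult_right_mono add_mono C0)
    have "card K = card (list_codes H \<nu>) ^ c"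
      unfolding K_def by (rule card_lists_length_eq[OF list_codes_bound(1)[OF H]])
    then have "card (\<Lambda> \<times> K) \<le> m * m ^ c"
      using m by (simp add: card_cartesian_product \<Lambda>_def mult_mono power_mono)
    then show "real (card (\<Lambda> \<times> K)) \<le> real (m * m ^ c)" by (simp only: of_nat_le_iff)
  qed (use m(1) in \<open>simp_all add: \<Lambda>_def\<close>)
  finally show ?thesis unfolding S_def e_def .
qed

text \<open>The scheme \<open>greedy_delete_equiv\<close> with full-length constraints as the
  deletable ones. A deleted edge constraint is recovered by \<open>box_edge\<close>, a deleted
  neighborhood constraint by \<open>box_has_common_nbr\<close>. The choice of \<phi> from reduced
  lists provides the incomparability both require.\<close>

lemma sat_kept_iff:
  assumes c2: "2 \<le> c" and \<phi>: "\<forall>i\<in>item ` C. \<phi> i \<in> colors H \<nu> (tl_data i)"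
  shows "(\<forall>r\<in>set (kept (d_star H < c) c BT d). sat H \<nu> \<phi> r) \<longleftrightarrow> (\<forall>r\<in>set (constraints c BT d). sat H \<nu> \<phi> r)"
proof (cases "d_star H < c")
  case b: True
  have R: "(\<exists>i j. r = Node Leaf (enc_list [i, j])) \<or> (\<exists>l s. r = Node (Node Leaf l) (enc_list s))"
    if "r \<in> set (constraints c BT d)" for r
    using that unfolding set_constraints by blast
  \<comment> \<open>A neighborhood constraint stems from a vertex \<open>w\<close> for which all
    tuples of neighbors up to length \<open>c\<close> were listed, so shorter tuples of its entries
    appear with the same label.\<close>
  have low: "Node (Node Leaf l) (enc_list t) \<in> set (constraints c BT d)"
    if st: "Node (Node Leaf l) (enc_list s) \<in> set (constraints c BT d)" "length s = c" "set t \<subseteq> set s" "length t < c" for l s t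
  proof -
    obtain w s' where w: "w \<in> verts G - C" "l = tl_data (item w)" "s = map item s'" "set s' \<subseteq> nbh G w"
      using st(1) unfolding set_constraints by auto
    have "t \<in> lists (item ` set s')" using st(3) w(3) by auto
    then obtain t' where t': "t = map item t'" "set t' \<subseteq> set s'"
      unfolding lists_image by auto
    then have "set t' \<subseteq> nbh G w" "length t' \<le> c" using w(4) st(4) by auto
    then show ?thesis unfolding set_constraints using w(1,2) t'(1) by blast
  qed
  have elem: "i \<in> item ` C" if "r \<in> set (constraints c BT d)" "i \<in> set (to_list (tl_data r))" for r i
    using constraint_form[OF c2 that(1)] that(2) by auto
  have col: "\<phi> (item v) \<in> best H \<nu> (L v)" if "v \<in> C" for v
    using \<phi> that colors_item[of v] C_subset by auto
  have \<phi>H: "\<phi> i \<in> verts H" if "i \<in> item ` C" for i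
    using that col L_subset C_subset by (fastforce simp: best_def)
  have \<phi>inc: "\<phi> i = \<phi> j \<or> incomparable H (\<phi> i) (\<phi> j)" if ij: "i \<in> item ` C" "j \<in> item ` C" "tl_data i = tl_data j" for i j
  proof -
    obtain u v where uv: "i = item u" "j = item v" "u \<in> C" "v \<in> C" using ij by blast
    have G: "u \<in> verts G" "v \<in> verts G" using uv(3,4) C_subset by auto
    have "best H \<nu> (L u) = best H \<nu> (L v)"
      using ij(3) colors_item[OF G(1)] colors_item[OF G(2)] by (simp add: uv)
    then have "\<phi> (item v) \<in> best H \<nu> (L u)" using col[OF uv(4)] by simp
    then show ?thesis
      unfolding uv(1,2) using best_incomparable[OF inj L_subset[OF G(1)] col[OF uv(3)]] by blast
  qed
  let ?R = "constraints c BT d"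
  have kept: "kept (d_star H < c) c BT d = greedy_delete (redundant c) ?R" using b by (simp add: kept_def)
  show ?thesis
  proof
    assume all: "\<forall>r\<in>set (kept (d_star H < c) c BT d). sat H \<nu> \<phi> r"
    show "\<forall>r\<in>set ?R. sat H \<nu> \<phi> r"
    proof (rule greedy_delete_equiv[where red = "redundant c" and del = "\<lambda>r. has_length c (tl_data r)"])
      show "has_length c (tl_data r)" if "redundant c S r" for S r
        using that by (simp add: redundant_def)
      show "\<forall>s\<in>set (greedy_delete (redundant c) ?R). sat H \<nu> \<phi> s" using all kept by simp
    next
      fix S r
      assume red: "redundant c S r" and S: "set S \<subseteq> set ?R" and r: "r \<in> set ?R"
        and sat: "\<forall>s\<in>set S - {r}. sat H \<nu> \<phi> s" and lsat: "\<forall>s\<in>set ?R. \<not> has_length c (tl_data s) \<longrightarrow> sat H \<nu> \<phi> s"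
      obtain l s where r_eq: "r = Node l (enc_list s)" using R[OF r] by blast
      obtain t where t: "length s = c" "Node l (enc_list t) \<in> set S" "length t = c"
          "map tl_data s = map tl_data t" "list_all2 (\<noteq>) s t"
          "\<forall>y\<in>corners s t. y = s \<or> Node l (enc_list y) \<in> set S"
        using red c2 unfolding r_eq by (subst (asm) redundant_iff) auto
      have X: "s ! i \<in> item ` C" "t ! i \<in> item ` C" if "i < c" for i
        using elem[OF r] elem[of "Node l (enc_list t)" "t ! i"] t S that by (auto simp: r_eq)
      have lists: "tl_data (s ! i) = tl_data (t ! i)" if "i < c" for i
        using t(1,3,4) that by (metis nth_map)
      have inc: "\<phi> (s ! i) = \<phi> (t ! i) \<or> incomparable H (\<phi> (s ! i)) (\<phi> (t ! i))" if "i < c" for i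
        using \<phi>inc X[OF that] lists[OF that] by blast
      have corner: "sat H \<nu> \<phi> (Node l (enc_list y))" if "y \<in> corners s t" "y \<noteq> s" for y
        using that t(6) sat by (auto simp: r_eq)
      show "sat H \<nu> \<phi> r"
      proof (cases "l = Leaf")
        case True
        \<comment> \<open>The label \<open>Leaf\<close> occurs only on pairs, so a full-length edge
          constraint forces \<open>c = 2\<close>.\<close>
        have "length s = 2" using R[OF r] True by (auto simp: r_eq simp flip: enc_list.simps)
        then have ceq: "c = 2" using t(1) by simp
        obtain u v u' v' where st: "s = [u, v]" "t = [u', v']"
          using t(1,3) unfolding ceq by (auto simp: length_Suc_conv numeral_2_eq_2)
        have ne: "u \<noteq> u'" "v \<noteq> v'" using t(5) by (auto simp: st)
        have e: "{\<phi> u', \<phi> v} \<in> edges H" "{\<phi> u, \<phi> v'} \<in> edges H" "{\<phi> u', \<phi> v'} \<in> edges H"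
          using corner[of "[u', v]"] corner[of "[u, v']"] corner[of "[u', v']"] ne
          by (auto simp: st corners_Cons sat_def True)
        have "{\<phi> u, \<phi> v} \<in> edges H"
        proof (rule box_edge[OF H, where a' = "\<phi> u'" and b' = "\<phi> v'"])
          show "d_star H < 2" using b ceq by simp
          show "\<phi> u = \<phi> u' \<or> incomparable H (\<phi> u) (\<phi> u')" using inc[of 0] by (simp add: st ceq)
          show "\<phi> v = \<phi> v' \<or> incomparable H (\<phi> v) (\<phi> v')" using inc[of 1] by (simp add: st ceq)
        qed (use e \<phi>H X[of 0] X[of 1] in \<open>auto simp: st ceq\<close>)
        then show ?thesis by (simp add: r_eq sat_def True st)
      next
        case False
        then obtain l' where l': "l = Node Leaf l'" using R[OF r] by (auto simp: r_eq)
        have sat_iff: "sat H \<nu> \<phi> (Node l (enc_list y)) \<longleftrightarrow> has_common_nbr H (colors H \<nu> l') (\<phi> ` set y)" for y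
          by (simp add: sat_def l')
        show ?thesis
          unfolding r_eq sat_iff
        proof (rule box_has_common_nbr[OF H])
          show "d_star H < c_star H" using b c by simp
          show "colors H \<nu> l' \<subseteq> verts H" by (auto simp: colors_def)
          show "length s = c_star H" using t(1) c by simp
          show "list_all2 (\<noteq>) s t" by fact
          show "\<phi> (s ! i) \<in> verts H \<and> \<phi> (t ! i) \<in> verts H \<and>
              (\<phi> (s ! i) = \<phi> (t ! i) \<or> incomparable H (\<phi> (s ! i)) (\<phi> (t ! i)))" if "i < length s" for i
            using that inc[of i] X[of i] \<phi>H t(1) by simp
          show "has_common_nbr H (colors H \<nu> l') (\<phi> ` set y)" if "y \<in> corners s t" "y \<noteq> s" for y
            using corner[OF that] by (simp add: sat_iff)
          fix T assume T: "T \<subseteq> \<phi> ` set s" "card T < c_star H"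
          \<comment> \<open>One entry per color turns \<open>T\<close> into a tuple shorter than
            \<open>c\<close>; its constraint exists by \<open>low\<close> and is exempt from
            deletion.\<close>
          then obtain T' where T': "T' \<subseteq> set s" "inj_on \<phi> T'" "T = \<phi> ` T'"
            by (auto simp: subset_image_inj)
          then have "finite T'" using finite_subset by blast
          then obtain y where y: "set y = T'" "distinct y" using finite_distinct_list by blast
          have "length y = card T" using y T' by (simp add: card_image distinct_card[symmetric])
          then have "length y < c" using T(2) c by simp
          then have "Node l (enc_list y) \<in> set ?R"
            using low[of l' s y] r t(1) y T'(1) by (auto simp: r_eq l')
          then have "sat H \<nu> \<phi> (Node l (enc_list y))" using lsat \<open>length y < c\<close> by auto
          then show "has_common_nbr H (colors H \<nu> l') T" using T'(3) y by (simp add: sat_iff)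
        qed
      qed
    qed
  next
    assume "\<forall>r\<in>set ?R. sat H \<nu> \<phi> r"
    then show "\<forall>r\<in>set (kept (d_star H < c) c BT d). sat H \<nu> \<phi> r"
      using greedy_delete_subset[of "redundant c" ?R] kept by auto
  qed
qed (simp add: kept_def)

lemma list_colorable_iff_kept:
  assumes "2 \<le> c"
  shows "list_colorable H G L \<longleftrightarrow> (\<exists>\<phi>. (\<forall>i\<in>item ` C. \<phi> i \<in> colors H \<nu> (tl_data i)) \<and>
     (\<forall>r\<in>set (kept (d_star H < c) c BT d). sat H \<nu> \<phi> r))"
  unfolding list_colorable_iff_sat using sat_kept_iff[OF assms] by blast

end

section \<open>Assembling the kernel when \<open>c_star H\<close> is at least 2\<close>

lemma encodes_encoded_instance:
  assumes "graph H" "inj_on \<nu> (verts H)" "instance_of H G L" "encodes \<nu> G L d" "set BT = pair_codes H \<nu> (better H \<nu>)"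
  shows "\<exists>vs ls es. encoded_instance H \<nu> G L d vs ls es BT (c_star H)"
proof -
  from assms(4) obtain vs ls es where "distinct vs" "set vs = verts G"
      "\<forall>v\<in>verts G. distinct (ls v) \<and> set (ls v) = L v"
      "(\<lambda>(u, v). {u, v}) ` set es = edges G"
      "d = Node
        (enc_list (map (\<lambda>v. Node (enc_nat v) (enc_colors \<nu> (ls v))) vs))
        (enc_list (map (\<lambda>(u, v). Node (enc_nat u) (enc_nat v)) es))"
    unfolding encodes_def by (elim exE conjE) (rule that)
  then have "encoded_instance H \<nu> G L d vs ls es BT (c_star H)"
    by unfold_locales (use assms in simp_all)
  then show ?thesis by blast
qed

text \<open>The factor 2 comes from the approximate vertex cover. The maximum with 1 covers
  \<open>k = 0\<close>, where constraints with the empty tuple may still remain and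
  \<open>0 powr e\<close> would be \<open>0\<close>.\<close>

lemma bigo_max_powr: "(\<lambda>k. A * real (max 1 (2 * k)) powr e) \<in> O(\<lambda>k. real k powr e)"
proof (rule bigoI[where c = "\<bar>A\<bar> * 2 powr e"])
  have "norm (A * real (max 1 (2 * k)) powr e) \<le> \<bar>A\<bar> * 2 powr e * norm (real k powr e)" if "1 \<le> k" for k
  proof -
    have "real (max 1 (2 * k)) = 2 * real k" using that by (simp add: max_def)
    then show ?thesis by (simp add: powr_mult abs_mult)
  qed
  then show "\<forall>\<^sub>F k in sequentially. norm (A * real (max 1 (2 * k)) powr e) \<le> \<bar>A\<bar> * 2 powr e * norm (real k powr e)"
    by (rule eventually_sequentiallyI)
qed

lemma vc_kernel_if_c_star_ge_2:
  fixes H :: "'h graph"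
  assumes H: "graph H" and c2: "2 \<le> c_star H"
  shows "\<exists>f. f \<in> O(\<lambda>k. real k powr (real (d_star H) + 1 - 2 powr (1 - real (c_star H)))) \<and> admits_vc_kernel H f"
proof -
  define c where "c = c_star H"
  define e where "e = real (d_star H) + 1 - 2 powr (1 - real c)"
  define m where "m = Suc (Suc (card (verts H)) * (max 1 (card (verts H))) ^ card (verts H))"
  have c2: "2 \<le> c" using c2 by (simp add: c_def)
  obtain n where n: "c = Suc n" using c2 by (cases c) auto
  obtain C0 where C0: "0 \<le> C0" and erdos: "\<And>(X :: data set) R N. finite X \<Longrightarrow> card X \<le> N \<Longrightarrow> 1 \<le> N \<Longrightarrow>
      R \<subseteq> {xs. set xs \<subseteq> X \<and> length xs = c} \<Longrightarrow> box_free R \<Longrightarrow>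
      real (card R) \<le> C0 * real N powr (real c - 2 powr (1 - real c))"
  proof -
    have "1 - real c = - real n" by (simp add: n)
    then show ?thesis using box_free_card_bound[where ?'a = data, of n] that unfolding n by auto
  qed
  define K where "K = real m * real c + real m + real (m * m ^ c) * C0"
  define f where "f k = (1 + (1 + real c) * K) * real (max 1 (2 * k)) powr e" for k
  have "2 powr (1 - real c) \<le> (1::real)" using powr_mono[of "1 - real c" 0 2] c2 by simp
  moreover have "c \<le> d_star H + 1" using c_star_le_d_star[OF H] by (simp add: c_def)
  \<comment> \<open>The cover vertices themselves belong to the kernel, so the exponent has to allow
    for a linear term.\<close>
  ultimately have e1: "1 \<le> e" using c2 unfolding e_def by linarith
  have "admits_vc_kernel H f"
  proof (rule admits_vc_kernelI)
    fix \<nu> and G :: "nat graph" and L d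
    assume inj: "inj_on \<nu> (verts H)" and G: "instance_of H G L" "encodes \<nu> G L d"
    define BT where "BT = pair_table H \<nu> (better H \<nu>)"
    obtain vs ls es where "encoded_instance H \<nu> G L d vs ls es BT c"
      using encodes_encoded_instance[OF H inj G set_pair_table[OF H], folded c_def BT_def] by (elim exE) (rule that)
    then interpret encoded_instance H \<nu> G L d vs ls es BT c .
    define S where "S = kept (d_star H < c) c BT d"
    interpret kernel_output H \<nu> G L d vs ls es BT c S
      by unfold_locales (simp_all add: S_def distinct_kept set_kept_subset)
    define N where "N = max 1 (2 * vc_number G)"
    have N: "card C \<le> N" "1 \<le> N" using card_C by (auto simp: N_def)
    have lenS: "real (length S) \<le> K * real N powr e"
      unfolding S_def e_def K_def
      by (rule length_kept_bound[OF c2 N C0 erdos]) (use list_codes_bound(2,3)[OF H, of \<nu>] in \<open>simp_all add: m_def\<close>)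
    have "card (verts out_graph) + card (edges out_graph) \<le> card C + length S + c * length S"
      using out_size c2 by (simp add: max_def)
    then have "real (card (verts out_graph) + card (edges out_graph)) \<le> real (card C + length S + c * length S)"
      by (rule of_nat_mono)
    also have "\<dots> = real (card C) + (1 + real c) * real (length S)" by (simp add: algebra_simps)
    also have "\<dots> \<le> real N powr e + (1 + real c) * (K * real N powr e)"
    proof (intro add_mono mult_left_mono lenS)
      have "real (card C) \<le> real N powr 1" using N by simp
      also have "\<dots> \<le> real N powr e" using N e1 by (intro powr_mono) auto
      finally show "real (card C) \<le> real N powr e" .
    qed simp
    also have "\<dots> = f (vc_number G)" by (simp add: f_def N_def algebra_simps)
    finally have size: "real (card (verts out_graph) + card (edges out_graph)) \<le> f (vc_number G)" .
    have "encodes \<nu> out_graph out_lists (kernel (d_star H < c) c BT d)"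
      using out_encodes by (simp add: kernel_def S_def)
    moreover have "list_colorable H out_graph out_lists \<longleftrightarrow> list_colorable H G L"
      using out_colorable_iff list_colorable_iff_kept[OF c2, folded S_def] by (simp only:)
    ultimately show "\<exists>(G' :: nat graph) L'. instance_of H G' L' \<and>
        encodes \<nu> G' L' (kernel (d_star H < c) c (pair_table H \<nu> (better H \<nu>)) d) \<and>
        (list_colorable H G' L' \<longleftrightarrow> list_colorable H G L) \<and>
        real (card (verts G') + card (edges G')) \<le> f (vc_number G)"
      using out_instance size unfolding BT_def by meson
  qed (rule ptime_kernel)
  moreover have "f \<in> O(\<lambda>k. real k powr e)" unfolding f_def[abs_def] by (rule bigo_max_powr)
  ultimately show ?thesis unfolding e_def c_def by blast
qed

section \<open>The case of nested neighborhoods\<close>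

text \<open>In a chain every nonempty list has a color whose neighborhood contains all others. Using
  it everywhere is optimal for all edges at once, so it suffices to check each edge
  separately.\<close>

lemma list_colorable_chain:
  assumes H: "graph H" and G: "instance_of H G L"
    and chain: "\<And>a b. a \<in> verts H \<Longrightarrow> b \<in> verts H \<Longrightarrow> nbh H a \<subseteq> nbh H b \<or> nbh H b \<subseteq> nbh H a"
  shows "list_colorable H G L \<longleftrightarrow> (\<forall>v\<in>verts G. L v \<noteq> {}) \<and>
    (\<forall>u\<in>verts G. \<forall>v\<in>verts G. {u, v} \<in> edges G \<longrightarrow> (\<exists>a\<in>L u. \<exists>b\<in>L v. {a, b} \<in> edges H))"
proof (rule iffI, rule conjI)
  assume col: "list_colorable H G L"
  then obtain \<phi> where \<phi>: "\<And>v. v \<in> verts G \<Longrightarrow> \<phi> v \<in> L v"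
      "\<And>u v. {u, v} \<in> edges G \<Longrightarrow> {\<phi> u, \<phi> v} \<in> edges H"
    by (auto simp: list_colorable_def)
  show "\<forall>v\<in>verts G. L v \<noteq> {}"
  proof
    fix v assume "v \<in> verts G"
    from \<phi>(1)[OF this] show "L v \<noteq> {}" by (rule ex_in_conv[THEN iffD1, OF exI])
  qed
  show "\<forall>u\<in>verts G. \<forall>v\<in>verts G. {u, v} \<in> edges G \<longrightarrow> (\<exists>a\<in>L u. \<exists>b\<in>L v. {a, b} \<in> edges H)"
  proof (intro ballI impI)
    fix u v assume "u \<in> verts G" "v \<in> verts G" and e: "{u, v} \<in> edges G"
    then have "\<phi> u \<in> L u" "\<phi> v \<in> L v" using \<phi>(1) by simp_all
    then show "\<exists>a\<in>L u. \<exists>b\<in>L v. {a, b} \<in> edges H"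
      using \<phi>(2)[OF e] by meson
  qed
next
  assume *: "(\<forall>v\<in>verts G. L v \<noteq> {}) \<and>
    (\<forall>u\<in>verts G. \<forall>v\<in>verts G. {u, v} \<in> edges G \<longrightarrow> (\<exists>a\<in>L u. \<exists>b\<in>L v. {a, b} \<in> edges H))"
  have L: "L v \<subseteq> verts H" if "v \<in> verts G" for v using that G by (simp add: instance_of_def)
  have "\<exists>m. m \<in> L v \<and> (\<forall>a\<in>L v. nbh H a \<subseteq> nbh H m)" if v: "v \<in> verts G" for v
  proof -
    obtain a where "a \<in> L v" using * v by blast
    moreover have "finite (L v)" using L[OF v] H finite_subset by (auto simp: graph_def)
    \<comment> \<open>A constant numbering breaks no ties: only a maximal neighborhood is wanted
      here.\<close>
    ultimately obtain m where "m \<in> best H (\<lambda>_. 0) (L v)" using best_dominates[of "L v" a H "\<lambda>_. 0"] by meson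
    then have m: "m \<in> L v" "\<forall>b\<in>L v. \<not> nbh H m \<subset> nbh H b" by (simp_all add: best_def better_def)
    have "nbh H a \<subseteq> nbh H m" if a: "a \<in> L v" for a
    proof -
      have "a \<in> verts H" "m \<in> verts H" using L[OF v] a m(1) by auto
      moreover have "\<not> nbh H m \<subset> nbh H a" using m(2) a by simp
      ultimately show ?thesis using chain[of a m] by auto
    qed
    with m(1) show ?thesis by meson
  qed
  then have "\<forall>v\<in>verts G. \<exists>m. m \<in> L v \<and> (\<forall>a\<in>L v. nbh H a \<subseteq> nbh H m)" by simp
  from bchoice[OF this] obtain m where m: "\<forall>v\<in>verts G. m v \<in> L v \<and> (\<forall>a\<in>L v. nbh H a \<subseteq> nbh H (m v))" ..
  have "{m u, m v} \<in> edges H" if e: "{u, v} \<in> edges G" for u v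
  proof -
    have uv: "u \<in> verts G" "v \<in> verts G" using graph_edgeD[OF _ e] G by (simp_all add: instance_of_def)
    have "\<exists>a\<in>L u. \<exists>b\<in>L v. {a, b} \<in> edges H" using * e uv by simp
    then obtain a b where ab: "a \<in> L u" "b \<in> L v" "{a, b} \<in> edges H" by (elim bexE) (rule that)
    have mab: "nbh H a \<subseteq> nbh H (m u)" "nbh H b \<subseteq> nbh H (m v)" "m u \<in> L u" using m uv ab(1,2) by simp_all
    have mu: "m u \<in> verts H" using L[OF uv(1)] mab(3) by (rule subsetD)
    have "b \<in> verts H" using ab(2) L[OF uv(2)] by blast
    then show ?thesis using dominated_edge[OF ab(3) _ mu mab(1,2)] by simp
  qed
  then show "list_colorable H G L" unfolding list_colorable_def using m by (intro exI[of _ m]) simp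
qed

text \<open>\<open>AT\<close> is the table of edges of \<open>H\<close>. Nonemptiness and
  implication are phrased by a bounded quantifier and a disjunction, the forms that the rules for
  \<open>ptimeB\<close> handle.\<close>

definition locally_feasible :: "data list \<Rightarrow> data list \<Rightarrow> data \<Rightarrow> bool" where
  "locally_feasible AT BT d \<longleftrightarrow> (\<forall>i\<in>set (items BT d). \<exists>a\<in>set (to_list (tl_data i)). True) \<and>
     (\<forall>i\<in>set (items BT d). \<forall>j\<in>set (items BT d). \<not> adjacent (edge_list d) i j \<or>
        (\<exists>a\<in>set (to_list (tl_data i)). \<exists>b\<in>set (to_list (tl_data j)). Node a b \<in> set AT))"

text \<open>The outputs encode the empty graph, a yes-instance, and the single vertex
  \<open>0\<close> with empty list, a no-instance.\<close>

definition decide_kernel :: "data list \<Rightarrow> data list \<Rightarrow> data \<Rightarrow> data" where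
  "decide_kernel AT BT d =
     (if locally_feasible AT BT d then Node Leaf Leaf else Node (Node (Node Leaf Leaf) Leaf) Leaf)"

lemma ptime_decide_kernel: "ptime (decide_kernel AT BT)"
  unfolding decide_kernel_def[abs_def] locally_feasible_def adjacent_def
  by (intro ptime_intros ptimeL_items ptimeL_comp[OF ptimeL_items] ptimeL_comp[OF ptimeL_edge_list])

lemma (in encoded_instance) locally_feasible_iff:
  assumes c1: "c \<le> 1" and AT: "set AT = pair_codes H \<nu> (\<lambda>a b. {a, b} \<in> edges H)"
  shows "locally_feasible AT BT d \<longleftrightarrow> list_colorable H G L"
proof -
  have its: "set (items BT d) = item ` verts G" by (simp add: items vs(2))
  have codes: "set (to_list (tl_data (item v))) = enc_nat ` \<nu> ` best H \<nu> (L v)" if "v \<in> verts G" for v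
    using best_list(2)[OF that] by (simp add: best_list(3)[OF that] image_comp)
  have AT_iff: "Node (enc_nat (\<nu> a)) (enc_nat (\<nu> b)) \<in> set AT \<longleftrightarrow> {a, b} \<in> edges H"
    if "a \<in> best H \<nu> (L u)" "b \<in> best H \<nu> (L v)" "u \<in> verts G" "v \<in> verts G" for a b u v
    unfolding AT using that L_subset by (intro pair_codes_iff[OF inj]) (auto simp: best_def)
  have ne: "(\<exists>a\<in>set (to_list (tl_data (item v))). True) \<longleftrightarrow> best H \<nu> (L v) \<noteq> {}" if "v \<in> verts G" for v
    unfolding codes[OF that] by auto
  have ex: "(\<exists>a\<in>set (to_list (tl_data (item u))). \<exists>b\<in>set (to_list (tl_data (item v))). Node a b \<in> set AT) \<longleftrightarrow>
      (\<exists>a\<in>best H \<nu> (L u). \<exists>b\<in>best H \<nu> (L v). {a, b} \<in> edges H)" if "u \<in> verts G" "v \<in> verts G" for u v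
    unfolding codes[OF that(1)] codes[OF that(2)] bex_simps by (intro bex_cong refl) (rule AT_iff[OF _ _ that])
  have inst: "instance_of H G (\<lambda>v. best H \<nu> (L v))" using G by (auto simp: instance_of_def best_def)
  have "locally_feasible AT BT d \<longleftrightarrow> (\<forall>v\<in>verts G. best H \<nu> (L v) \<noteq> {}) \<and>
      (\<forall>u\<in>verts G. \<forall>v\<in>verts G. {u, v} \<in> edges G \<longrightarrow>
        (\<exists>a\<in>best H \<nu> (L u). \<exists>b\<in>best H \<nu> (L v). {a, b} \<in> edges H))"
    unfolding locally_feasible_def its ball_simps adjacent
    by (intro arg_cong2[of _ _ _ _ "(\<and>)"] ball_cong refl) (simp_all only: ne ex imp_conv_disj)
  also have "\<dots> \<longleftrightarrow> list_colorable H G (\<lambda>v. best H \<nu> (L v))"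
    by (rule list_colorable_chain[OF H inst, symmetric], rule chain_if_c_star_le_1[OF H]) (use c1 c in simp_all)
  finally show ?thesis using list_colorable_best[OF H G] by simp
qed

lemma vc_kernel_if_c_star_le_1:
  assumes H: "graph H" and c1: "c_star H \<le> 1"
  shows "admits_vc_kernel H (\<lambda>_. 1)"
proof (rule admits_vc_kernelI)
  fix \<nu> and G :: "nat graph" and L d
  assume inj: "inj_on \<nu> (verts H)" and G: "instance_of H G L" "encodes \<nu> G L d"
  define AT where "AT = pair_table H \<nu> (\<lambda>a b. {a, b} \<in> edges H)"
  define BT where "BT = pair_table H \<nu> (better H \<nu>)"
  obtain vs ls es where "encoded_instance H \<nu> G L d vs ls es BT (c_star H)"
    using encodes_encoded_instance[OF H inj G set_pair_table[OF H], folded BT_def] by (elim exE) (rule that)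
  from encoded_instance.locally_feasible_iff[OF this c1 set_pair_table[OF H]]
  have feasible: "locally_feasible AT BT d \<longleftrightarrow> list_colorable H G L" unfolding AT_def .
  define G' :: "nat graph" where "G' = \<lparr>verts = (if locally_feasible AT BT d then {} else {0}), edges = {}\<rparr>"
  have "encodes \<nu> G' (\<lambda>_. {}) (decide_kernel AT BT d)"
    unfolding encodes_def
    by (rule exI[of _ "if locally_feasible AT BT d then [] else [0]"], rule exI[of _ "\<lambda>_. []"], rule exI[of _ "[]"])
      (simp add: G'_def decide_kernel_def enc_nat.simps)
  moreover have "instance_of H G' (\<lambda>_. {})" by (simp add: instance_of_def graph_def G'_def)
  moreover have "list_colorable H G' (\<lambda>_. {}) \<longleftrightarrow> list_colorable H G L"
    unfolding feasible[symmetric] by (simp add: list_colorable_def G'_def)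
  moreover have "real (card (verts G') + card (edges G')) \<le> 1" by (simp add: G'_def)
  ultimately show "\<exists>(G' :: nat graph) L'. instance_of H G' L' \<and>
      encodes \<nu> G' L' (decide_kernel (pair_table H \<nu> (\<lambda>a b. {a, b} \<in> edges H)) (pair_table H \<nu> (better H \<nu>)) d) \<and>
      (list_colorable H G' L' \<longleftrightarrow> list_colorable H G L) \<and> real (card (verts G') + card (edges G')) \<le> 1"
    unfolding AT_def BT_def by meson
qed (rule ptime_decide_kernel)

theorem theorem6:
  fixes H :: "'h graph"
  assumes "graph H" and "\<not> bi_arc_graph H"
  shows "let \<epsilon> = 2 powr (1 - real (c_star H)) in
    \<exists>f :: nat \<Rightarrow> real.
      f \<in> O(\<lambda>k. real k powr (real (d_star H) + 1 - \<epsilon>)) \<and> admits_vc_kernel H f"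
proof (cases "2 \<le> c_star H")
  case True
  then show ?thesis using vc_kernel_if_c_star_ge_2[OF assms(1)] by (simp add: Let_def)
next
  case False
  have "c_star H \<noteq> 0"
    using assms(2) bi_arc_graph_if_complete[of H] complete_if_c_star_0[OF assms(1)] by blast
  with False have c: "c_star H = 1" by simp
  \<comment> \<open>For \<open>c_star H = 1\<close> one has \<epsilon> = 1, so the exponent is
    \<open>d_star H \<ge> 0\<close> and a kernel of constant size is small enough.\<close>
  have "(\<lambda>_. 1) \<in> O(\<lambda>k. real k powr real (d_star H))"
  proof (rule bigoI[where c = 1])
    have "norm (1 :: real) \<le> 1 * norm (real k powr real (d_star H))" if "1 \<le> k" for k
      using that by (simp add: ge_one_powr_ge_zero)
    then show "\<forall>\<^sub>F k in sequentially. norm (1 :: real) \<le> 1 * norm (real k powr real (d_star H))"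
      by (rule eventually_sequentiallyI)
  qed
  moreover have "admits_vc_kernel H (\<lambda>_. 1)" using vc_kernel_if_c_star_le_1[OF assms(1)] c by simp
  ultimately show ?thesis by (auto simp: c Let_def)
qed

end
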